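(* Let $(Y_i,Z_i)_{0\le i\le n}$ be the solution of the scheme $\mathcal E[(F_i),\xi]$ and $(\tilde Y_i,\tilde Z_i)_{0\le i\le n}$ the solution of the perturbed scheme with perturbations $(\zeta^Y_i)$, and set $\delta Y_i=Y_i-\tilde Y_i$. Under the standing assumptions (a)–(e) of the context, there exist constants $C>0$ and $q^*>1$ not depending on $n$ such that for all $0\le i\le n$ $$|\delta Y_i|\le C\Big(\mathbb E_{t_i}\big[|\delta Y_n|^{q^*}\big]^{1/q^*}+\mathbb E_{t_i}\Big[\Big(\sum_{j=i}^{n-1}|\zeta^Y_j|\Big)^{q^*}\Big]^{1/q^*}\Big).$$ Here $q^*$ is the conjugate exponent of an exponent $p^*>1$, not depending on $n$, for which the reverse Hölder inequality $\mathbb E_t[\mathcal D_T^{p^*}/\mathcal D_t^{p^*}]\le C'$, $0\le t\le T$, holds with a constant $C'$ not depending on $n$, where $\mathcal D_t=\prod_{j\ge0:\,t_{j+1}\le t}(1+h_jH_j\gamma_j)$ and $\gamma_j=\frac{F_j(\tilde Y_j,Z_j)-F_j(\tilde Y_j,\tilde Z_j)}{|Z_j-\tilde Z_j|^2}(Z_j-\tilde Z_j)^\top\mathbf 1_{\{Z_j\ne\tilde Z_j\}}$.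
   Context: $(\mathcal F_t)_{0\le t\le T}$ is the Brownian filtration on $(\Omega,\mathcal A,\mathbb P)$ of a $d$-dimensional Brownian motion, $\mathbb E_t[\cdot]=\mathbb E[\cdot|\mathcal F_t]$. For each $n$ the grid is $0=t_0<\dots<t_n=T$, $h_i=t_{i+1}-t_i$, $h=\max_ih_i$, with $hn\le c_1$ and $h_in^\theta\ge c_2$ for constants $c_1,c_2>0$, $\theta\ge1$ independent of $n$. The coefficients $(H_i)_{0\le i<n}$ are independent $\mathbb R^{1\times d}$-valued random vectors such that $H_i$ is $\mathcal F_{t_{i+1}}$-measurable, $\mathbb E_{t_i}[H_i]=0$, and $c_iI_{d\times d}=h_i\mathbb E[H_i^\top H_i]=h_i\mathbb E_{t_i}[H_i^\top H_i]$ with $\lambda/d\le c_i\le\Lambda/d$ for positive constants $\lambda,\Lambda$ independent of $n$. The scheme $\mathcal E[(F_i),\xi]$ has solution $(Y_i,Z_i)_{0\le i\le n}$ (adapted to $(\mathcal F_{t_i})$) defined by $Y_n=\xi$, $Z_n=0$ and, for $0\le i<n$, $Y_i=\mathbb E_{t_i}[Y_{i+1}+h_iF_i(Y_i,Z_i)]$, $Z_i=\mathbb E_{t_i}[Y_{i+1}H_i]$. The perturbed scheme (same $F_i$, $H_i$) has solution $(\tilde Y_i,\tilde Z_i)$ defined by $\tilde Y_n=\tilde\xi\in L^\infty(\mathcal F_T)$, $\tilde Z_n=0$ and, for $0\le i<n$, $\tilde Y_i=\mathbb E_{t_i}[\tilde Y_{i+1}+h_iF_i(\tilde Y_i,\tilde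 Z_i)]+\zeta^Y_i$, $\tilde Z_i=\mathbb E_{t_i}[\tilde Y_{i+1}H_i]$, where $\zeta^Y_i$ is $\mathcal F_{t_i}$-measurable and square integrable, and it is assumed that $\sup_{0\le i<n}\mathbb E_{t_i}[\sum_{j=i}^{n-1}|\tilde Z_j|^2h_j]\le C_0$ for a constant $C_0$ not depending on $n$. Standing assumptions, where $K_y,\varepsilon\in(0,1),\tilde C,\tilde L,\tilde\Lambda$ are positive constants not depending on $n$ and $K_z^n>0$ may depend on $n$: (a) $\xi\in L^\infty(\mathcal F_T)$ (with norm bounded independently of $n$); each $F_i:\Omega\times\mathbb R\times\mathbb R^{1\times d}\to\mathbb R$, $0\le i\le n-1$, is $\mathcal F_{t_i}\otimes\mathcal B(\mathbb R)\otimes\mathcal B(\mathbb R^{1\times d})$-measurable and $|F_i(y,z)-F_i(y',z')|\le K_y|y-y'|+K^n_z|z-z'|$; (b) $hK_y<1-\varepsilon$ and $(\sup_{0\le i\le n-1}h_i|H_i|)K^n_z<1-\varepsilon$; (c) $F_i(0,0)\in L^\infty(\mathcal F_{t_i})$ and $\sup_{0\le i\le n-1}|F_i(0,0)|\le\tilde C$; (d) $|F_i(y,z)|\le K_y|y|+\tilde L|z|^2+\varsigma_i$ for random variables $\varsigma_i$ with $\mathbb E_{t_i}[\sum_{k=i}^{n-1}h_k|\varsigma_k|]\le\tilde\Lambda$ for all $0\le i\le n-1$; (e) $|F_i(y,z)-F_i(y,z')|\le\tilde L(1+|z|+|z'|)|z-z'|$ for all $y,z,z'$ and $0\le i\le n-1$.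 *)

theory Defs
  imports "HOL-Probability.Probability"
begin

text \<open>
  A standard \<open>CARD('d)\<close>-dimensional Brownian motion on the time interval \<open>[0, T]\<close>: it starts at 0,
  has continuous paths, independent increments, and the increment over \<open>[s, t]\<close> has the
  distribution \<open>N(0, (t - s) I)\<close>, given here by its density.
\<close>

definition brownian_motion :: "'a measure \<Rightarrow> real \<Rightarrow> (real \<Rightarrow> 'a \<Rightarrow> real ^ 'd) \<Rightarrow> bool" where
  "brownian_motion M T W \<longleftrightarrow>
     prob_space M \<and>
     (\<forall>t\<in>{0..T}. W t \<in> borel_measurable M) \<and>
     (AE \<omega> in M. W 0 \<omega> = 0) \<and>
     (AE \<omega> in M. continuous_on {0..T} (\<lambda>t. W t \<omega>)) \<and>
     (\<forall>s t. 0 \<le> s \<longrightarrow> s < t \<longrightarrow> t \<le> T \<longrightarrow>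
        distributed M lborel (\<lambda>\<omega>. W t \<omega> - W s \<omega>)
          (\<lambda>x. \<Prod>k\<in>UNIV. ennreal (normal_density 0 (sqrt (t - s)) (x $ k)))) \<and>
     (\<forall>(m::nat) u. (\<forall>k\<le>m. u k \<in> {0..T}) \<longrightarrow> (\<forall>k<m. u k < u (Suc k)) \<longrightarrow>
        prob_space.indep_vars M (\<lambda>_. borel) (\<lambda>k \<omega>. W (u (Suc k)) \<omega> - W (u k) \<omega>) {..<m})"

text \<open>The filtration generated by the Brownian motion, augmented by the null sets.\<close>

definition brownian_filtration :: "'a measure \<Rightarrow> (real \<Rightarrow> 'a \<Rightarrow> real ^ 'd) \<Rightarrow> real \<Rightarrow> 'a measure" where
  "brownian_filtration M W t =
     sigma (space M)
       ({W s -` A \<inter> space M | s A. s \<in> {0..t} \<and> A \<in> sets borel} \<union> null_sets M)"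

lemma subalgebra_brownian_filtration:
  assumes "brownian_motion M T W" "t \<le> T"
  shows "subalgebra M (brownian_filtration M W t)"
proof -
  let ?G = "{W s -` A \<inter> space M | s A. s \<in> {0..t} \<and> A \<in> sets borel} \<union> null_sets M"
  have "W s -` A \<inter> space M \<in> sets M" if "s \<in> {0..t}" "A \<in> sets borel" for s A
    using assms that by (intro measurable_sets[of _ _ borel]) (auto simp: brownian_motion_def)
  then have "?G \<subseteq> sets M"
    by auto
  then have "sigma_sets (space M) ?G \<subseteq> sets M" "?G \<subseteq> Pow (space M)"
    using sets.sigma_sets_subset sets.sets_into_space by blast+
  then show ?thesis
    unfolding subalgebra_def brownian_filtration_def
    by (simp add: space_measure_of_conv sets_measure_of)
qed

text \<open>Conditional expectation of a random vector, taken componentwise.\<close>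

definition vec_cond_exp :: "'a measure \<Rightarrow> 'a measure \<Rightarrow> ('a \<Rightarrow> real ^ 'd) \<Rightarrow> 'a \<Rightarrow> real ^ 'd" where
  "vec_cond_exp M G X \<omega> = (\<chi> k. real_cond_exp M G (\<lambda>\<omega>'. X \<omega>' $ k) \<omega>)"

text \<open>
  Powers \<open>x\<^sup>a\<close> of extended nonnegative reals with exponent \<open>a > 0\<close>. They are needed because the
  conditional moments of the perturbations may be infinite.
\<close>

definition ennreal_powr :: "ennreal \<Rightarrow> real \<Rightarrow> ennreal" where
  "ennreal_powr x a = (if x = \<top> then \<top> else ennreal (enn2real x powr a))"

definition time_grid :: "real \<Rightarrow> nat \<Rightarrow> (nat \<Rightarrow> real) \<Rightarrow> bool" where
  "time_grid T n t \<longleftrightarrow> t 0 = 0 \<and> t n = T \<and> (\<forall>i<n. t i < t (Suc i))"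

definition step :: "(nat \<Rightarrow> real) \<Rightarrow> nat \<Rightarrow> real" where
  "step t i = t (Suc i) - t i"

definition mesh :: "nat \<Rightarrow> (nat \<Rightarrow> real) \<Rightarrow> real" where
  "mesh n t = (MAX i\<in>{..<n}. step t i)"

text \<open>
  Row vectors in \<open>\<real>\<^bsup>1\<times>d\<^esup>\<close> are elements of \<open>real ^ 'd\<close>, so that \<open>H\<^sup>T H\<close> is the
  matrix with entries \<open>H\<^sub>k H\<^sub>l\<close>.
\<close>

definition scheme_coefficients ::
  "'a measure \<Rightarrow> (real \<Rightarrow> 'a measure) \<Rightarrow> nat \<Rightarrow> (nat \<Rightarrow> real) \<Rightarrow> real \<Rightarrow> real \<Rightarrow>
     (nat \<Rightarrow> real) \<Rightarrow> (nat \<Rightarrow> 'a \<Rightarrow> real ^ 'd) \<Rightarrow> bool" where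
  "scheme_coefficients M \<F> n t lmin lmax c H \<longleftrightarrow>
     prob_space.indep_vars M (\<lambda>_. borel) H {..<n} \<and>
     (\<forall>i<n.
        H i \<in> borel_measurable (\<F> (t (Suc i))) \<and>
        (AE \<omega> in M. vec_cond_exp M (\<F> (t i)) (H i) \<omega> = 0) \<and>
        c i *\<^sub>R (mat 1 :: real ^ 'd ^ 'd) =
          step t i *\<^sub>R (\<chi> k l. \<integral>\<omega>. H i \<omega> $ k * H i \<omega> $ l \<partial>M) \<and>
        (AE \<omega> in M. c i *\<^sub>R (mat 1 :: real ^ 'd ^ 'd) =
          step t i *\<^sub>R (\<chi> k l. real_cond_exp M (\<F> (t i)) (\<lambda>\<omega>'. H i \<omega>' $ k * H i \<omega>' $ l) \<omega>)) \<and>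
        lmin / CARD('d) \<le> c i \<and> c i \<le> lmax / CARD('d))"

text \<open>
  Adapted solutions of the perturbed scheme. As the library's conditional expectation is a total
  function, integrability of its arguments is part of the definition.
\<close>

definition perturbed_scheme_solution ::
  "'a measure \<Rightarrow> (real \<Rightarrow> 'a measure) \<Rightarrow> nat \<Rightarrow> (nat \<Rightarrow> real) \<Rightarrow> (nat \<Rightarrow> 'a \<Rightarrow> real ^ 'd) \<Rightarrow>
     (nat \<Rightarrow> 'a \<Rightarrow> real \<Rightarrow> real ^ 'd \<Rightarrow> real) \<Rightarrow> ('a \<Rightarrow> real) \<Rightarrow> (nat \<Rightarrow> 'a \<Rightarrow> real) \<Rightarrow>
     (nat \<Rightarrow> 'a \<Rightarrow> real) \<Rightarrow> (nat \<Rightarrow> 'a \<Rightarrow> real ^ 'd) \<Rightarrow> bool" where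
  "perturbed_scheme_solution M \<F> n t H F \<xi> \<zeta> Y Z \<longleftrightarrow>
     (\<forall>i\<le>n. Y i \<in> borel_measurable (\<F> (t i)) \<and> Z i \<in> borel_measurable (\<F> (t i))) \<and>
     (AE \<omega> in M. Y n \<omega> = \<xi> \<omega>) \<and>
     (AE \<omega> in M. Z n \<omega> = 0) \<and>
     (\<forall>i<n.
        integrable M (\<lambda>\<omega>. Y (Suc i) \<omega> + step t i * F i \<omega> (Y i \<omega>) (Z i \<omega>)) \<and>
        integrable M (\<lambda>\<omega>. Y (Suc i) \<omega> *\<^sub>R H i \<omega>) \<and>
        (AE \<omega> in M. Y i \<omega> =
           real_cond_exp M (\<F> (t i))
             (\<lambda>\<omega>'. Y (Suc i) \<omega>' + step t i * F i \<omega>' (Y i \<omega>') (Z i \<omega>')) \<omega> + \<zeta> i \<omega>) \<and>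
        (AE \<omega> in M. Z i \<omega> = vec_cond_exp M (\<F> (t i)) (\<lambda>\<omega>'. Y (Suc i) \<omega>' *\<^sub>R H i \<omega>') \<omega>))"

definition scheme_solution ::
  "'a measure \<Rightarrow> (real \<Rightarrow> 'a measure) \<Rightarrow> nat \<Rightarrow> (nat \<Rightarrow> real) \<Rightarrow> (nat \<Rightarrow> 'a \<Rightarrow> real ^ 'd) \<Rightarrow>
     (nat \<Rightarrow> 'a \<Rightarrow> real \<Rightarrow> real ^ 'd \<Rightarrow> real) \<Rightarrow> ('a \<Rightarrow> real) \<Rightarrow>
     (nat \<Rightarrow> 'a \<Rightarrow> real) \<Rightarrow> (nat \<Rightarrow> 'a \<Rightarrow> real ^ 'd) \<Rightarrow> bool" where
  "scheme_solution M \<F> n t H F \<xi> Y Z \<longleftrightarrow> perturbed_scheme_solution M \<F> n t H F \<xi> (\<lambda>_ _. 0) Y Z"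

text \<open>\<open>\<gamma>\<^sub>j\<close> is \<open>linearization (F j \<omega>) (Yt j \<omega>) (Z j \<omega>) (Zt j \<omega>)\<close>.\<close>

definition linearization ::
  "(real \<Rightarrow> real ^ 'd \<Rightarrow> real) \<Rightarrow> real \<Rightarrow> real ^ 'd \<Rightarrow> real ^ 'd \<Rightarrow> real ^ 'd" where
  "linearization f y z z' =
     (if z \<noteq> z' then ((f y z - f y z') / (norm (z - z'))\<^sup>2) *\<^sub>R (z - z') else 0)"

definition discrete_exponential ::
  "nat \<Rightarrow> (nat \<Rightarrow> real) \<Rightarrow> (nat \<Rightarrow> 'a \<Rightarrow> real ^ 'd) \<Rightarrow> (nat \<Rightarrow> 'a \<Rightarrow> real ^ 'd) \<Rightarrow>
     real \<Rightarrow> 'a \<Rightarrow> real" where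
  "discrete_exponential n t H \<gamma> s \<omega> =
     (\<Prod>j | j < n \<and> t (Suc j) \<le> s. 1 + step t j * (H j \<omega> \<bullet> \<gamma> j \<omega>))"

end

theory Submission
  imports Defs
begin

text \<open>
  Linearising the difference of the two schemes gives
  \<open>(1 - h\<^sub>i \<beta>\<^sub>i) \<delta>Y\<^sub>i = E\<^sub>i[(1 + h\<^sub>i H\<^sub>i \<gamma>\<^sub>i) \<delta>Y\<^sub>i\<^sub>+\<^sub>1] - \<zeta>\<^sub>i\<close>, whose weights are positive, so that \<open>|\<delta>Y\<^sub>i|\<close> is at
  most a constant times \<open>E\<^sub>i[(D\<^sub>n / D\<^sub>i) (|\<delta>Y\<^sub>n| + \<Sum> |\<zeta>\<^sub>j|)]\<close>, and conditional Hoelder reduces the estimate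
  to the reverse Hoelder inequality for \<open>D\<close>. As \<open>|\<gamma>\<^sub>j|\<close> is at most of order \<open>1 + |Z\<^sub>j| + |Z~\<^sub>j|\<close>, the
  increments \<open>a\<^sub>j = h\<^sub>j H\<^sub>j \<gamma>\<^sub>j\<close> have a bounded remaining bracket
  \<open>u\<^sub>i = E\<^sub>i[\<Sum>\<^sub>j\<^sub>\<ge>\<^sub>i E\<^sub>j a\<^sub>j\<^sup>2]\<close> once this is known for \<open>Z\<close>. For \<open>p\<close> close to 1 the function
  \<open>2 - exp (- k u)\<close> of the bracket is then a supermartingale for the weights \<open>(1 + a)\<^sup>p\<close>, which gives the
  reverse Hoelder inequality without stopping times. The bound on \<open>Z\<close> comes from the drift of
  \<open>exp (k Y)\<close>, which for large \<open>k\<close> dominates \<open>h\<^sub>i |Z\<^sub>i|\<^sup>2\<close> up to terms of order \<open>h\<^sub>i\<close>, where \<open>Y\<close> itself is bounded by comparing it with the zero process, a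
  perturbed solution with \<open>\<zeta>\<^sub>i = - h\<^sub>i F\<^sub>i(0, 0)\<close>.
\<close>

section \<open>Elementary inequalities\<close>

text \<open>The obstacle is that the Lipschitz constant in \<open>z\<close> may grow with the number
  of steps. The increments \<open>a\<close> are then bounded by \<open>1 - e\<close> without being
  small, so uniform estimates must come from conditional second moments of \<open>a\<close>. This is
  why powers, logarithms and exponentials are expanded below with remainders whose constants depend
  on \<open>e\<close> alone or on bounds of the processes. A linear function of the bracket would
  not do as a supermartingale: its jump \<open>x\<close> is correlated with \<open>a\<close>, and
  the conditional mean of the cross term \<open>a * x\<close> is not controlled by that of
  \<open>a^2\<close>. The exponential decouples the two. For \<open>exp (k * Y)\<close> the same
  cross term is welcome: its conditional mean is \<open>h * (Z \<bullet> \<gamma>)\<close>, exactly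
  the part of the driver that has to be cancelled. The argument is not circular: the weights have
  conditional mean 1 without any bound on the bracket, and this suffices to bound
  \<open>Y\<close>.\<close>

lemma powr_Bernoulli_le:
  fixes a r :: real
  assumes "- 1 < a" "0 \<le> r" "r \<le> 1"
  shows "(1 + a) powr r \<le> 1 + r * a"
  using Youngs_inequality_0[of r "1 - r" "1 + a" 1] assms by (simp add: algebra_simps)

text \<open>The concave version with exponent \<open>1 / p\<close>, applied to \<open>p * a\<close>
  and raised to the power \<open>p\<close>. If \<open>1 + p * a\<close> is not positive there is
  nothing to prove.\<close>

lemma powr_Bernoulli_ge:
  fixes a p :: real
  assumes "- 1 < a" "1 \<le> p"
  shows "1 + p * a \<le> (1 + a) powr p"
proof (cases "0 < 1 + p * a")
  case True
  have "(1 + p * a) powr (1 / p) \<le> 1 + a"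
    using powr_Bernoulli_le[of "p * a" "1 / p"] True assms by (auto simp: divide_simps)
  then have "((1 + p * a) powr (1 / p)) powr p \<le> (1 + a) powr p"
    using assms by (intro powr_mono2) auto
  then show ?thesis
    using True assms by (simp add: powr_powr)
next
  case False
  then show ?thesis
    by (smt (verit) powr_ge_zero)
qed

text \<open>One factor \<open>1 + a\<close> is split off and Bernoulli is applied to the remaining
  exponent \<open>p - 1\<close>. What matters is the coefficient \<open>p - 1\<close> of
  \<open>a^2\<close>: it vanishes as \<open>p\<close> tends to 1, although \<open>a\<close> itself
  does not become small.\<close>

lemma powr_one_plus_le:
  fixes a p :: real
  assumes "- 1 < a" "1 \<le> p" "p \<le> 2"
  shows "(1 + a) powr p \<le> 1 + p * a + (p - 1) * a\<^sup>2"
proof -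
  have "(1 + a) powr p = (1 + a) * (1 + a) powr (p - 1)"
    using assms by (simp add: powr_diff)
  also have "\<dots> \<le> (1 + a) * (1 + (p - 1) * a)"
    using assms by (intro mult_left_mono powr_Bernoulli_le) auto
  finally show ?thesis
    by (simp add: algebra_simps power2_eq_square)
qed

lemma ln_one_plus_ge:
  fixes b e :: real
  assumes "0 < e" "e \<le> 1 + b"
  shows "b - b\<^sup>2 / e \<le> ln (1 + b)"
proof -
  have "ln (inverse (1 + b)) \<le> inverse (1 + b) - 1"
    using assms by (intro ln_le_minus_one) auto
  then have "1 - 1 / (1 + b) \<le> ln (1 + b)"
    using assms by (simp add: ln_inverse) (simp add: inverse_eq_divide)
  moreover have "b - b\<^sup>2 / (1 + b) = 1 - 1 / (1 + b)"
    using assms by (simp add: field_simps power2_eq_square)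
  moreover have "b\<^sup>2 / (1 + b) \<le> b\<^sup>2 / e"
    using assms by (intro divide_left_mono) auto
  ultimately show ?thesis by linarith
qed

text \<open>For \<open>w = - u < 0\<close> the sum \<open>1 - u + u^2 / (2 + u)\<close> equals
  \<open>(2 - u) / (2 + u)\<close>, the Pade approximant of \<open>exp (- u)\<close>. The
  denominator grows only linearly in \<open>R\<close>; with \<open>w\<close> of size
  \<open>k\<close> and \<open>R\<close> proportional to \<open>k\<close>, the quadratic term is
  therefore still of order \<open>k\<close>.\<close>

lemma exp_ge_quadratic:
  fixes w R :: real
  assumes "- R \<le> w" "0 \<le> R"
  shows "1 + w + w\<^sup>2 / (2 + R) \<le> exp w"
proof (cases "0 \<le> w")
  case True
  have "w\<^sup>2 / (2 + R) \<le> w\<^sup>2 / 2"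
    using assms by (intro divide_left_mono) auto
  then show ?thesis
    using exp_lower_Taylor_quadratic[OF True] by linarith
next
  case False
  define u where "u = - w"
  have u: "0 < u" "u \<le> R" using False assms by (auto simp: u_def)
  \<comment> \<open>\<open>?g\<close> vanishes at 0, and its derivative
    \<open>1 - exp (- v) * (1 + v)\<close> is nonnegative; \<open>0 \<le> ?g u\<close> is the Pade
    bound with the denominator cleared.\<close>
  let ?g = "\<lambda>v::real. exp (- v) * (2 + v) - 2 + v"
  have "?g 0 \<le> ?g u"
  proof (rule DERIV_nonneg_imp_nondecreasing[where f = ?g])
    fix v :: real assume v: "0 \<le> v" "v \<le> u"
    have "exp (- v) * (1 + v) \<le> exp (- v) * exp v"
      by (intro mult_left_mono exp_ge_add_one_self) auto
    then have "0 \<le> 1 - exp (- v) * (1 + v)"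
      by (simp flip: exp_add)
    moreover have "(?g has_real_derivative 1 - exp (- v) * (1 + v)) (at v)"
      by (auto intro!: derivative_eq_intros simp: algebra_simps)
    ultimately show "\<exists>y. (?g has_real_derivative y) (at v) \<and> 0 \<le> y"
      by blast
  qed (use u in auto)
  then have "2 - u \<le> exp (- u) * (2 + u)" by simp
  then have "1 - u + u\<^sup>2 / (2 + u) \<le> exp (- u)"
    using u by (simp add: field_simps power2_eq_square)
  moreover have "u\<^sup>2 / (2 + R) \<le> u\<^sup>2 / (2 + u)"
    using u by (intro divide_left_mono) auto
  ultimately show ?thesis by (simp add: u_def)
qed

text \<open>The implicit dependence of the scheme on \<open>y\<close> costs a factor
  \<open>1 / (1 - h * Ky)\<close> per step. With an exponent linear in \<open>u\<close> the product
  of these factors depends on the sum of the step sizes only, not on their number.\<close>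

lemma inverse_one_minus_le_exp:
  fixes u e :: real
  assumes "0 \<le> u" "u \<le> 1 - e" "0 < e"
  shows "1 \<le> exp (u / e) * (1 - u)"
proof -
  have "1 / (1 - u) = 1 + u / (1 - u)"
    using assms by (simp add: field_simps)
  also have "\<dots> \<le> 1 + u / e"
    using assms by (intro add_left_mono divide_left_mono) auto
  also have "\<dots> \<le> exp (u / e)" by (rule exp_ge_add_one_self)
  finally show ?thesis
    using assms by (simp add: field_simps)
qed

text \<open>Changing the measure with density \<open>1 + a\<close> before expanding the exponential is what makes the
  coefficient of \<open>x\<^sup>2\<close> grow with \<open>k\<close> although \<open>x\<close> is not small.\<close>

lemma exp_ge_tilted_quadratic:
  fixes a x k B e :: real
  assumes e: "0 < e" "e < 1" and a: "\<bar>a\<bar> \<le> 1 - e" and x: "\<bar>x\<bar> \<le> 2 * B" and "1 \<le> k" "1 \<le> B"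
  shows "1 + k * ((1 + a) * x) + e * k / (10 * B) * x\<^sup>2 - (1 + 1 / e) * a\<^sup>2 \<le> exp (k * x)"
proof -
  define l where "l = ln (1 + a)"
  define w where "w = k * x - l"
  \<comment> \<open>From \<open>x \<ge> - 2 * B\<close> and \<open>l \<le> a < 1\<close> one gets
    \<open>w \<ge> - R\<close>. As \<open>1 \<le> k * B\<close>, the denominator
    \<open>2 + R\<close> is at most \<open>5 * (k * B)\<close>, and half of \<open>(k * x)^2\<close>
    divided by this is \<open>k / (10 * B) * x^2\<close>: the origin of the 10.\<close>
  define R where "R = 2 * (k * B) + 1"
  have pos: "0 < 1 + a" "e \<le> 1 + a" using a e by auto
  have l_le: "l \<le> a" unfolding l_def using ln_add_one_self_le_self2[of a] a e by simp
  have abs_l: "\<bar>l\<bar> \<le> \<bar>a\<bar> / e"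
  proof -
    have "a - a\<^sup>2 / (1 + a) \<le> l" unfolding l_def using pos by (intro ln_one_plus_ge) auto
    moreover have "a - a\<^sup>2 / (1 + a) = a / (1 + a)"
      using pos by (simp add: field_simps power2_eq_square)
    moreover have "\<bar>a / (1 + a)\<bar> \<le> \<bar>a\<bar> / e"
      using pos e by (simp add: abs_divide) (intro divide_left_mono, auto)
    moreover have "\<bar>a\<bar> \<le> \<bar>a\<bar> / e" using e by (simp add: field_simps mult_left_le_one_le)
    ultimately show ?thesis using l_le by linarith
  qed
  have kB: "1 \<le> k * B" using mult_mono[of 1 k 1 B] assms by linarith
  have "\<bar>k * x\<bar> \<le> 2 * (k * B)"
    using mult_left_mono[OF x, of k] assms by (simp add: abs_mult mult_ac)
  then have wR: "- R \<le> w" unfolding w_def R_def using l_le a e by linarith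
  have R: "1 \<le> R" "2 + R \<le> 5 * (k * B)" using kB unfolding R_def by linarith+
  have "exp (k * x) = (1 + a) * exp w"
    using pos by (simp add: w_def l_def exp_diff)
  moreover have "(1 + a) * (1 + w + w\<^sup>2 / (2 + R)) \<le> (1 + a) * exp w"
    using pos R wR by (intro mult_left_mono exp_ge_quadratic) auto
  moreover have "e * (w\<^sup>2 / (2 + R)) \<le> (1 + a) * (w\<^sup>2 / (2 + R))"
    using pos R by (intro mult_right_mono) auto
  moreover have "(1 + a) * l \<le> a + a\<^sup>2"
    using mult_left_mono[OF l_le, of "1 + a"] pos by (simp add: algebra_simps power2_eq_square)
  ultimately have 1: "1 + k * ((1 + a) * x) - a\<^sup>2 + e * (w\<^sup>2 / (2 + R)) \<le> exp (k * x)"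
    by (simp add: algebra_simps w_def)
  have "(k * x)\<^sup>2 / 2 - l\<^sup>2 \<le> w\<^sup>2"
  proof -
    have "0 \<le> (k * x - 2 * l)\<^sup>2" by simp
    then show ?thesis unfolding w_def by (simp add: power2_eq_square algebra_simps)
  qed
  moreover have "l\<^sup>2 \<le> (\<bar>a\<bar> / e)\<^sup>2"
    using abs_l by (metis abs_ge_zero power2_abs power_mono)
  ultimately have "(k * x)\<^sup>2 / 2 - a\<^sup>2 / e\<^sup>2 \<le> w\<^sup>2"
    by (simp add: power_divide)
  then have "((k * x)\<^sup>2 / 2 - a\<^sup>2 / e\<^sup>2) / (2 + R) \<le> w\<^sup>2 / (2 + R)"
    using R by (intro divide_right_mono) auto
  moreover have "(k * x)\<^sup>2 / 2 / (5 * (k * B)) \<le> (k * x)\<^sup>2 / 2 / (2 + R)"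
    using R kB by (intro divide_left_mono) auto
  moreover have "(k * x)\<^sup>2 / 2 / (5 * (k * B)) = k / (10 * B) * x\<^sup>2"
    using assms by (simp add: field_simps power2_eq_square)
  moreover have "a\<^sup>2 / e\<^sup>2 / (2 + R) \<le> a\<^sup>2 / e\<^sup>2"
  proof -
    have "a\<^sup>2 / e\<^sup>2 / (2 + R) \<le> a\<^sup>2 / e\<^sup>2 / 1"
      using R by (intro divide_left_mono) auto
    then show ?thesis by simp
  qed
  ultimately have "k / (10 * B) * x\<^sup>2 - a\<^sup>2 / e\<^sup>2 \<le> w\<^sup>2 / (2 + R)"
    by (simp add: diff_divide_distrib)
  then have "e * (k / (10 * B) * x\<^sup>2 - a\<^sup>2 / e\<^sup>2) \<le> e * (w\<^sup>2 / (2 + R))"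
    using e by (intro mult_left_mono) auto
  moreover have "e * (k / (10 * B) * x\<^sup>2 - a\<^sup>2 / e\<^sup>2) = e * k / (10 * B) * x\<^sup>2 - 1 / e * a\<^sup>2"
    using e by (simp add: field_simps power2_eq_square)
  ultimately show ?thesis
    using 1 by (simp add: algebra_simps)
qed

section \<open>Conditional expectations\<close>

text \<open>A relation, because a conditional expectation is determined only up to null sets and is
  meaningful only for integrable functions. With both facts bundled, the rules below compute the
  conditional mean of a long expression by following its syntax.\<close>

definition has_cond_exp :: "'a measure \<Rightarrow> 'a measure \<Rightarrow> ('a \<Rightarrow> real) \<Rightarrow> ('a \<Rightarrow> real) \<Rightarrow> bool" where
  "has_cond_exp M G f g \<longleftrightarrow> integrable M f \<and> (AE \<omega> in M. real_cond_exp M G f \<omega> = g \<omega>)"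

lemma integrable_AE_bounded_mult:
  fixes f g :: "'a \<Rightarrow> real"
  assumes "f \<in> borel_measurable M" "AE x in M. \<bar>f x\<bar> \<le> B" "integrable M g"
  shows "integrable M (\<lambda>x. f x * g x)"
proof (rule Bochner_Integration.integrable_bound)
  show "integrable M (\<lambda>x. B * g x)" using assms by simp
  show "(\<lambda>x. f x * g x) \<in> borel_measurable M" using assms by measurable
  show "AE x in M. norm (f x * g x) \<le> norm (B * g x)"
    using assms(2) by eventually_elim (auto simp: abs_mult intro!: mult_right_mono)
qed

context sigma_finite_subalgebra
begin

lemma has_cond_expI: "integrable M f \<Longrightarrow> has_cond_exp M F f (real_cond_exp M F f)"
  by (simp add: has_cond_exp_def)

lemma has_cond_exp_self:
  "integrable M f \<Longrightarrow> f \<in> borel_measurable F \<Longrightarrow> has_cond_exp M F f f"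
  by (simp add: has_cond_exp_def)

lemma has_cond_exp_add:
  assumes "has_cond_exp M F f f'" "has_cond_exp M F g g'"
  shows "has_cond_exp M F (\<lambda>x. f x + g x) (\<lambda>x. f' x + g' x)"
  using real_cond_exp_add[of f g] assms unfolding has_cond_exp_def by (auto elim: eventually_elim2)

lemma has_cond_exp_mult:
  assumes "u \<in> borel_measurable F" "integrable M (\<lambda>x. u x * f x)" "has_cond_exp M F f f'"
  shows "has_cond_exp M F (\<lambda>x. u x * f x) (\<lambda>x. u x * f' x)"
  using real_cond_exp_mult[of u f] assms unfolding has_cond_exp_def by (auto elim: eventually_elim2)

lemma has_cond_exp_bounded_mult:
  assumes "u \<in> borel_measurable F" "AE x in M. \<bar>u x\<bar> \<le> B" "has_cond_exp M F f f'"
  shows "has_cond_exp M F (\<lambda>x. u x * f x) (\<lambda>x. u x * f' x)"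
  using assms measurable_from_subalg[OF subalg assms(1)]
  by (intro has_cond_exp_mult integrable_AE_bounded_mult) (auto simp: has_cond_exp_def)

lemma has_cond_exp_cmult:
  "has_cond_exp M F f f' \<Longrightarrow> has_cond_exp M F (\<lambda>x. c * f x) (\<lambda>x. c * f' x)"
  by (rule has_cond_exp_bounded_mult[of _ "\<bar>c\<bar>"]) auto

lemma has_cond_exp_diff:
  assumes "has_cond_exp M F f f'" "has_cond_exp M F g g'"
  shows "has_cond_exp M F (\<lambda>x. f x - g x) (\<lambda>x. f' x - g' x)"
  using has_cond_exp_add[OF assms(1) has_cond_exp_cmult[OF assms(2), of "- 1"]] by simp

lemma has_cond_exp_sum:
  assumes "finite I" "I \<noteq> {}" "\<And>i. i \<in> I \<Longrightarrow> has_cond_exp M F (f i) (f' i)"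
  shows "has_cond_exp M F (\<lambda>x. \<Sum>i\<in>I. f i x) (\<lambda>x. \<Sum>i\<in>I. f' i x)"
  using assms by (induction I rule: finite_ne_induct) (auto intro!: has_cond_exp_add)

lemma has_cond_exp_mono:
  assumes "has_cond_exp M F f f'" "has_cond_exp M F g g'" "AE x in M. f x \<le> g x"
  shows "AE x in M. f' x \<le> g' x"
  using real_cond_exp_mono[of f g] assms unfolding has_cond_exp_def
  by (auto elim!: eventually_elim2)

text \<open>The bridge between the two calculi: drift computations need signed integrands, whereas
  the backward recursions run in \<open>ennreal\<close>, where no integrability has to be
  propagated. Both sides have the same integral over every set of \<open>F\<close>.\<close>

lemma nn_cond_exp_eq_has_cond_exp:
  assumes f: "has_cond_exp M F f f'" and nonneg: "AE x in M. 0 \<le> f x"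
  shows "AE x in M. nn_cond_exp M F (\<lambda>x. ennreal (f x)) x = ennreal (f' x)"
proof -
  have [measurable]: "f \<in> borel_measurable M" and int: "integrable M f"
    using f by (auto simp: has_cond_exp_def)
  have "AE x in M. ennreal (real_cond_exp M F f x) = nn_cond_exp M F (\<lambda>x. ennreal (f x)) x"
  proof (rule nn_cond_exp_charact)
    fix A assume A: "A \<in> sets F"
    then have [measurable]: "A \<in> sets M" using subalg by (auto simp: subalgebra_def)
    have pos: "AE x in M. 0 \<le> real_cond_exp M F f x"
      using nonneg by (rule real_cond_exp_pos) simp
    have "(\<integral>\<^sup>+x\<in>A. ennreal (f x) \<partial>M) = (\<integral>\<^sup>+x. ennreal (indicator A x * f x) \<partial>M)"
      by (intro nn_integral_cong) (auto simp: indicator_def)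
    also have "\<dots> = ennreal (\<integral>x. indicator A x * f x \<partial>M)"
      using integrable_mult_indicator[OF \<open>A \<in> sets M\<close> int] nonneg
      by (intro nn_integral_eq_integral) (auto simp: indicator_def)
    also have "(\<integral>x. indicator A x * f x \<partial>M) = (\<integral>x. indicator A x * real_cond_exp M F f x \<partial>M)"
      using real_cond_exp_intA[OF int A] by (simp add: set_lebesgue_integral_def)
    also have "ennreal \<dots> = (\<integral>\<^sup>+x. ennreal (indicator A x * real_cond_exp M F f x) \<partial>M)"
      using integrable_mult_indicator[OF \<open>A \<in> sets M\<close> real_cond_exp_int(1)[OF int]] pos
      by (intro nn_integral_eq_integral[symmetric]) (auto simp: indicator_def)
    also have "\<dots> = (\<integral>\<^sup>+x\<in>A. ennreal (real_cond_exp M F f x) \<partial>M)"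
      by (intro nn_integral_cong) (auto simp: indicator_def)
    finally show "(\<integral>\<^sup>+x\<in>A. ennreal (f x) \<partial>M) = (\<integral>\<^sup>+x\<in>A. ennreal (real_cond_exp M F f x) \<partial>M)" .
  qed auto
  then show ?thesis
    using f unfolding has_cond_exp_def by (auto elim: eventually_elim2)
qed

lemma nn_cond_exp_cmult:
  assumes [measurable]: "f \<in> borel_measurable M"
  shows "AE x in M. nn_cond_exp M F (\<lambda>x. c * f x) x = c * nn_cond_exp M F f x"
  using nn_cond_exp_prod[of "\<lambda>_. c" f] by (auto elim: eventually_mono)

text \<open>Young's inequality with a rational parameter \<open>r\<close>, chosen afterwards for each point within a
  factor 2 of the optimum.\<close>

lemma nn_cond_exp_Holder:
  fixes p q C :: real and D X :: "'a \<Rightarrow> real"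
  assumes p: "1 < p" "1 < q" "1 / p + 1 / q = 1" and C: "0 \<le> C"
    and [measurable]: "D \<in> borel_measurable M" "X \<in> borel_measurable M"
    and D: "AE x in M. 0 \<le> D x" and X: "AE x in M. 0 \<le> X x"
    and bound: "AE x in M. nn_cond_exp M F (\<lambda>x. ennreal (D x powr p)) x \<le> ennreal C"
  shows "AE x in M. nn_cond_exp M F (\<lambda>x. ennreal (D x * X x)) x \<le>
    ennreal (2 * C + 1) * ennreal_powr (nn_cond_exp M F (\<lambda>x. ennreal (X x powr q)) x) (1 / q)"
proof -
  let ?A = "nn_cond_exp M F (\<lambda>x. ennreal (D x * X x))"
  let ?N = "nn_cond_exp M F (\<lambda>x. ennreal (X x powr q))"
  have young: "AE x in M. ?A x \<le> ennreal (r * C) + ennreal (r powr (1 - q)) * ?N x" if r: "0 < r" for r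
  proof -
    let ?D = "\<lambda>x. ennreal r * ennreal (D x powr p)"
    let ?X = "\<lambda>x. ennreal (r powr (1 - q)) * ennreal (X x powr q)"
    have "AE x in M. ennreal (D x * X x) \<le> ?D x + ?X x"
      using D X
    proof eventually_elim
      case (elim x)
      \<comment> \<open>The product is balanced by \<open>r\<close> before Young's inequality is
        applied. The factors \<open>1 / p\<close> and \<open>1 / q\<close> are discarded, which
        costs only a constant.\<close>
      have "D x * (X x / r) \<le> D x powr p / p + (X x / r) powr q / q"
        using elim p r by (intro Youngs_inequality) auto
      also have "\<dots> \<le> D x powr p / 1 + (X x / r) powr q / 1"
        using p by (intro add_mono divide_left_mono) auto
      finally have "r * (D x * (X x / r)) \<le> r * (D x powr p + (X x / r) powr q)"
        using r by (intro mult_left_mono) auto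
      moreover have "r * (X x / r) powr q = r powr (1 - q) * X x powr q"
        using elim r by (simp add: powr_divide powr_diff)
      ultimately have "D x * X x \<le> r * D x powr p + r powr (1 - q) * X x powr q"
        using r by (simp add: algebra_simps)
      then have "ennreal (D x * X x) \<le> ennreal (r * D x powr p + r powr (1 - q) * X x powr q)"
        by (rule ennreal_leI)
      then show ?case
        using r by (simp add: ennreal_plus ennreal_mult)
    qed
    then have "AE x in M. ?A x \<le> nn_cond_exp M F (\<lambda>x. ?D x + ?X x) x"
      by (rule nn_cond_exp_mono) auto
    moreover have "AE x in M. nn_cond_exp M F ?D x + nn_cond_exp M F ?X x
        = nn_cond_exp M F (\<lambda>x. ?D x + ?X x) x"
      by (rule nn_cond_exp_sum) auto
    moreover have "AE x in M. nn_cond_exp M F ?D x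
        = ennreal r * nn_cond_exp M F (\<lambda>x. ennreal (D x powr p)) x"
      by (rule nn_cond_exp_cmult) auto
    moreover have "AE x in M. nn_cond_exp M F ?X x = ennreal (r powr (1 - q)) * ?N x"
      by (rule nn_cond_exp_cmult) auto
    ultimately show ?thesis
      using bound
    proof eventually_elim
      case (elim x)
      have "ennreal r * nn_cond_exp M F (\<lambda>x. ennreal (D x powr p)) x \<le> ennreal r * ennreal C"
        using elim by (intro mult_left_mono) auto
      then have "nn_cond_exp M F ?D x + nn_cond_exp M F ?X x
          \<le> ennreal (r * C) + ennreal (r powr (1 - q)) * ?N x"
        using r C unfolding elim(3,4) by (intro add_right_mono) (simp add: ennreal_mult)
      then show ?case
        using elim(1) unfolding elim(2)[symmetric] by (rule order_trans[rotated])
    qed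
  qed
  \<comment> \<open>Countably many parameters leave one common null set, so that \<open>r\<close>
    may depend on the point from here on.\<close>
  have "AE x in M. \<forall>r\<in>{r\<in>\<rat>. 0 < r}.
      ?A x \<le> ennreal (r * C) + ennreal (r powr (1 - q)) * ?N x"
    using young countable_rat by (intro AE_ball_countable') (auto intro: countable_subset)
  then show ?thesis
  proof eventually_elim
    case (elim x)
    have le: "?A x \<le> ennreal (r * C) + ennreal (r powr (1 - q)) * ?N x" if "r \<in> \<rat>" "0 < r" for r
      using elim that by auto
    show ?case
    proof (cases "?N x")
      case top
      then show ?thesis using C by (simp add: ennreal_powr_def ennreal_mult_top)
    next
      case (real m)
      have powr: "ennreal_powr (?N x) (1 / q) = ennreal (m powr (1 / q))"
        using real by (simp add: ennreal_powr_def)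
      show ?thesis
      proof (cases "m = 0")
        case True
        \<comment> \<open>Here the infimum over \<open>r\<close> is not attained; \<open>r\<close>
          tends to 0.\<close>
        have "?A x \<le> 0"
        proof (rule ennreal_le_epsilon)
          fix e :: real assume "0 < e"
          then obtain r where r: "r \<in> \<rat>" "0 < r" "r < e / (C + 1)"
            using Rats_dense_in_real[of 0 "e / (C + 1)"] C by auto
          have "r * C \<le> r * (C + 1)" using r by (simp add: algebra_simps)
          also have "\<dots> \<le> e" using r C by (simp add: field_simps)
          finally have "ennreal (r * C) \<le> ennreal e" by (rule ennreal_leI)
          moreover have "?A x \<le> ennreal (r * C)" using le[OF r(1,2)] real True by simp
          ultimately show "?A x \<le> 0 + ennreal e" by simp
        qed
        then show ?thesis by simp
      next
        case False
        define v where "v = m powr (1 / q)"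
        have v: "0 < v" using real False by (simp add: v_def)
        \<comment> \<open>Since \<open>1 - q < 0\<close> and \<open>m = v powr q\<close>, the lower
          bound on \<open>r\<close> gives \<open>r powr (1 - q) * m \<le> v\<close>; the upper bound
          gives \<open>r * C \<le> 2 * v * C\<close>. Together they produce the constant
          \<open>2 * C + 1\<close>.\<close>
        obtain r where r: "r \<in> \<rat>" "v < r" "r < 2 * v"
          using Rats_dense_in_real[of v "2 * v"] v by auto
        have "r powr (1 - q) \<le> v powr (1 - q)"
          using r v p by (intro powr_mono2') auto
        then have "r powr (1 - q) * m \<le> v powr (1 - q) * m"
          using real by (intro mult_right_mono) auto
        also have "\<dots> = m powr ((1 - q) / q + 1)"
          using real False by (simp add: v_def powr_powr powr_add)
        also have "(1 - q) / q + 1 = 1 / q"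
          using p by (simp add: field_simps)
        finally have "r powr (1 - q) * m \<le> v" by (simp add: v_def)
        moreover have "r * C \<le> 2 * v * C"
          using r C by (intro mult_right_mono) auto
        ultimately have "r * C + r powr (1 - q) * m \<le> (2 * C + 1) * v"
          by (simp add: algebra_simps)
        then have "ennreal (r * C + r powr (1 - q) * m) \<le> ennreal ((2 * C + 1) * v)"
          by (rule ennreal_leI)
        then have "ennreal (r * C) + ennreal (r powr (1 - q)) * ?N x \<le> ennreal (2 * C + 1) * ennreal v"
          using r v C real by (simp add: ennreal_plus ennreal_mult)
        then show ?thesis
          using le[of r] r v unfolding powr v_def by (intro order_trans[OF le]) auto
      qed
    qed
  qed
qed

end

section \<open>One step of the scheme\<close>

text \<open>A single step, with \<open>G\<close> the information at its left end. \<open>K\<close>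
  is the Lipschitz constant in \<open>z\<close>, which need not be uniform in the grid: it bounds
  the admissible \<open>\<gamma>\<close> but occurs in no constant of the estimates below.\<close>

locale scheme_step = prob_space M for M :: "'a measure" +
  fixes G :: "'a measure" and H :: "'a \<Rightarrow> real ^ 'd" and h c e K :: real
  assumes subalg: "subalgebra M G"
    and H_meas [measurable]: "H \<in> borel_measurable M"
    and pos: "0 < h" "0 < c" "0 < e" "e < 1" "0 < K"
    and H_bound: "AE \<omega> in M. h * norm (H \<omega>) * K \<le> 1 - e"
    and H_mean: "AE \<omega> in M. vec_cond_exp M G H \<omega> = 0"
    and H_second: "\<And>k l. AE \<omega> in M. h * real_cond_exp M G (\<lambda>\<omega>'. H \<omega>' $ k * H \<omega>' $ l) \<omega> =
      (if k = l then c else 0)"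

sublocale scheme_step \<subseteq> finite_measure_subalgebra M G
  by unfold_locales (rule subalg)

context scheme_step
begin

lemma measurable_G [measurable_dest]: "f \<in> measurable G N \<Longrightarrow> f \<in> measurable M N"
  by (rule measurable_from_subalg[OF subalg])

lemma borel_measurable_vec_nth [measurable]:
  assumes "f \<in> borel_measurable N"
  shows "(\<lambda>\<omega>. (f \<omega> :: real ^ 'd) $ k) \<in> borel_measurable N"
  using borel_measurable_inner[OF assms borel_measurable_const[of "axis k 1"]]
  by (simp add: inner_axis)

lemma H_comp_bound: "AE \<omega> in M. \<bar>H \<omega> $ k\<bar> \<le> (1 - e) / (h * K)"
  using H_bound
proof eventually_elim
  case (elim \<omega>)
  then have "norm (H \<omega>) \<le> (1 - e) / (h * K)"
    using pos by (simp add: field_simps)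
  then show ?case
    using component_le_norm_cart[of "H \<omega>" k] by linarith
qed

text \<open>On a fixed step \<open>H\<close> is essentially bounded, by a constant that may explode
  as the grid is refined. Mere integrability of \<open>f\<close> therefore suffices to define the
  vector of conditional means of \<open>f * H\<close>.\<close>

lemma integrable_H_mult:
  assumes "integrable M f"
  shows "integrable M (\<lambda>\<omega>. H \<omega> $ k * f \<omega>)"
  by (rule integrable_AE_bounded_mult[OF _ H_comp_bound assms]) simp

lemma integrable_bounded:
  fixes f :: "'a \<Rightarrow> real"
  assumes "f \<in> borel_measurable M" "AE \<omega> in M. \<bar>f \<omega>\<bar> \<le> B"
  shows "integrable M f"
  using assms by (intro integrable_const_bound[of _ B]) auto

lemma AE_component_bound:
  fixes \<gamma> :: "'a \<Rightarrow> real ^ 'd"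
  assumes "AE \<omega> in M. norm (\<gamma> \<omega>) \<le> B"
  shows "AE \<omega> in M. \<bar>\<gamma> \<omega> $ k\<bar> \<le> B"
  using assms by eventually_elim (use component_le_norm_cart in \<open>blast intro: order_trans\<close>)

section \<open>Conditional moments of the linear forms \<open>H \<bullet> \<gamma>\<close>\<close>

lemma has_cond_exp_H: "has_cond_exp M G (\<lambda>\<omega>. H \<omega> $ k) (\<lambda>_. 0)"
proof -
  have "integrable M (\<lambda>\<omega>. H \<omega> $ k)"
    using H_comp_bound by (intro integrable_bounded) auto
  moreover have "AE \<omega> in M. real_cond_exp M G (\<lambda>\<omega>'. H \<omega>' $ k) \<omega> = 0"
    using H_mean by eventually_elim (simp add: vec_cond_exp_def vec_eq_iff)
  ultimately show ?thesis by (simp add: has_cond_exp_def)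
qed

lemma has_cond_exp_HH:
  "has_cond_exp M G (\<lambda>\<omega>. H \<omega> $ k * H \<omega> $ l) (\<lambda>_. if k = l then c / h else 0)"
proof -
  have "integrable M (\<lambda>\<omega>. H \<omega> $ k * H \<omega> $ l)"
    using has_cond_exp_H by (intro integrable_H_mult) (simp add: has_cond_exp_def)
  moreover have "AE \<omega> in M. real_cond_exp M G (\<lambda>\<omega>'. H \<omega>' $ k * H \<omega>' $ l) \<omega> =
      (if k = l then c / h else 0)"
    using H_second[of k l] by eventually_elim (use pos in \<open>auto simp: field_simps split: if_splits\<close>)
  ultimately show ?thesis by (simp add: has_cond_exp_def)
qed

context
  fixes \<gamma> :: "'a \<Rightarrow> real ^ 'd" and B :: real
  assumes \<gamma> [measurable]: "\<gamma> \<in> borel_measurable G" and \<gamma>_bound: "AE \<omega> in M. norm (\<gamma> \<omega>) \<le> B"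
begin

lemma has_cond_exp_component_mult:
  "has_cond_exp M G f f' \<Longrightarrow> has_cond_exp M G (\<lambda>\<omega>. \<gamma> \<omega> $ k * f \<omega>) (\<lambda>\<omega>. \<gamma> \<omega> $ k * f' \<omega>)"
  by (rule has_cond_exp_bounded_mult[OF _ AE_component_bound[OF \<gamma>_bound]]) simp

lemma has_cond_exp_inner: "has_cond_exp M G (\<lambda>\<omega>. H \<omega> \<bullet> \<gamma> \<omega>) (\<lambda>_. 0)"
proof -
  have "has_cond_exp M G (\<lambda>\<omega>. \<Sum>k\<in>UNIV. \<gamma> \<omega> $ k * H \<omega> $ k) (\<lambda>\<omega>. \<Sum>k\<in>UNIV. \<gamma> \<omega> $ k * 0)"
    by (intro has_cond_exp_sum has_cond_exp_component_mult has_cond_exp_H) auto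
  then show ?thesis by (simp add: inner_vec_def mult.commute)
qed

text \<open>The mechanism of the linearisation: a term \<open>Z \<bullet> \<gamma>\<close>, with
  \<open>Z\<close> the conditional mean of \<open>f * H\<close>, is the conditional mean of
  \<open>f\<close> against the extra weight \<open>H \<bullet> \<gamma>\<close>, so it can be
  absorbed into a weight \<open>1 + h * (H \<bullet> \<gamma>)\<close>.\<close>

lemma has_cond_exp_inner_mult:
  assumes f: "integrable M f"
  shows "has_cond_exp M G (\<lambda>\<omega>. (H \<omega> \<bullet> \<gamma> \<omega>) * f \<omega>)
    (\<lambda>\<omega>. vec_cond_exp M G (\<lambda>\<omega>'. f \<omega>' *\<^sub>R H \<omega>') \<omega> \<bullet> \<gamma> \<omega>)"
proof -
  have "has_cond_exp M G (\<lambda>\<omega>. \<Sum>k\<in>UNIV. \<gamma> \<omega> $ k * (H \<omega> $ k * f \<omega>))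
     (\<lambda>\<omega>. \<Sum>k\<in>UNIV. \<gamma> \<omega> $ k * real_cond_exp M G (\<lambda>\<omega>. H \<omega> $ k * f \<omega>) \<omega>)"
    using f by (intro has_cond_exp_sum has_cond_exp_component_mult has_cond_expI integrable_H_mult) auto
  then show ?thesis
    by (simp add: inner_vec_def vec_cond_exp_def mult_ac sum_distrib_left)
qed

lemma has_cond_exp_inner_sq:
  "has_cond_exp M G (\<lambda>\<omega>. (H \<omega> \<bullet> \<gamma> \<omega>)\<^sup>2) (\<lambda>\<omega>. c / h * (norm (\<gamma> \<omega>))\<^sup>2)"
proof -
  have "has_cond_exp M G (\<lambda>\<omega>. \<Sum>k\<in>UNIV. \<gamma> \<omega> $ k * (\<Sum>l\<in>UNIV. \<gamma> \<omega> $ l * (H \<omega> $ k * H \<omega> $ l)))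
     (\<lambda>\<omega>. \<Sum>k\<in>UNIV. \<gamma> \<omega> $ k * (\<Sum>l\<in>UNIV. \<gamma> \<omega> $ l * (if k = l then c / h else 0)))"
    by (intro has_cond_exp_sum has_cond_exp_component_mult has_cond_exp_HH) auto
  moreover have "(\<Sum>k\<in>UNIV. \<gamma> \<omega> $ k * (\<Sum>l\<in>UNIV. \<gamma> \<omega> $ l * (H \<omega> $ k * H \<omega> $ l))) = (H \<omega> \<bullet> \<gamma> \<omega>)\<^sup>2" for \<omega>
    by (simp add: inner_vec_def power2_eq_square sum_product sum_distrib_left mult_ac)
  moreover have "(\<Sum>k\<in>UNIV. \<gamma> \<omega> $ k * (\<Sum>l\<in>UNIV. \<gamma> \<omega> $ l * (if k = l then c / h else 0)))
      = c / h * (norm (\<gamma> \<omega>))\<^sup>2" for \<omega>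
    by (simp add: power2_norm_eq_inner inner_vec_def sum_distrib_left mult_ac if_distrib cong: if_cong)
  ultimately show ?thesis by simp
qed

end

text \<open>Bessel's inequality, obtained from \<open>(x - s H \<bullet> Z)\<^sup>2 \<ge> 0\<close> with \<open>s = h / c\<close>; the weight
  \<open>w = 1 / (1 + |Z|)\<close> makes all terms bounded.\<close>

lemma norm_vec_cond_exp_le:
  fixes y Y' :: "'a \<Rightarrow> real"
  assumes [measurable]: "y \<in> borel_measurable G" "Y' \<in> borel_measurable M"
    and y: "AE \<omega> in M. \<bar>y \<omega>\<bar> \<le> B" and Y': "AE \<omega> in M. \<bar>Y' \<omega>\<bar> \<le> B"
    and [measurable]: "Z \<in> borel_measurable G"
    and Z: "AE \<omega> in M. Z \<omega> = vec_cond_exp M G (\<lambda>\<omega>'. Y' \<omega>' *\<^sub>R H \<omega>') \<omega>"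
  shows "AE \<omega> in M. h * (norm (Z \<omega>))\<^sup>2 \<le> c * real_cond_exp M G (\<lambda>\<omega>'. (Y' \<omega>' - y \<omega>')\<^sup>2) \<omega>"
proof -
  define w where "w = (\<lambda>\<omega>. 1 / (1 + norm (Z \<omega>)))"
  define \<gamma> where "\<gamma> = (\<lambda>\<omega>. w \<omega> *\<^sub>R Z \<omega>)"
  let ?x = "\<lambda>\<omega>. Y' \<omega> - y \<omega>"
  have w_pos: "0 < w \<omega>" for \<omega>
    by (simp add: w_def add_pos_nonneg)
  have w_le: "w \<omega> \<le> 1" for \<omega>
    by (simp add: w_def divide_simps add_pos_nonneg)
  have [measurable]: "w \<in> borel_measurable G" unfolding w_def by measurable
  have \<gamma>[measurable]: "\<gamma> \<in> borel_measurable G" unfolding \<gamma>_def by measurable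
  have "norm (\<gamma> \<omega>) \<le> 1" for \<omega>
    by (simp add: \<gamma>_def w_def divide_simps add_pos_nonneg)
  then have \<gamma>_bound: "AE \<omega> in M. norm (\<gamma> \<omega>) \<le> 1" by simp
  have iY: "integrable M Y'" "integrable M y"
    using Y' y by (auto intro!: integrable_bounded)
  have x_bound: "AE \<omega> in M. \<bar>?x \<omega>\<bar> \<le> 2 * B"
    using y Y' by eventually_elim auto
  have "AE \<omega> in M. \<bar>(?x \<omega>)\<^sup>2\<bar> \<le> (2 * B)\<^sup>2"
    using x_bound by eventually_elim (metis abs_ge_zero abs_power2 power2_abs power_mono)
  then have ix2: "integrable M (\<lambda>\<omega>. (?x \<omega>)\<^sup>2)"
    by (rule integrable_bounded[rotated]) measurable
  have 1: "has_cond_exp M G (\<lambda>\<omega>. w \<omega> * (w \<omega> * (?x \<omega>)\<^sup>2))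
      (\<lambda>\<omega>. w \<omega> * (w \<omega> * real_cond_exp M G (\<lambda>\<omega>'. (?x \<omega>')\<^sup>2) \<omega>))"
    using ix2 w_pos w_le
    by (intro has_cond_exp_bounded_mult[where B = 1] has_cond_expI) (auto simp: abs_of_pos)
  have "has_cond_exp M G (\<lambda>\<omega>. (H \<omega> \<bullet> \<gamma> \<omega>) * Y' \<omega> - y \<omega> * (H \<omega> \<bullet> \<gamma> \<omega>))
     (\<lambda>\<omega>. vec_cond_exp M G (\<lambda>\<omega>'. Y' \<omega>' *\<^sub>R H \<omega>') \<omega> \<bullet> \<gamma> \<omega> - y \<omega> * 0)"
    using iY y by (intro has_cond_exp_diff has_cond_exp_inner_mult[OF \<gamma> \<gamma>_bound]
        has_cond_exp_bounded_mult[OF _ y] has_cond_exp_inner[OF \<gamma> \<gamma>_bound]) auto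
  then have "has_cond_exp M G (\<lambda>\<omega>. w \<omega> * ((H \<omega> \<bullet> \<gamma> \<omega>) * Y' \<omega> - y \<omega> * (H \<omega> \<bullet> \<gamma> \<omega>)))
     (\<lambda>\<omega>. w \<omega> * (vec_cond_exp M G (\<lambda>\<omega>'. Y' \<omega>' *\<^sub>R H \<omega>') \<omega> \<bullet> \<gamma> \<omega> - y \<omega> * 0))"
    using w_pos w_le by (intro has_cond_exp_bounded_mult[where B = 1]) (auto simp: abs_of_pos)
  note 2 = has_cond_exp_cmult[OF this, of "2 * h / c"]
  note 3 = has_cond_exp_cmult[OF has_cond_exp_inner_sq[OF \<gamma> \<gamma>_bound], of "(h / c)\<^sup>2"]
  note 4 = has_cond_exp_add[OF has_cond_exp_diff[OF 1 2] 3]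
  have ineq: "AE \<omega> in M. 0 \<le> w \<omega> * (w \<omega> * real_cond_exp M G (\<lambda>\<omega>'. (?x \<omega>')\<^sup>2) \<omega>)
    - 2 * h / c * (w \<omega> * (vec_cond_exp M G (\<lambda>\<omega>'. Y' \<omega>' *\<^sub>R H \<omega>') \<omega> \<bullet> \<gamma> \<omega> - y \<omega> * 0))
    + (h / c)\<^sup>2 * (c / h * (norm (\<gamma> \<omega>))\<^sup>2)"
  proof (rule has_cond_exp_mono[OF has_cond_exp_self 4])
    show "AE \<omega> in M. 0 \<le> w \<omega> * (w \<omega> * (?x \<omega>)\<^sup>2)
       - 2 * h / c * (w \<omega> * ((H \<omega> \<bullet> \<gamma> \<omega>) * Y' \<omega> - y \<omega> * (H \<omega> \<bullet> \<gamma> \<omega>)))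
       + (h / c)\<^sup>2 * (H \<omega> \<bullet> \<gamma> \<omega>)\<^sup>2"
    proof (rule AE_I2)
      fix \<omega>
      have "0 \<le> (w \<omega> * ?x \<omega> - h / c * (H \<omega> \<bullet> \<gamma> \<omega>))\<^sup>2" by simp
      then show "0 \<le> w \<omega> * (w \<omega> * (?x \<omega>)\<^sup>2)
       - 2 * h / c * (w \<omega> * ((H \<omega> \<bullet> \<gamma> \<omega>) * Y' \<omega> - y \<omega> * (H \<omega> \<bullet> \<gamma> \<omega>)))
       + (h / c)\<^sup>2 * (H \<omega> \<bullet> \<gamma> \<omega>)\<^sup>2"
        by (simp add: power2_eq_square algebra_simps)
    qed
  qed auto
  \<comment> \<open>With \<open>N = |Z|^2\<close> the cross term contributes
    \<open>- 2 * (h / c)\<close> and the square \<open>+ h / c\<close> times \<open>v^2 * N\<close>;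
    the choice \<open>s = h / c\<close> maximises what is left. The weight enters every term as
    \<open>v^2\<close> and cancels afterwards.\<close>
  have alg: "0 \<le> v\<^sup>2 * (E - h / c * N)"
    if "0 \<le> v * (v * E) - 2 * h / c * (v * (I - u * 0)) + (h / c)\<^sup>2 * (c / h * S)"
      "I = v * N" "S = v\<^sup>2 * N" for v E I u S N :: real
  proof -
    have "(h / c)\<^sup>2 * (c / h * S) = h / c * S"
      using pos by (simp add: power2_eq_square)
    then have "0 \<le> v * (v * E) - 2 * (h / c) * (v * I) + h / c * S"
      using that(1) by (simp only: mult_zero_right diff_zero times_divide_eq_right)
    also have "\<dots> = v\<^sup>2 * (E - h / c * N)"
      unfolding that(2,3) by (simp only: power2_eq_square) algebra
    finally show ?thesis .
  qed
  from ineq Z show ?thesis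
  proof eventually_elim
    case (elim \<omega>)
    let ?E = "real_cond_exp M G (\<lambda>\<omega>'. (?x \<omega>')\<^sup>2) \<omega>"
    have "vec_cond_exp M G (\<lambda>\<omega>'. Y' \<omega>' *\<^sub>R H \<omega>') \<omega> \<bullet> \<gamma> \<omega> = w \<omega> * (norm (Z \<omega>))\<^sup>2"
      unfolding elim(2)[symmetric] by (simp add: \<gamma>_def power2_norm_eq_inner)
    moreover have "(norm (\<gamma> \<omega>))\<^sup>2 = (w \<omega>)\<^sup>2 * (norm (Z \<omega>))\<^sup>2"
      by (simp add: \<gamma>_def power_mult_distrib)
    ultimately have "0 \<le> (w \<omega>)\<^sup>2 * (?E - h / c * (norm (Z \<omega>))\<^sup>2)"
      using alg[OF elim(1)] by blast
    then have "0 \<le> ?E - h / c * (norm (Z \<omega>))\<^sup>2"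
      using w_pos[of \<omega>] by (simp add: zero_le_mult_iff)
    then show ?case using pos by (simp add: field_simps)
  qed
qed

section \<open>The three one-step estimates: stability, reverse Hoelder, drift of
  \<open>exp (k * Y)\<close>\<close>

lemma increment_bound:
  assumes "AE \<omega> in M. norm (\<gamma> \<omega>) \<le> K"
  shows "AE \<omega> in M. \<bar>h * (H \<omega> \<bullet> \<gamma> \<omega>)\<bar> \<le> 1 - e"
  using assms H_bound
proof eventually_elim
  case (elim \<omega>)
  have "\<bar>H \<omega> \<bullet> \<gamma> \<omega>\<bar> \<le> norm (H \<omega>) * norm (\<gamma> \<omega>)" by (rule Cauchy_Schwarz_ineq2)
  also have "\<dots> \<le> norm (H \<omega>) * K" using elim by (intro mult_left_mono) auto
  finally have "h * \<bar>H \<omega> \<bullet> \<gamma> \<omega>\<bar> \<le> h * (norm (H \<omega>) * K)"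
    using pos by (intro mult_left_mono) auto
  also have "\<dots> \<le> 1 - e" using elim by (simp add: mult.assoc)
  finally show ?case using pos by (simp add: abs_mult)
qed

text \<open>Only the dependence on \<open>z\<close> is linearised. The difference in
  \<open>y\<close> stays as an error of size \<open>h * b * |\<delta>|\<close>, is absorbed on the
  left, and reappears as the factor \<open>exp (h * b / e)\<close>. The result is stated in
  \<open>ennreal\<close>, ready for iteration.\<close>

lemma stability_step:
  fixes \<delta> \<delta>' \<zeta> :: "'a \<Rightarrow> real"
  assumes int: "integrable M \<delta>'"
    and \<gamma> [measurable]: "\<gamma> \<in> borel_measurable G" and \<gamma>_bound: "AE \<omega> in M. norm (\<gamma> \<omega>) \<le> K"
    and b: "0 \<le> b" "h * b \<le> 1 - e"
    and eq: "AE \<omega> in M. \<bar>\<delta> \<omega> - real_cond_exp M G \<delta>' \<omega>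
      - h * (vec_cond_exp M G (\<lambda>\<omega>'. \<delta>' \<omega>' *\<^sub>R H \<omega>') \<omega> \<bullet> \<gamma> \<omega>) + \<zeta> \<omega>\<bar> \<le> h * b * \<bar>\<delta> \<omega>\<bar>"
  shows "AE \<omega> in M. ennreal \<bar>\<delta> \<omega>\<bar> \<le> ennreal (exp (h * b / e)) *
    (nn_cond_exp M G (\<lambda>\<omega>'. ennreal ((1 + h * (H \<omega>' \<bullet> \<gamma> \<omega>')) * \<bar>\<delta>' \<omega>'\<bar>)) \<omega> + ennreal \<bar>\<zeta> \<omega>\<bar>)"
proof -
  let ?f = "\<lambda>\<omega>. (1 + h * (H \<omega> \<bullet> \<gamma> \<omega>)) * \<delta>' \<omega>"
  have [measurable]: "\<delta>' \<in> borel_measurable M" using int by simp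
  have "has_cond_exp M G (\<lambda>\<omega>. \<delta>' \<omega> + h * ((H \<omega> \<bullet> \<gamma> \<omega>) * \<delta>' \<omega>)) (\<lambda>\<omega>. real_cond_exp M G \<delta>' \<omega>
      + h * (vec_cond_exp M G (\<lambda>\<omega>'. \<delta>' \<omega>' *\<^sub>R H \<omega>') \<omega> \<bullet> \<gamma> \<omega>))"
    by (intro has_cond_exp_add has_cond_exp_cmult has_cond_expI int has_cond_exp_inner_mult[OF \<gamma> \<gamma>_bound])
  moreover have "(\<lambda>\<omega>. \<delta>' \<omega> + h * ((H \<omega> \<bullet> \<gamma> \<omega>) * \<delta>' \<omega>)) = ?f"
    by (simp add: algebra_simps)
  ultimately have f: "has_cond_exp M G ?f (\<lambda>\<omega>. real_cond_exp M G \<delta>' \<omega>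
      + h * (vec_cond_exp M G (\<lambda>\<omega>'. \<delta>' \<omega>' *\<^sub>R H \<omega>') \<omega> \<bullet> \<gamma> \<omega>))" by simp
  then have "AE \<omega> in M. real_cond_exp M G ?f \<omega> = real_cond_exp M G \<delta>' \<omega>
      + h * (vec_cond_exp M G (\<lambda>\<omega>'. \<delta>' \<omega>' *\<^sub>R H \<omega>') \<omega> \<bullet> \<gamma> \<omega>)"
    by (simp add: has_cond_exp_def)
  moreover have "AE \<omega> in M. \<bar>real_cond_exp M G ?f \<omega>\<bar> \<le> nn_cond_exp M G (\<lambda>\<omega>. ennreal \<bar>?f \<omega>\<bar>) \<omega>"
    by (rule real_cond_exp_abs) measurable
  \<comment> \<open>Positivity of the weight: the absolute value passes to \<open>\<delta>'\<close>,
    and the weights of successive steps multiply up to a positive martingale ratio.\<close>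
  moreover have "AE \<omega> in M. nn_cond_exp M G (\<lambda>\<omega>. ennreal \<bar>?f \<omega>\<bar>) \<omega> =
      nn_cond_exp M G (\<lambda>\<omega>'. ennreal ((1 + h * (H \<omega>' \<bullet> \<gamma> \<omega>')) * \<bar>\<delta>' \<omega>'\<bar>)) \<omega>"
  proof (rule nn_cond_exp_cong)
    show "AE \<omega> in M. ennreal \<bar>?f \<omega>\<bar> = ennreal ((1 + h * (H \<omega> \<bullet> \<gamma> \<omega>)) * \<bar>\<delta>' \<omega>\<bar>)"
      using increment_bound[OF \<gamma>_bound]
    proof eventually_elim
      case (elim \<omega>)
      then have "0 \<le> 1 + h * (H \<omega> \<bullet> \<gamma> \<omega>)" using pos by linarith
      then show ?case by (simp add: abs_mult)
    qed
  qed measurable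
  ultimately show ?thesis
    using eq
  proof eventually_elim
    case (elim \<omega>)
    define m where "m = real_cond_exp M G ?f \<omega>"
    have "\<bar>\<delta> \<omega> - m + \<zeta> \<omega>\<bar> \<le> h * b * \<bar>\<delta> \<omega>\<bar>"
      using elim(1,4) by (simp add: m_def algebra_simps)
    then have "(1 - h * b) * \<bar>\<delta> \<omega>\<bar> \<le> \<bar>m\<bar> + \<bar>\<zeta> \<omega>\<bar>"
      unfolding left_diff_distrib by linarith
    then have "exp (h * b / e) * ((1 - h * b) * \<bar>\<delta> \<omega>\<bar>) \<le> exp (h * b / e) * (\<bar>m\<bar> + \<bar>\<zeta> \<omega>\<bar>)"
      by (intro mult_left_mono) auto
    moreover have "1 * \<bar>\<delta> \<omega>\<bar> \<le> (exp (h * b / e) * (1 - h * b)) * \<bar>\<delta> \<omega>\<bar>"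
      using b pos by (intro mult_right_mono inverse_one_minus_le_exp) auto
    ultimately have "\<bar>\<delta> \<omega>\<bar> \<le> exp (h * b / e) * (\<bar>m\<bar> + \<bar>\<zeta> \<omega>\<bar>)"
      unfolding mult.assoc by linarith
    then have "ennreal \<bar>\<delta> \<omega>\<bar> \<le> ennreal (exp (h * b / e) * (\<bar>m\<bar> + \<bar>\<zeta> \<omega>\<bar>))"
      by (rule ennreal_leI)
    also have "\<dots> = ennreal (exp (h * b / e)) * (ennreal \<bar>m\<bar> + ennreal \<bar>\<zeta> \<omega>\<bar>)"
      by (simp add: ennreal_mult ennreal_plus)
    also have "\<dots> \<le> ennreal (exp (h * b / e)) * (nn_cond_exp M G
        (\<lambda>\<omega>'. ennreal ((1 + h * (H \<omega>' \<bullet> \<gamma> \<omega>')) * \<bar>\<delta>' \<omega>'\<bar>)) \<omega> + ennreal \<bar>\<zeta> \<omega>\<bar>)"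
      using elim(2) unfolding elim(3) m_def by (intro mult_left_mono add_right_mono) auto
    finally show ?case .
  qed
qed

text \<open>If \<open>u\<close> bounds the conditional bracket that remains, then \<open>2 - exp (- k u)\<close> is a
  supermartingale for the weights \<open>(1 + a)\<^sup>p\<close>. The inequality comes from
  \<open>exp (- k x) (1 + b) \<ge> 1 - k x + ln (1 + b)\<close>, which needs no bound on the size of the jump \<open>x\<close>
  of \<open>u\<close>.\<close>

lemma reverse_Holder_step:
  fixes u U' g :: "'a \<Rightarrow> real" and C p k :: real
  assumes \<gamma> [measurable]: "\<gamma> \<in> borel_measurable G" and \<gamma>_bound: "AE \<omega> in M. norm (\<gamma> \<omega>) \<le> K"
    and [measurable]: "u \<in> borel_measurable G" "U' \<in> borel_measurable M"
    and u: "AE \<omega> in M. 0 \<le> u \<omega> \<and> u \<omega> \<le> C" and U': "AE \<omega> in M. 0 \<le> U' \<omega> \<and> U' \<omega> \<le> C"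
    and decrease: "AE \<omega> in M. real_cond_exp M G U' \<omega> \<le> u \<omega> - g \<omega>"
    and bracket: "AE \<omega> in M. h * c * (norm (\<gamma> \<omega>))\<^sup>2 \<le> g \<omega>"
    and k: "k = 8 / e + 1" and p: "1 \<le> p" "p \<le> 2" "p - 1 \<le> e / 2" "2 * (p - 1) \<le> exp (- k * C)"
  shows "AE \<omega> in M. nn_cond_exp M G (\<lambda>\<omega>'. ennreal ((1 + h * (H \<omega>' \<bullet> \<gamma> \<omega>')) powr p
      * (2 - exp (- k * U' \<omega>')))) \<omega> \<le> ennreal (2 - exp (- k * u \<omega>))"
proof -
  define a where "a = (\<lambda>\<omega>. h * (H \<omega> \<bullet> \<gamma> \<omega>))"
  have [measurable]: "a \<in> borel_measurable M" unfolding a_def by measurable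
  have a_bound: "AE \<omega> in M. \<bar>a \<omega>\<bar> \<le> 1 - e" unfolding a_def by (rule increment_bound[OF \<gamma>_bound])
  have k_pos: "0 < k" using k pos by (simp add: add_pos_pos)
  let ?w = "\<lambda>\<omega>. exp (- k * u \<omega>)"
  \<comment> \<open>A majorant of \<open>?f\<close> with computable conditional mean: the upper
    bound for \<open>(1 + a)^p\<close> is used in the part with factor 2, a lower bound in the part
    with \<open>exp (- k * U')\<close>. In it \<open>U'\<close> and \<open>a\<close> occur only
    separately.\<close>
  let ?q = "\<lambda>\<omega>. (p - 1) * 2 * (a \<omega>)\<^sup>2 + (p * 2) * a \<omega> + 2
     - ?w \<omega> * (1 - k * (U' \<omega> - u \<omega>) + p * a \<omega> - (2 * p\<^sup>2 / e) * (a \<omega>)\<^sup>2)"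
  let ?f = "\<lambda>\<omega>. (1 + a \<omega>) powr p * (2 - exp (- k * U' \<omega>))"
  have a1: "has_cond_exp M G a (\<lambda>_. 0)"
    using has_cond_exp_cmult[OF has_cond_exp_inner[OF \<gamma> \<gamma>_bound], of h] by (simp add: a_def)
  have a2: "has_cond_exp M G (\<lambda>\<omega>. (a \<omega>)\<^sup>2) (\<lambda>\<omega>. h * c * (norm (\<gamma> \<omega>))\<^sup>2)"
    using has_cond_exp_cmult[OF has_cond_exp_inner_sq[OF \<gamma> \<gamma>_bound], of "h\<^sup>2"] pos
    by (simp add: a_def power_mult_distrib power2_eq_square field_simps)
  have int: "integrable M U'" "integrable M u"
    using u U' by (auto intro!: integrable_bounded[where B = C] elim: eventually_mono)
  have w: "?w \<in> borel_measurable G" "AE \<omega> in M. \<bar>?w \<omega>\<bar> \<le> 1"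
    using u by (measurable, auto elim!: eventually_mono simp: k_pos less_imp_le)
  have const: "has_cond_exp M G (\<lambda>_. r) (\<lambda>_. r)" for r :: real
    by (rule has_cond_exp_self) auto
  have q: "has_cond_exp M G ?q (\<lambda>\<omega>. (p - 1) * 2 * (h * c * (norm (\<gamma> \<omega>))\<^sup>2) + (p * 2) * 0 + 2
     - ?w \<omega> * (1 - k * (real_cond_exp M G U' \<omega> - u \<omega>) + p * 0 - (2 * p\<^sup>2 / e) * (h * c * (norm (\<gamma> \<omega>))\<^sup>2)))"
    using int by (intro has_cond_exp_diff has_cond_exp_add has_cond_exp_cmult a1 a2 const
        has_cond_exp_bounded_mult[OF w] has_cond_expI has_cond_exp_self) auto
  have le: "AE \<omega> in M. ?f \<omega> \<le> ?q \<omega>"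
    using a_bound
  proof eventually_elim
    case (elim \<omega>)
    have a: "- 1 < a \<omega>" "\<bar>a \<omega>\<bar> \<le> 1 - e" using elim pos by auto
    \<comment> \<open>The condition \<open>p - 1 \<le> e / 2\<close> is made for this:
      \<open>1 + p * a\<close> stays away from 0 and its logarithm has a quadratic remainder with
      constant \<open>2 / e\<close>.\<close>
    have pa: "e / 2 \<le> 1 + p * a \<omega>"
    proof -
      have "\<bar>p * a \<omega>\<bar> \<le> p * (1 - e)"
        using a p by (simp add: abs_mult mult_left_mono)
      also have "\<dots> = 1 - e + (p - 1) * (1 - e)" by (simp add: algebra_simps)
      also have "(p - 1) * (1 - e) \<le> (e / 2) * 1"
        using p pos by (intro mult_mono) auto
      finally show ?thesis by linarith
    qed
    have "p * a \<omega> - (p * a \<omega>)\<^sup>2 / (e / 2) \<le> ln (1 + p * a \<omega>)"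
      using pos pa by (intro ln_one_plus_ge) auto
    moreover have "(p * a \<omega>)\<^sup>2 / (e / 2) = (2 * p\<^sup>2 / e) * (a \<omega>)\<^sup>2"
      by (simp add: power_mult_distrib)
    moreover have "1 + (- k * (U' \<omega> - u \<omega>) + ln (1 + p * a \<omega>)) \<le> exp (- k * (U' \<omega> - u \<omega>) + ln (1 + p * a \<omega>))"
      by (rule exp_ge_add_one_self)
    moreover have "exp (- k * (U' \<omega> - u \<omega>) + ln (1 + p * a \<omega>)) = exp (- k * (U' \<omega> - u \<omega>)) * (1 + p * a \<omega>)"
      using pa pos unfolding exp_add by (subst exp_ln) auto
    ultimately have "1 - k * (U' \<omega> - u \<omega>) + p * a \<omega> - (2 * p\<^sup>2 / e) * (a \<omega>)\<^sup>2
        \<le> exp (- k * (U' \<omega> - u \<omega>)) * (1 + p * a \<omega>)"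
      by linarith
    then have "?w \<omega> * (1 - k * (U' \<omega> - u \<omega>) + p * a \<omega> - (2 * p\<^sup>2 / e) * (a \<omega>)\<^sup>2)
        \<le> ?w \<omega> * (exp (- k * (U' \<omega> - u \<omega>)) * (1 + p * a \<omega>))"
      by (intro mult_left_mono) auto
    also have "\<dots> = exp (- k * U' \<omega>) * (1 + p * a \<omega>)"
      by (simp add: algebra_simps flip: exp_add mult.assoc)
    also have "\<dots> \<le> exp (- k * U' \<omega>) * (1 + a \<omega>) powr p"
      using a p by (intro mult_left_mono powr_Bernoulli_ge) auto
    finally have "?w \<omega> * (1 - k * (U' \<omega> - u \<omega>) + p * a \<omega> - (2 * p\<^sup>2 / e) * (a \<omega>)\<^sup>2)
        \<le> exp (- k * U' \<omega>) * (1 + a \<omega>) powr p" .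
    moreover have "(1 + a \<omega>) powr p * 2 \<le> (1 + p * a \<omega> + (p - 1) * (a \<omega>)\<^sup>2) * 2"
      using a p by (intro mult_right_mono powr_one_plus_le) auto
    ultimately show ?case by (simp add: algebra_simps)
  qed
  have f_nonneg: "AE \<omega> in M. 0 \<le> ?f \<omega>"
    using U'
  proof eventually_elim
    case (elim \<omega>)
    then have "exp (- k * U' \<omega>) \<le> 1" using k_pos by simp
    then have "0 \<le> 2 - exp (- k * U' \<omega>)" by linarith
    then show ?case by (intro mult_nonneg_nonneg) auto
  qed
  have "AE \<omega> in M. nn_cond_exp M G (\<lambda>\<omega>. ennreal (?f \<omega>)) \<omega> \<le> nn_cond_exp M G (\<lambda>\<omega>. ennreal (?q \<omega>)) \<omega>"
    using le by (intro nn_cond_exp_mono) (auto elim!: eventually_mono intro: ennreal_leI)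
  moreover have "AE \<omega> in M. 0 \<le> ?q \<omega>"
    using le f_nonneg by eventually_elim linarith
  note nn_cond_exp_eq_has_cond_exp[OF q this]
  ultimately show ?thesis
    using u decrease bracket
  proof eventually_elim
    case (elim \<omega>)
    let ?A = "h * c * (norm (\<gamma> \<omega>))\<^sup>2"
    have A: "0 \<le> ?A" using pos by simp
    \<comment> \<open>The remainder of the logarithm costs at most \<open>8 / e\<close> times
      \<open>?A\<close>, while the decrease of the bracket yields \<open>k\<close> times
      \<open>?A\<close>. With \<open>k = 8 / e + 1\<close> exactly one \<open>?A\<close> is left
      over, multiplied by \<open>?w\<close>.\<close>
    have "p\<^sup>2 \<le> 2\<^sup>2" using p by (intro power_mono) auto
    then have "(2 * p\<^sup>2 / e) * ?A \<le> 8 / e * ?A"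
      using pos A by (intro mult_right_mono divide_right_mono) auto
    moreover have "k * g \<omega> \<ge> k * ?A" using elim k_pos by (intro mult_left_mono) auto
    moreover have "k * (u \<omega> - real_cond_exp M G U' \<omega>) \<ge> k * g \<omega>"
      using elim k_pos by (intro mult_left_mono) auto
    ultimately have "1 + ?A \<le> 1 - k * (real_cond_exp M G U' \<omega> - u \<omega>) + p * 0 - (2 * p\<^sup>2 / e) * ?A"
      unfolding k by (simp add: algebra_simps)
    then have "?w \<omega> * (1 + ?A) \<le> ?w \<omega> * (1 - k * (real_cond_exp M G U' \<omega> - u \<omega>) + p * 0 - (2 * p\<^sup>2 / e) * ?A)"
      by (intro mult_left_mono) auto
    \<comment> \<open>The surplus \<open>?w * ?A\<close> must pay for the term
      \<open>2 * (p - 1) * ?A\<close> of the upper bound. As \<open>?w\<close> can be as small as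
      \<open>exp (- k * C)\<close>, this fixes how close to 1 the exponent must be.\<close>
    moreover have "2 * (p - 1) \<le> ?w \<omega>"
    proof -
      have "exp (- k * C) \<le> exp (- k * u \<omega>)" using elim k_pos by simp
      then show ?thesis using p by linarith
    qed
    then have "2 * (p - 1) * ?A \<le> ?w \<omega> * ?A" using A by (intro mult_right_mono) auto
    ultimately have "(p - 1) * 2 * ?A + (p * 2) * 0 + 2 - ?w \<omega> * (1 - k * (real_cond_exp M G U' \<omega> - u \<omega>)
       + p * 0 - (2 * p\<^sup>2 / e) * ?A) \<le> 2 - ?w \<omega>"
      by (simp add: algebra_simps)
    then have *: "ennreal ((p - 1) * 2 * ?A + (p * 2) * 0 + 2 - ?w \<omega> * (1 - k * (real_cond_exp M G U' \<omega> - u \<omega>)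
       + p * 0 - (2 * p\<^sup>2 / e) * ?A)) \<le> ennreal (2 - ?w \<omega>)"
      by (rule ennreal_leI)
    note elim(1)
    also note elim(2)
    also note *
    finally show ?case unfolding a_def .
  qed
qed

text \<open>With \<open>x = Y' - y\<close>, the tilted term \<open>(1 + a) * x\<close> has
  conditional mean \<open>- h * f\<close>, because the part \<open>Z \<bullet> \<gamma>\<close> of
  the driver is cancelled. The term in \<open>x^2\<close> is worth at least
  \<open>h * |Z|^2 / c\<close> by Bessel's inequality, and \<open>a^2\<close> costs at most a
  multiple of \<open>h * (1 + |Z|^2)\<close>. The last condition on \<open>k\<close> says that the
  gain pays for this cost and still leaves one full \<open>h * |Z|^2\<close>.\<close>

lemma exponential_step:
  fixes y Y' f :: "'a \<Rightarrow> real" and B b L k c0 :: real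
  assumes [measurable]: "y \<in> borel_measurable G" "Y' \<in> borel_measurable M"
    and y: "AE \<omega> in M. \<bar>y \<omega>\<bar> \<le> B" and Y': "AE \<omega> in M. \<bar>Y' \<omega>\<bar> \<le> B"
    and Z [measurable]: "Z \<in> borel_measurable G"
    and Z_eq: "AE \<omega> in M. Z \<omega> = vec_cond_exp M G (\<lambda>\<omega>'. Y' \<omega>' *\<^sub>R H \<omega>') \<omega>"
    and \<gamma> [measurable]: "\<gamma> \<in> borel_measurable G" and \<gamma>_bound: "AE \<omega> in M. norm (\<gamma> \<omega>) \<le> K"
    and \<gamma>_Z: "AE \<omega> in M. norm (\<gamma> \<omega>) \<le> L * (1 + norm (Z \<omega>))"
    and eq: "AE \<omega> in M. y \<omega> = real_cond_exp M G Y' \<omega> + h * (f \<omega> + Z \<omega> \<bullet> \<gamma> \<omega>)"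
    and f: "AE \<omega> in M. \<bar>f \<omega>\<bar> \<le> b"
    and const: "1 \<le> B" "1 \<le> k" "0 \<le> L" "c \<le> c0"
      "1 + 2 * (1 + 1 / e) * c0 * L\<^sup>2 \<le> e * k / (10 * B) / c0"
  shows "AE \<omega> in M. exp (k * y \<omega>) * (1 + h * (norm (Z \<omega>))\<^sup>2 - h * (k * b + 2 * (1 + 1 / e) * c0 * L\<^sup>2))
    \<le> real_cond_exp M G (\<lambda>\<omega>'. exp (k * Y' \<omega>')) \<omega>"
proof -
  define a where "a = (\<lambda>\<omega>. h * (H \<omega> \<bullet> \<gamma> \<omega>))"
  define x where "x = (\<lambda>\<omega>. Y' \<omega> - y \<omega>)"
  define v where "v = e * k / (10 * B)"
  define r where "r = 1 + 1 / e"
  have v: "0 < v" and r: "0 < r" using pos const by (auto simp: v_def r_def add_pos_pos)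
  have c0: "0 < c0" using pos const by linarith
  have [measurable]: "a \<in> borel_measurable M" "x \<in> borel_measurable M"
    unfolding a_def x_def by measurable
  have a_bound: "AE \<omega> in M. \<bar>a \<omega>\<bar> \<le> 1 - e" unfolding a_def by (rule increment_bound[OF \<gamma>_bound])
  have x_bound: "AE \<omega> in M. \<bar>x \<omega>\<bar> \<le> 2 * B"
    using y Y' unfolding x_def by eventually_elim auto
  have iY: "integrable M Y'" "integrable M y"
    using Y' y by (auto intro!: integrable_bounded)
  have "AE \<omega> in M. \<bar>(x \<omega>)\<^sup>2\<bar> \<le> (2 * B)\<^sup>2"
    using x_bound by eventually_elim (metis abs_ge_zero abs_power2 power2_abs power_mono)
  then have ix2: "integrable M (\<lambda>\<omega>. (x \<omega>)\<^sup>2)"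
    by (rule integrable_bounded[rotated]) measurable
  have "AE \<omega> in M. \<bar>exp (k * Y' \<omega>)\<bar> \<le> exp (k * B)"
    using Y' by eventually_elim (use const in auto)
  then have iexp: "integrable M (\<lambda>\<omega>. exp (k * Y' \<omega>))"
    by (rule integrable_bounded[rotated]) measurable
  have w: "(\<lambda>\<omega>. exp (k * y \<omega>)) \<in> borel_measurable G" "AE \<omega> in M. \<bar>exp (k * y \<omega>)\<bar> \<le> exp (k * B)"
    using y by (measurable, auto elim!: eventually_mono simp: const) (use const in auto)
  let ?VZ = "vec_cond_exp M G (\<lambda>\<omega>'. Y' \<omega>' *\<^sub>R H \<omega>')"
  let ?Ex2 = "real_cond_exp M G (\<lambda>\<omega>'. (x \<omega>')\<^sup>2)"
  \<comment> \<open>The tilted quadratic with \<open>(1 + a) * x\<close> multiplied out, so that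
    \<open>H\<close> occurs only in the linear forms whose conditional moments are known.\<close>
  let ?q = "\<lambda>\<omega>. exp (k * y \<omega>) * (1 + k * (Y' \<omega> - y \<omega> + h * ((H \<omega> \<bullet> \<gamma> \<omega>) * Y' \<omega> - y \<omega> * (H \<omega> \<bullet> \<gamma> \<omega>)))
      + v * (x \<omega>)\<^sup>2 - (r * h\<^sup>2) * (H \<omega> \<bullet> \<gamma> \<omega>)\<^sup>2)"
  have q: "has_cond_exp M G ?q (\<lambda>\<omega>. exp (k * y \<omega>) * (1 + k * (real_cond_exp M G Y' \<omega> - y \<omega>
        + h * (?VZ \<omega> \<bullet> \<gamma> \<omega> - y \<omega> * 0)) + v * ?Ex2 \<omega> - (r * h\<^sup>2) * (c / h * (norm (\<gamma> \<omega>))\<^sup>2)))"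
    using iY ix2
    by (intro has_cond_exp_bounded_mult[OF w] has_cond_exp_diff has_cond_exp_add has_cond_exp_cmult
        has_cond_exp_inner[OF \<gamma> \<gamma>_bound] has_cond_exp_inner_sq[OF \<gamma> \<gamma>_bound]
        has_cond_exp_inner_mult[OF \<gamma> \<gamma>_bound] has_cond_exp_bounded_mult[OF _ y]
        has_cond_expI has_cond_exp_self) auto
  have "AE \<omega> in M. ?q \<omega> \<le> exp (k * Y' \<omega>)"
    using a_bound x_bound
  proof eventually_elim
    case (elim \<omega>)
    have "1 + k * ((1 + a \<omega>) * x \<omega>) + e * k / (10 * B) * (x \<omega>)\<^sup>2 - (1 + 1 / e) * (a \<omega>)\<^sup>2 \<le> exp (k * x \<omega>)"
      using elim pos const by (intro exp_ge_tilted_quadratic) auto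
    then have "exp (k * y \<omega>) * (1 + k * ((1 + a \<omega>) * x \<omega>) + v * (x \<omega>)\<^sup>2 - r * (a \<omega>)\<^sup>2)
        \<le> exp (k * y \<omega>) * exp (k * x \<omega>)"
      unfolding v_def r_def by (intro mult_left_mono) auto
    also have "\<dots> = exp (k * Y' \<omega>)"
      by (simp add: x_def algebra_simps flip: exp_add)
    finally show ?case
      by (simp add: a_def x_def power_mult_distrib algebra_simps)
  qed
  then have "AE \<omega> in M. exp (k * y \<omega>) * (1 + k * (real_cond_exp M G Y' \<omega> - y \<omega>
        + h * (?VZ \<omega> \<bullet> \<gamma> \<omega> - y \<omega> * 0)) + v * ?Ex2 \<omega> - (r * h\<^sup>2) * (c / h * (norm (\<gamma> \<omega>))\<^sup>2))
      \<le> real_cond_exp M G (\<lambda>\<omega>. exp (k * Y' \<omega>)) \<omega>"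
    by (rule has_cond_exp_mono[OF q has_cond_expI[OF iexp]])
  moreover have "AE \<omega> in M. h * (norm (Z \<omega>))\<^sup>2 \<le> c * ?Ex2 \<omega>"
    unfolding x_def by (rule norm_vec_cond_exp_le[OF _ _ y Y' Z Z_eq]) measurable
  ultimately show ?thesis
    using Z_eq \<gamma>_Z eq f
  proof eventually_elim
    case (elim \<omega>)
    define N where "N = (norm (Z \<omega>))\<^sup>2"
    \<comment> \<open>The cancellation for which the tilt was introduced; only the bounded part
      \<open>f\<close> of the driver survives.\<close>
    have "real_cond_exp M G Y' \<omega> - y \<omega> + h * (?VZ \<omega> \<bullet> \<gamma> \<omega> - y \<omega> * 0) = - (h * f \<omega>)"
      using elim(5) unfolding elim(3)[symmetric] by (simp add: algebra_simps)
    moreover have "k * (h * f \<omega>) \<le> k * (h * b)"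
      using elim(6) pos const by (intro mult_left_mono) auto
    ultimately have 1: "- (k * (h * b)) \<le> k * (real_cond_exp M G Y' \<omega> - y \<omega> + h * (?VZ \<omega> \<bullet> \<gamma> \<omega> - y \<omega> * 0))"
      by simp
    have "h * N / c0 \<le> h * N / c"
      using pos const by (intro divide_left_mono) (auto simp: N_def)
    also have "\<dots> \<le> ?Ex2 \<omega>"
      using elim(2) pos by (simp add: N_def field_simps)
    finally have 2: "v * (h * N / c0) \<le> v * ?Ex2 \<omega>"
      using v by (intro mult_left_mono) auto
    have "(norm (\<gamma> \<omega>))\<^sup>2 \<le> (L * (1 + norm (Z \<omega>)))\<^sup>2"
      using elim(4) by (intro power_mono) auto
    also have "\<dots> = L\<^sup>2 * (1 + norm (Z \<omega>))\<^sup>2" by (simp add: power_mult_distrib)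
    also have "\<dots> \<le> L\<^sup>2 * (2 * (1 + N))"
    proof (rule mult_left_mono)
      have "0 \<le> (1 - norm (Z \<omega>))\<^sup>2" by simp
      then show "(1 + norm (Z \<omega>))\<^sup>2 \<le> 2 * (1 + N)"
        by (simp add: N_def power2_eq_square algebra_simps)
    qed simp
    finally have "r * h * c * (norm (\<gamma> \<omega>))\<^sup>2 \<le> r * h * c0 * (L\<^sup>2 * (2 * (1 + N)))"
      using r pos const by (intro mult_mono) auto
    moreover have "(r * h\<^sup>2) * (c / h * (norm (\<gamma> \<omega>))\<^sup>2) = r * h * c * (norm (\<gamma> \<omega>))\<^sup>2"
      using pos by (simp add: power2_eq_square)
    ultimately have 3: "(r * h\<^sup>2) * (c / h * (norm (\<gamma> \<omega>))\<^sup>2) \<le> h * (2 * r * c0 * L\<^sup>2) * (1 + N)"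
      by (simp add: algebra_simps)
    \<comment> \<open>The 1 on the left is the \<open>h * |Z|^2\<close> that remains as a gain; the
      other summand pays for the part of the \<open>a^2\<close> term proportional to
      \<open>N\<close>.\<close>
    have "(h * N) * (1 + 2 * r * c0 * L\<^sup>2) \<le> (h * N) * (v / c0)"
      using const(5) pos unfolding v_def r_def N_def by (intro mult_left_mono) auto
    then have "h * N + h * (2 * r * c0 * L\<^sup>2) * N \<le> v * (h * N / c0)"
      by (simp add: algebra_simps)
    moreover have "h * (2 * r * c0 * L\<^sup>2) * (1 + N)
        = h * (2 * r * c0 * L\<^sup>2) + h * (2 * r * c0 * L\<^sup>2) * N"
      by (simp add: algebra_simps)
    moreover have "h * (k * b + 2 * r * c0 * L\<^sup>2) = k * (h * b) + h * (2 * r * c0 * L\<^sup>2)"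
      by (simp add: algebra_simps)
    ultimately have "1 + h * N - h * (k * b + 2 * r * c0 * L\<^sup>2) \<le>
       1 + k * (real_cond_exp M G Y' \<omega> - y \<omega> + h * (?VZ \<omega> \<bullet> \<gamma> \<omega> - y \<omega> * 0)) + v * ?Ex2 \<omega>
         - (r * h\<^sup>2) * (c / h * (norm (\<gamma> \<omega>))\<^sup>2)"
      using 1 2 3 by linarith
    then have "exp (k * y \<omega>) * (1 + h * N - h * (k * b + 2 * r * c0 * L\<^sup>2)) \<le> exp (k * y \<omega>) *
       (1 + k * (real_cond_exp M G Y' \<omega> - y \<omega> + h * (?VZ \<omega> \<bullet> \<gamma> \<omega> - y \<omega> * 0)) + v * ?Ex2 \<omega>
         - (r * h\<^sup>2) * (c / h * (norm (\<gamma> \<omega>))\<^sup>2))"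
      by (intro mult_left_mono) auto
    also note elim(1)
    finally show ?case by (simp add: N_def r_def)
  qed
qed

end

section \<open>The scheme on a fixed grid\<close>

lemma linearization_inner: "linearization f y z z' \<bullet> (z - z') = f y z - f y z'"
proof (cases "z = z'")
  case False
  then have "norm (z - z') \<noteq> 0" by simp
  then show ?thesis
    using False by (simp add: linearization_def power2_norm_eq_inner del: norm_eq_zero)
qed (simp add: linearization_def)

lemma norm_linearization_le:
  assumes "\<bar>f y z - f y z'\<bar> \<le> L * norm (z - z')" "0 \<le> L"
  shows "norm (linearization f y z z') \<le> L"
proof (cases "z = z'")
  case False
  then have "0 < norm (z - z')" by simp
  then show ?thesis
    using False assms by (simp add: linearization_def power2_eq_square divide_simps)
qed (use assms in \<open>simp add: linearization_def\<close>)

text \<open>One fixed grid. \<open>Ky\<close>, \<open>e\<close>, \<open>lmin\<close>,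
  \<open>lmax\<close> and \<open>T\<close> are shared by all grids, whereas \<open>K\<close> stands
  for the constant in \<open>z\<close> that varies with \<open>n\<close>. Bounds free of
  \<open>K\<close>, \<open>n\<close> and the individual step sizes are thus uniform.\<close>

locale bsde_scheme = prob_space M for M :: "'a measure" +
  fixes \<F> :: "real \<Rightarrow> 'a measure" and T :: real and n :: nat and t :: "nat \<Rightarrow> real"
    and lmin lmax :: real and c :: "nat \<Rightarrow> real" and H :: "nat \<Rightarrow> 'a \<Rightarrow> real ^ 'd"
    and F :: "nat \<Rightarrow> 'a \<Rightarrow> real \<Rightarrow> real ^ 'd \<Rightarrow> real" and Ky K e :: real
  assumes subalg: "\<And>s. 0 \<le> s \<Longrightarrow> s \<le> T \<Longrightarrow> subalgebra M (\<F> s)"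
    and subalg_mono: "\<And>r s. 0 \<le> r \<Longrightarrow> r \<le> s \<Longrightarrow> s \<le> T \<Longrightarrow> subalgebra (\<F> s) (\<F> r)"
    and grid: "time_grid T n t"
    and coefficients: "scheme_coefficients M \<F> n t lmin lmax c H"
    and constants: "0 < lmin" "0 < Ky" "0 < K" "0 < e" "e < 1"
    and F_meas: "\<And>i. i < n \<Longrightarrow>
      (\<lambda>(\<omega>, y, z). F i \<omega> y z) \<in> borel_measurable (\<F> (t i) \<Otimes>\<^sub>M (borel \<Otimes>\<^sub>M borel))"
    and F_lipschitz: "\<And>i. i < n \<Longrightarrow> AE \<omega> in M. \<forall>y y' z z'.
        \<bar>F i \<omega> y z - F i \<omega> y' z'\<bar> \<le> Ky * \<bar>y - y'\<bar> + K * norm (z - z')"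
    and mesh_le: "mesh n t * Ky < 1 - e"
    and H_le: "AE \<omega> in M. (MAX i\<in>{..<n}. step t i * norm (H i \<omega>)) * K < 1 - e"
begin

abbreviation G :: "nat \<Rightarrow> 'a measure" where "G i \<equiv> \<F> (t i)"

lemma step_pos: "i < n \<Longrightarrow> 0 < step t i"
  using grid by (simp add: time_grid_def step_def)

lemma t_mono:
  assumes "i \<le> j" "j \<le> n"
  shows "t i \<le> t j"
  using assms
proof (induction j rule: dec_induct)
  case (step j)
  then show ?case using step_pos[of j] by (simp add: step_def)
qed simp

lemma t_range: "i \<le> n \<Longrightarrow> 0 \<le> t i" "i \<le> n \<Longrightarrow> t i \<le> T"
  using t_mono[of 0 i] t_mono[of i n] grid by (auto simp: time_grid_def)

lemma T_nonneg: "0 \<le> T"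
  using t_range[of 0] by simp

lemma sum_step: "i \<le> n \<Longrightarrow> (\<Sum>j=i..<n. step t j) = T - t i"
  using sum_Suc_diff'[of i n t] grid by (simp add: step_def time_grid_def)

lemma step_le_mesh: "i < n \<Longrightarrow> step t i \<le> mesh n t"
  unfolding mesh_def by (intro Max_ge) auto

lemma step_Ky_le:
  assumes "i < n"
  shows "step t i * Ky \<le> 1 - e"
proof -
  have "step t i * Ky \<le> mesh n t * Ky"
    using constants step_le_mesh[OF assms] by (intro mult_right_mono) auto
  then show ?thesis using mesh_le by linarith
qed

lemma subalg_G: "i \<le> n \<Longrightarrow> subalgebra M (G i)"
  using subalg t_range by blast

lemma subalg_G_mono: "i \<le> j \<Longrightarrow> j \<le> n \<Longrightarrow> subalgebra (G j) (G i)"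
  using subalg_mono t_range t_mono by (meson le_trans)

lemma measurable_G_mono: "f \<in> measurable (G i) N \<Longrightarrow> i \<le> j \<Longrightarrow> j \<le> n \<Longrightarrow> f \<in> measurable (G j) N"
  using measurable_from_subalg subalg_G_mono by blast

lemma measurable_G: "f \<in> measurable (G i) N \<Longrightarrow> i \<le> n \<Longrightarrow> f \<in> measurable M N"
  using measurable_from_subalg subalg_G by blast

lemma sigma_finite_F: "0 \<le> s \<Longrightarrow> s \<le> T \<Longrightarrow> sigma_finite_subalgebra M (\<F> s)"
  by (intro finite_measure_subalgebra_is_sigma_finite)
    (simp add: finite_measure_subalgebra_def finite_measure_subalgebra_axioms_def
      subalg finite_measure_axioms)

lemma sigma_finite_G: "i \<le> n \<Longrightarrow> sigma_finite_subalgebra M (G i)"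
  using sigma_finite_F t_range by blast

lemma coefficient_bounds: "i < n \<Longrightarrow> 0 < c i" "i < n \<Longrightarrow> c i \<le> lmax / CARD('d)"
  using coefficients constants by (auto simp: scheme_coefficients_def intro: less_le_trans[rotated])

lemma H_meas_Suc: "i < n \<Longrightarrow> H i \<in> borel_measurable (G (Suc i))"
  using coefficients by (simp add: scheme_coefficients_def)

lemma H_meas: "i < n \<Longrightarrow> H i \<in> borel_measurable M"
  by (rule measurable_G[OF H_meas_Suc]) auto

lemma scheme_step:
  assumes i: "i < n"
  shows "scheme_step M (G i) (H i) (step t i) (c i) e K"
proof
  show "subalgebra M (G i)" using i by (intro subalg_G) auto
  show "H i \<in> borel_measurable M" by (rule H_meas[OF i])
  show "0 < step t i" "0 < c i" "0 < e" "e < 1" "0 < K"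
    using step_pos[OF i] coefficient_bounds[OF i] constants by auto
  show "AE \<omega> in M. step t i * norm (H i \<omega>) * K \<le> 1 - e"
    using H_le
  proof eventually_elim
    case (elim \<omega>)
    have "step t i * norm (H i \<omega>) \<le> (MAX i\<in>{..<n}. step t i * norm (H i \<omega>))"
      using i by (intro Max_ge) auto
    then have "step t i * norm (H i \<omega>) * K \<le> (MAX i\<in>{..<n}. step t i * norm (H i \<omega>)) * K"
      using constants by (intro mult_right_mono) auto
    then show ?case using elim by linarith
  qed
  show "AE \<omega> in M. vec_cond_exp M (G i) (H i) \<omega> = 0"
    using coefficients i by (simp add: scheme_coefficients_def)
  fix k l :: 'd
  have "AE \<omega> in M. c i *\<^sub>R (mat 1 :: real ^ 'd ^ 'd) = step t i *\<^sub>R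
      (\<chi> k l. real_cond_exp M (G i) (\<lambda>\<omega>'. H i \<omega>' $ k * H i \<omega>' $ l) \<omega>)"
    using coefficients i unfolding scheme_coefficients_def by blast
  then show "AE \<omega> in M. step t i * real_cond_exp M (G i) (\<lambda>\<omega>'. H i \<omega>' $ k * H i \<omega>' $ l) \<omega>
      = (if k = l then c i else 0)"
  proof eventually_elim
    case (elim \<omega>)
    from arg_cong[OF elim, of "\<lambda>A. A $ k $ l"] show ?case
      by (simp add: mat_def split: if_splits)
  qed
qed

text \<open>Tower property combined with pulling out the factor known at time \<open>s\<close>. The
  times need not be grid points, since the reverse Hoelder inequality is wanted at every
  \<open>s\<close> in \<open>[0, T]\<close>.\<close>

lemma nn_cond_exp_tower:
  assumes "0 \<le> r" "r \<le> s" "s \<le> T"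
    and f: "f \<in> borel_measurable (\<F> s)" and [measurable]: "g \<in> borel_measurable M"
  shows "AE \<omega> in M. nn_cond_exp M (\<F> r) (\<lambda>\<omega>. f \<omega> * g \<omega>) \<omega> =
    nn_cond_exp M (\<F> r) (\<lambda>\<omega>. f \<omega> * nn_cond_exp M (\<F> s) g \<omega>) \<omega>"
proof -
  interpret r: sigma_finite_subalgebra M "\<F> r" using assms by (intro sigma_finite_F) auto
  interpret s: sigma_finite_subalgebra M "\<F> s" using assms by (intro sigma_finite_F) auto
  have [measurable]: "f \<in> borel_measurable M" by (rule measurable_from_subalg[OF s.subalg f])
  have "AE \<omega> in M. nn_cond_exp M (\<F> r) (\<lambda>\<omega>. f \<omega> * g \<omega>) \<omega> =
      nn_cond_exp M (\<F> r) (nn_cond_exp M (\<F> s) (\<lambda>\<omega>. f \<omega> * g \<omega>)) \<omega>"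
    using assms by (intro r.nn_cond_exp_nested_subalg subalg subalg_mono) auto
  moreover have "AE \<omega> in M. nn_cond_exp M (\<F> r) (\<lambda>\<omega>. f \<omega> * nn_cond_exp M (\<F> s) g \<omega>) \<omega> =
      nn_cond_exp M (\<F> r) (nn_cond_exp M (\<F> s) (\<lambda>\<omega>. f \<omega> * g \<omega>)) \<omega>"
    using s.nn_cond_exp_prod[OF f] by (intro r.nn_cond_exp_cong) auto
  ultimately show ?thesis by eventually_elim simp
qed

section \<open>Products of the factors \<open>1 + a\<close> and their conditional moments\<close>

definition admissible :: "(nat \<Rightarrow> 'a \<Rightarrow> real ^ 'd) \<Rightarrow> bool" where
  "admissible \<gamma> \<longleftrightarrow> (\<forall>j<n. \<gamma> j \<in> borel_measurable (G j) \<and> (AE \<omega> in M. norm (\<gamma> j \<omega>) \<le> K))"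

definition factor :: "(nat \<Rightarrow> 'a \<Rightarrow> real ^ 'd) \<Rightarrow> nat \<Rightarrow> 'a \<Rightarrow> real" where
  "factor \<gamma> j \<omega> = 1 + step t j * (H j \<omega> \<bullet> \<gamma> j \<omega>)"

text \<open>The ratio of the discrete exponential at \<open>T\<close> to its value at
  \<open>t i\<close>. Working with the product of the remaining factors avoids quotients and suits
  backward induction.\<close>

definition weight :: "(nat \<Rightarrow> 'a \<Rightarrow> real ^ 'd) \<Rightarrow> nat \<Rightarrow> 'a \<Rightarrow> real" where
  "weight \<gamma> i \<omega> = (\<Prod>j=i..<n. factor \<gamma> j \<omega>)"

lemma weight_n [simp]: "weight \<gamma> n \<omega> = 1"
  by (simp add: weight_def)

lemma weight_Suc: "i < n \<Longrightarrow> weight \<gamma> i \<omega> = factor \<gamma> i \<omega> * weight \<gamma> (Suc i) \<omega>"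
  by (simp add: weight_def prod.atLeast_Suc_lessThan)

context
  fixes \<gamma> :: "nat \<Rightarrow> 'a \<Rightarrow> real ^ 'd"
  assumes \<gamma>: "admissible \<gamma>"
begin

lemma factor_bounds:
  assumes j: "j < n"
  shows "AE \<omega> in M. e \<le> factor \<gamma> j \<omega> \<and> factor \<gamma> j \<omega> \<le> 2"
proof -
  interpret scheme_step M "G j" "H j" "step t j" "c j" e K by (rule scheme_step[OF j])
  have "AE \<omega> in M. \<bar>step t j * (H j \<omega> \<bullet> \<gamma> j \<omega>)\<bar> \<le> 1 - e"
    using \<gamma> j by (intro increment_bound) (auto simp: admissible_def)
  then show ?thesis
    by eventually_elim (use constants in \<open>simp add: factor_def abs_le_iff\<close>)
qed

lemma factor_meas_Suc:
  assumes j: "j < n"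
  shows "factor \<gamma> j \<in> borel_measurable (G (Suc j))"
proof -
  have [measurable]: "\<gamma> j \<in> borel_measurable (G (Suc j))"
    using \<gamma> j unfolding admissible_def by (auto intro: measurable_G_mono[of _ j])
  have [measurable]: "H j \<in> borel_measurable (G (Suc j))" by (rule H_meas_Suc[OF j])
  show ?thesis unfolding factor_def[abs_def] by measurable
qed

lemma factor_meas: "j < n \<Longrightarrow> factor \<gamma> j \<in> borel_measurable M"
  by (rule measurable_G[OF factor_meas_Suc]) auto

lemma weight_meas: "i \<le> n \<Longrightarrow> weight \<gamma> i \<in> borel_measurable M"
  unfolding weight_def[abs_def] by (intro borel_measurable_prod factor_meas) auto

lemma weight_pos:
  assumes "i \<le> n"
  shows "AE \<omega> in M. 0 < weight \<gamma> i \<omega>"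
proof -
  have "AE \<omega> in M. \<forall>j\<in>{i..<n}. 0 < factor \<gamma> j \<omega>"
  proof (subst AE_finite_all)
    show "\<forall>j\<in>{i..<n}. AE \<omega> in M. 0 < factor \<gamma> j \<omega>"
    proof
      fix j assume "j \<in> {i..<n}"
      then show "AE \<omega> in M. 0 < factor \<gamma> j \<omega>"
        using factor_bounds[of j] constants by (auto elim: eventually_mono)
    qed
  qed auto
  then show ?thesis
    by eventually_elim (auto simp: weight_def intro: prod_pos)
qed

lemma nn_cond_exp_factor:
  assumes i: "i < n"
  shows "AE \<omega> in M. nn_cond_exp M (G i) (\<lambda>\<omega>. ennreal (factor \<gamma> i \<omega>)) \<omega> = 1"
proof -
  interpret scheme_step M "G i" "H i" "step t i" "c i" e K by (rule scheme_step[OF i])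
  have \<gamma>i: "\<gamma> i \<in> borel_measurable (G i)" "AE \<omega> in M. norm (\<gamma> i \<omega>) \<le> K"
    using \<gamma> i by (auto simp: admissible_def)
  have "has_cond_exp M (G i) (factor \<gamma> i) (\<lambda>_. 1 + step t i * 0)"
    unfolding factor_def[abs_def]
    by (intro has_cond_exp_add has_cond_exp_self has_cond_exp_cmult has_cond_exp_inner[OF \<gamma>i]) auto
  moreover have "AE \<omega> in M. 0 \<le> factor \<gamma> i \<omega>"
    using factor_bounds[OF i] constants by (auto elim: eventually_mono)
  ultimately show ?thesis
    using nn_cond_exp_eq_has_cond_exp[of "factor \<gamma> i" "\<lambda>_. 1"] by simp
qed

lemma nn_cond_exp_factor_weight:
  assumes i: "i < n" and [measurable]: "X \<in> borel_measurable M"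
  shows "AE \<omega> in M. nn_cond_exp M (G i) (\<lambda>\<omega>. ennreal (weight \<gamma> i \<omega>) * X \<omega>) \<omega> =
    nn_cond_exp M (G i) (\<lambda>\<omega>. ennreal (factor \<gamma> i \<omega>) *
      nn_cond_exp M (G (Suc i)) (\<lambda>\<omega>. ennreal (weight \<gamma> (Suc i) \<omega>) * X \<omega>) \<omega>) \<omega>"
proof -
  interpret i: sigma_finite_subalgebra M "G i" using i by (intro sigma_finite_G) auto
  have [measurable]: "factor \<gamma> i \<in> borel_measurable M" "weight \<gamma> i \<in> borel_measurable M"
      "weight \<gamma> (Suc i) \<in> borel_measurable M"
    using i by (auto intro: factor_meas weight_meas)
  have "AE \<omega> in M. nn_cond_exp M (G i) (\<lambda>\<omega>. ennreal (weight \<gamma> i \<omega>) * X \<omega>) \<omega> =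
    nn_cond_exp M (G i) (\<lambda>\<omega>. ennreal (factor \<gamma> i \<omega>) * (ennreal (weight \<gamma> (Suc i) \<omega>) * X \<omega>)) \<omega>"
  proof (rule i.nn_cond_exp_cong)
    show "AE \<omega> in M. ennreal (weight \<gamma> i \<omega>) * X \<omega> =
        ennreal (factor \<gamma> i \<omega>) * (ennreal (weight \<gamma> (Suc i) \<omega>) * X \<omega>)"
      using factor_bounds[OF i]
      by eventually_elim (use i constants in \<open>simp add: weight_Suc ennreal_mult' mult.assoc\<close>)
  qed auto
  moreover have "AE \<omega> in M. nn_cond_exp M (G i) (\<lambda>\<omega>. ennreal (factor \<gamma> i \<omega>) * (ennreal (weight \<gamma> (Suc i) \<omega>) * X \<omega>)) \<omega> =
    nn_cond_exp M (G i) (\<lambda>\<omega>. ennreal (factor \<gamma> i \<omega>) *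
      nn_cond_exp M (G (Suc i)) (\<lambda>\<omega>. ennreal (weight \<gamma> (Suc i) \<omega>) * X \<omega>) \<omega>) \<omega>"
    using i t_range t_mono factor_meas_Suc[OF i] by (intro nn_cond_exp_tower) auto
  ultimately show ?thesis by eventually_elim simp
qed

text \<open>The discrete exponential is a martingale, as each factor has conditional mean 1. No
  bound on the bracket is involved, which is what permits a first bound on \<open>Y\<close> before
  anything is known about \<open>Z\<close>.\<close>

lemma nn_cond_exp_weight:
  assumes "i \<le> n"
  shows "AE \<omega> in M. nn_cond_exp M (G i) (\<lambda>\<omega>. ennreal (weight \<gamma> i \<omega>)) \<omega> = 1"
  using assms
proof (induction i rule: inc_induct)
  case base
  interpret sigma_finite_subalgebra M "G n" by (rule sigma_finite_G) auto
  show ?case using nn_cond_exp_F_meas[of "\<lambda>_. 1"] by (auto elim: eventually_mono)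
next
  case (step i)
  interpret sigma_finite_subalgebra M "G i" using step by (intro sigma_finite_G) auto
  have [measurable]: "factor \<gamma> i \<in> borel_measurable M" "weight \<gamma> (Suc i) \<in> borel_measurable M"
    using step by (auto intro: factor_meas weight_meas)
  have "AE \<omega> in M. nn_cond_exp M (G i) (\<lambda>\<omega>. ennreal (factor \<gamma> i \<omega>) *
      nn_cond_exp M (G (Suc i)) (\<lambda>\<omega>. ennreal (weight \<gamma> (Suc i) \<omega>) * 1) \<omega>) \<omega>
      = nn_cond_exp M (G i) (\<lambda>\<omega>. ennreal (factor \<gamma> i \<omega>)) \<omega>"
    using step.IH by (intro nn_cond_exp_cong) auto
  with nn_cond_exp_factor_weight[OF step.hyps(2), of "\<lambda>_. 1"] nn_cond_exp_factor[OF step.hyps(2)]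
  show ?case by simp (auto elim: eventually_elim2)
qed

text \<open>Iterates the one-step inequality with \<open>U i\<close>, the conditional mean of the
  remaining sum of the \<open>g j\<close>. A majorant \<open>g\<close> replaces the bracket itself
  because only the majorant built from \<open>Z\<close> and its perturbed counterpart is estimated
  later. The values of \<open>2 - exp (- k * U)\<close> lie between 1 and 2: the lower end matches
  the empty product at time \<open>n\<close>, the upper end is the constant 2.\<close>

lemma reverse_Holder:
  fixes g :: "nat \<Rightarrow> 'a \<Rightarrow> real" and C p k :: real
  assumes g: "\<And>j. j < n \<Longrightarrow> g j \<in> borel_measurable (G j)" "\<And>j. j < n \<Longrightarrow> integrable M (g j)"
    and bracket: "\<And>j. j < n \<Longrightarrow> AE \<omega> in M. step t j * c j * (norm (\<gamma> j \<omega>))\<^sup>2 \<le> g j \<omega>"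
    and C: "0 \<le> C" "\<And>i. i < n \<Longrightarrow> AE \<omega> in M. real_cond_exp M (G i) (\<lambda>\<omega>. \<Sum>j=i..<n. g j \<omega>) \<omega> \<le> C"
    and k: "k = 8 / e + 1" and p: "1 \<le> p" "p \<le> 2" "p - 1 \<le> e / 2" "2 * (p - 1) \<le> exp (- k * C)"
    and i: "i \<le> n"
  shows "AE \<omega> in M. nn_cond_exp M (G i) (\<lambda>\<omega>. ennreal (weight \<gamma> i \<omega> powr p)) \<omega> \<le> 2"
proof -
  define S where "S = (\<lambda>i \<omega>. \<Sum>j=i..<n. g j \<omega>)"
  define U where "U = (\<lambda>i. real_cond_exp M (G i) (S i))"
  have S_int: "integrable M (S i)" for i
    unfolding S_def using g by (intro Bochner_Integration.integrable_sum) auto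
  have S_meas[measurable]: "S i \<in> borel_measurable M" for i
    using S_int by blast
  have g_nonneg: "AE \<omega> in M. 0 \<le> g j \<omega>" if "j < n" for j
    using bracket[OF that]
  proof eventually_elim
    case (elim \<omega>)
    have "0 \<le> step t j * c j * (norm (\<gamma> j \<omega>))\<^sup>2"
      using step_pos[OF that] coefficient_bounds(1)[OF that] by simp
    then show ?case using elim by linarith
  qed
  have U_bounds: "AE \<omega> in M. 0 \<le> U i \<omega> \<and> U i \<omega> \<le> C" if i: "i \<le> n" for i
  proof -
    interpret sigma_finite_subalgebra M "G i" using i by (rule sigma_finite_G)
    have "AE \<omega> in M. \<forall>j\<in>{i..<n}. 0 \<le> g j \<omega>"
      using g_nonneg by (subst AE_finite_all) auto
    then have "AE \<omega> in M. 0 \<le> S i \<omega>"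
      by eventually_elim (auto simp: S_def intro: sum_nonneg)
    then have "AE \<omega> in M. 0 \<le> U i \<omega>" unfolding U_def by (rule real_cond_exp_pos) simp
    moreover have "AE \<omega> in M. U i \<omega> \<le> C"
    proof (cases "i = n")
      case True
      have "AE \<omega> in M. U i \<omega> = S i \<omega>"
        unfolding U_def using True S_int by (intro real_cond_exp_F_meas) (auto simp: S_def)
      then show ?thesis by eventually_elim (use True C in \<open>simp add: S_def\<close>)
    next
      case False
      then show ?thesis using C(2)[of i] i unfolding U_def S_def by simp
    qed
    ultimately show ?thesis by eventually_elim simp
  qed
  have "AE \<omega> in M. nn_cond_exp M (G i) (\<lambda>\<omega>. ennreal (weight \<gamma> i \<omega> powr p)) \<omega>
      \<le> ennreal (2 - exp (- k * U i \<omega>))"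
    using i
  proof (induction i rule: inc_induct)
    \<comment> \<open>No summand is left, so \<open>U n = 0\<close> and the bounding function takes
      the value 1, that of the empty product.\<close>
    case base
    interpret sigma_finite_subalgebra M "G n" by (rule sigma_finite_G) auto
    have "AE \<omega> in M. 1 = nn_cond_exp M (G n) (\<lambda>_. 1) \<omega>"
      by (rule nn_cond_exp_F_meas) auto
    moreover have "AE \<omega> in M. U n \<omega> = S n \<omega>"
      unfolding U_def using S_int by (intro real_cond_exp_F_meas) (auto simp: S_def)
    ultimately show ?case by eventually_elim (simp add: S_def)
  next
    case (step i)
    have i: "i < n" by fact
    interpret scheme_step M "G i" "H i" "step t i" "c i" e K by (rule scheme_step[OF i])
    have \<gamma>i: "\<gamma> i \<in> borel_measurable (G i)" "AE \<omega> in M. norm (\<gamma> i \<omega>) \<le> K"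
      using \<gamma> i by (auto simp: admissible_def)
    have [measurable]: "factor \<gamma> i \<in> borel_measurable M" "weight \<gamma> i \<in> borel_measurable M"
      "weight \<gamma> (Suc i) \<in> borel_measurable M" "U (Suc i) \<in> borel_measurable M"
      using i by (auto intro: factor_meas weight_meas simp: U_def)
    have fac: "(\<lambda>\<omega>. ennreal (factor \<gamma> i \<omega> powr p)) \<in> borel_measurable (G (Suc i))"
      using factor_meas_Suc[OF i] by measurable
    have "AE \<omega> in M. nn_cond_exp M (G i) (\<lambda>\<omega>. ennreal (weight \<gamma> i \<omega> powr p)) \<omega> =
        nn_cond_exp M (G i) (\<lambda>\<omega>. ennreal (factor \<gamma> i \<omega> powr p) * ennreal (weight \<gamma> (Suc i) \<omega> powr p)) \<omega>"
    proof (rule nn_cond_exp_cong)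
      have "AE \<omega> in M. 0 < weight \<gamma> (Suc i) \<omega>" using i by (intro weight_pos) auto
      with factor_bounds[OF i] show "AE \<omega> in M. ennreal (weight \<gamma> i \<omega> powr p) =
          ennreal (factor \<gamma> i \<omega> powr p) * ennreal (weight \<gamma> (Suc i) \<omega> powr p)"
        by eventually_elim (use constants i in \<open>simp add: weight_Suc powr_mult ennreal_mult\<close>)
    qed auto
    moreover have "AE \<omega> in M. nn_cond_exp M (G i) (\<lambda>\<omega>. ennreal (factor \<gamma> i \<omega> powr p) * ennreal (weight \<gamma> (Suc i) \<omega> powr p)) \<omega>
       = nn_cond_exp M (G i) (\<lambda>\<omega>. ennreal (factor \<gamma> i \<omega> powr p) *
           nn_cond_exp M (G (Suc i)) (\<lambda>\<omega>. ennreal (weight \<gamma> (Suc i) \<omega> powr p)) \<omega>) \<omega>"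
      using i t_range t_mono by (intro nn_cond_exp_tower fac) auto
    moreover have "AE \<omega> in M. nn_cond_exp M (G i) (\<lambda>\<omega>. ennreal (factor \<gamma> i \<omega> powr p) *
           nn_cond_exp M (G (Suc i)) (\<lambda>\<omega>. ennreal (weight \<gamma> (Suc i) \<omega> powr p)) \<omega>) \<omega>
       \<le> nn_cond_exp M (G i) (\<lambda>\<omega>. ennreal (factor \<gamma> i \<omega> powr p * (2 - exp (- k * U (Suc i) \<omega>)))) \<omega>"
    proof (rule nn_cond_exp_mono)
      show "AE \<omega> in M. ennreal (factor \<gamma> i \<omega> powr p) *
           nn_cond_exp M (G (Suc i)) (\<lambda>\<omega>. ennreal (weight \<gamma> (Suc i) \<omega> powr p)) \<omega>
         \<le> ennreal (factor \<gamma> i \<omega> powr p * (2 - exp (- k * U (Suc i) \<omega>)))"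
        using step.IH by eventually_elim (simp add: ennreal_mult' mult_left_mono)
    qed auto
    moreover have "AE \<omega> in M. nn_cond_exp M (G i) (\<lambda>\<omega>. ennreal (factor \<gamma> i \<omega> powr p * (2 - exp (- k * U (Suc i) \<omega>)))) \<omega>
       \<le> ennreal (2 - exp (- k * U i \<omega>))"
      unfolding factor_def
    proof (rule reverse_Holder_step[OF \<gamma>i, where g = "g i" and C = C])
      show "AE \<omega> in M. 0 \<le> U i \<omega> \<and> U i \<omega> \<le> C" "AE \<omega> in M. 0 \<le> U (Suc i) \<omega> \<and> U (Suc i) \<omega> \<le> C"
        using i U_bounds[of i] U_bounds[of "Suc i"] by simp_all
      have "has_cond_exp M (G i) (\<lambda>\<omega>. g i \<omega> + S (Suc i) \<omega>) (\<lambda>\<omega>. g i \<omega> + real_cond_exp M (G i) (S (Suc i)) \<omega>)"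
        using g i S_int by (intro has_cond_exp_add has_cond_exp_self has_cond_expI) auto
      moreover have "(\<lambda>\<omega>. g i \<omega> + S (Suc i) \<omega>) = S i"
        using i by (simp add: S_def sum.atLeast_Suc_lessThan)
      ultimately have "AE \<omega> in M. U i \<omega> = g i \<omega> + real_cond_exp M (G i) (S (Suc i)) \<omega>"
        by (simp add: has_cond_exp_def U_def)
      moreover have "AE \<omega> in M. real_cond_exp M (G i) (U (Suc i)) \<omega> = real_cond_exp M (G i) (S (Suc i)) \<omega>"
        unfolding U_def using i S_int by (intro real_cond_exp_nested_subalg subalg_G subalg_G_mono) auto
      ultimately show "AE \<omega> in M. real_cond_exp M (G i) (U (Suc i)) \<omega> \<le> U i \<omega> - g i \<omega>"
        by eventually_elim simp
    qed (use k p bracket[OF i] in \<open>auto simp: U_def\<close>)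
    ultimately show ?case by eventually_elim simp
  qed
  then show ?thesis
  proof eventually_elim
    case (elim \<omega>)
    have "ennreal (2 - exp (- k * U i \<omega>)) \<le> ennreal 2"
      by (intro ennreal_leI) auto
    then show ?case using elim by simp
  qed
qed

end

section \<open>Linearisation of the driver and stability over the whole grid\<close>

lemma F_meas_comp:
  assumes i: "i < n" and [measurable]: "y \<in> borel_measurable (G i)" "z \<in> borel_measurable (G i)"
  shows "(\<lambda>\<omega>. F i \<omega> (y \<omega>) (z \<omega>)) \<in> borel_measurable (G i)"
proof -
  have "(\<lambda>\<omega>. (\<omega>, y \<omega>, z \<omega>)) \<in> measurable (G i) (G i \<Otimes>\<^sub>M (borel \<Otimes>\<^sub>M borel))"
    by measurable
  from measurable_compose[OF this F_meas[OF i]] show ?thesis by simp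
qed

lemma F_AE_lipschitz_y:
  assumes "i < n"
  shows "AE \<omega> in M. \<forall>y y' z. \<bar>F i \<omega> y z - F i \<omega> y' z\<bar> \<le> Ky * \<bar>y - y'\<bar>"
  using F_lipschitz[OF assms]
proof eventually_elim
  case (elim \<omega>)
  show ?case
  proof (intro allI)
    fix y y' :: real and z :: "real ^ 'd"
    show "\<bar>F i \<omega> y z - F i \<omega> y' z\<bar> \<le> Ky * \<bar>y - y'\<bar>"
      using elim[rule_format, of y z y' z] by simp
  qed
qed

lemma admissible_linearization:
  assumes [measurable]: "\<And>j. j < n \<Longrightarrow> y j \<in> borel_measurable (G j)"
    "\<And>j. j < n \<Longrightarrow> z j \<in> borel_measurable (G j)" "\<And>j. j < n \<Longrightarrow> z' j \<in> borel_measurable (G j)"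
  shows "admissible (\<lambda>j \<omega>. linearization (F j \<omega>) (y j \<omega>) (z j \<omega>) (z' j \<omega>))"
  unfolding admissible_def
proof (intro allI impI conjI)
  fix j assume j: "j < n"
  note [measurable] = F_meas_comp[OF j assms(1)[OF j] assms(2)[OF j]]
    F_meas_comp[OF j assms(1)[OF j] assms(3)[OF j]] assms(1)[OF j] assms(2)[OF j] assms(3)[OF j]
  show "(\<lambda>\<omega>. linearization (F j \<omega>) (y j \<omega>) (z j \<omega>) (z' j \<omega>)) \<in> borel_measurable (G j)"
    unfolding linearization_def by measurable
  show "AE \<omega> in M. norm (linearization (F j \<omega>) (y j \<omega>) (z j \<omega>) (z' j \<omega>)) \<le> K"
    using F_lipschitz[OF j]
  proof eventually_elim
    case (elim \<omega>)
    show ?case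
      using elim[rule_format, of "y j \<omega>" "z j \<omega>" "y j \<omega>" "z' j \<omega>"] constants
      by (intro norm_linearization_le) auto
  qed
qed

lemma solution_integrable:
  assumes sol: "perturbed_scheme_solution M \<F> n t H F \<xi> \<zeta> Y Z"
    and \<xi>: "integrable M \<xi>" and \<zeta>: "\<And>i. i < n \<Longrightarrow> integrable M (\<zeta> i)" and i: "i \<le> n"
  shows "integrable M (Y i)"
proof -
  have meas: "Y i \<in> borel_measurable M"
    using sol i measurable_G[of "Y i" i] by (auto simp: perturbed_scheme_solution_def)
  show ?thesis
  proof (cases "i = n")
    case True
    then have "AE \<omega> in M. Y i \<omega> = \<xi> \<omega>"
      using sol by (simp add: perturbed_scheme_solution_def)
    then show ?thesis
      using integrable_cong_AE[of "Y i" M \<xi>] meas \<xi> by auto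
  next
    case False
    then have i': "i < n" using i by simp
    interpret sigma_finite_subalgebra M "G i" using i by (rule sigma_finite_G)
    let ?f = "\<lambda>\<omega>. Y (Suc i) \<omega> + step t i * F i \<omega> (Y i \<omega>) (Z i \<omega>)"
    have "integrable M ?f" "AE \<omega> in M. Y i \<omega> = real_cond_exp M (G i) ?f \<omega> + \<zeta> i \<omega>"
      using sol i' by (auto simp: perturbed_scheme_solution_def)
    moreover have "integrable M (\<lambda>\<omega>. real_cond_exp M (G i) ?f \<omega> + \<zeta> i \<omega>)"
      using real_cond_exp_int(1)[OF calculation(1)] \<zeta>[OF i']
      by (rule Bochner_Integration.integrable_add)
    ultimately show ?thesis
      using integrable_cong_AE[of "Y i" M "\<lambda>\<omega>. real_cond_exp M (G i) ?f \<omega> + \<zeta> i \<omega>"] meas by auto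
  qed
qed

text \<open>Backward iteration of \<open>stability_step\<close>. Since \<open>\<zeta> i\<close> is
  known at \<open>t i\<close> and the weight has conditional mean 1, \<open>|\<zeta> i|\<close> may
  be multiplied by the weight inside the conditional expectation, and all perturbations end up under
  one common weight. The exponents \<open>step t i * Ky / e\<close> add up to
  \<open>(T - t i) * Ky / e\<close>.\<close>

lemma stability:
  fixes Y Yt \<zeta> :: "nat \<Rightarrow> 'a \<Rightarrow> real" and Z Zt :: "nat \<Rightarrow> 'a \<Rightarrow> real ^ 'd"
  defines "\<gamma> \<equiv> \<lambda>j \<omega>. linearization (F j \<omega>) (Yt j \<omega>) (Z j \<omega>) (Zt j \<omega>)"
  assumes sol: "scheme_solution M \<F> n t H F \<xi> Y Z"
    and solt: "perturbed_scheme_solution M \<F> n t H F \<xi>t \<zeta> Yt Zt"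
    and int: "integrable M \<xi>" "integrable M \<xi>t" "\<And>i. i < n \<Longrightarrow> integrable M (\<zeta> i)"
    and \<zeta>: "\<And>i. i < n \<Longrightarrow> \<zeta> i \<in> borel_measurable (G i)"
    and i: "i \<le> n"
  shows "AE \<omega> in M. ennreal \<bar>Y i \<omega> - Yt i \<omega>\<bar> \<le> ennreal (exp ((T - t i) * Ky / e)) *
    nn_cond_exp M (G i) (\<lambda>\<omega>. ennreal (weight \<gamma> i \<omega>) *
      ennreal (\<bar>Y n \<omega> - Yt n \<omega>\<bar> + (\<Sum>j=i..<n. \<bar>\<zeta> j \<omega>\<bar>))) \<omega>"
proof -
  have Y_int: "integrable M (Y i)" and Yt_int: "integrable M (Yt i)" if "i \<le> n" for i
    using solution_integrable[OF sol[unfolded scheme_solution_def] int(1) _ that]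
      solution_integrable[OF solt int(2,3) that] by auto
  have adapted: "Y i \<in> borel_measurable (G i)" "Z i \<in> borel_measurable (G i)"
      "Yt i \<in> borel_measurable (G i)" "Zt i \<in> borel_measurable (G i)" if "i \<le> n" for i
    using sol solt that by (auto simp: scheme_solution_def perturbed_scheme_solution_def)
  have \<gamma>: "admissible \<gamma>"
    unfolding \<gamma>_def by (rule admissible_linearization) (auto intro: adapted)
  note [measurable] = weight_meas[OF \<gamma>] factor_meas[OF \<gamma>]
  let ?X = "\<lambda>i \<omega>. ennreal (\<bar>Y n \<omega> - Yt n \<omega>\<bar> + (\<Sum>j=i..<n. \<bar>\<zeta> j \<omega>\<bar>))"
  have X_meas[measurable]: "?X i \<in> borel_measurable M" for i
  proof -
    have "(\<lambda>\<omega>. \<bar>Y n \<omega> - Yt n \<omega>\<bar>) \<in> borel_measurable M"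
      using Y_int[of n] Yt_int[of n] by simp
    moreover have "(\<lambda>\<omega>. \<Sum>j=i..<n. \<bar>\<zeta> j \<omega>\<bar>) \<in> borel_measurable M"
      using int(3) by (intro borel_measurable_sum borel_measurable_abs borel_measurable_integrable) auto
    ultimately show ?thesis by measurable
  qed
  show ?thesis
    using i
  proof (induction i rule: inc_induct)
    case base
    interpret sigma_finite_subalgebra M "G n" by (rule sigma_finite_G) simp
    have "AE \<omega> in M. ennreal \<bar>Y n \<omega> - Yt n \<omega>\<bar> = nn_cond_exp M (G n) (\<lambda>\<omega>. ennreal \<bar>Y n \<omega> - Yt n \<omega>\<bar>) \<omega>"
      using adapted[of n] by (intro nn_cond_exp_F_meas) auto
    then show ?case
      by eventually_elim (use grid in \<open>simp add: time_grid_def\<close>)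
  next
    case (step i)
    have i: "i < n" by fact
    interpret scheme_step M "G i" "H i" "step t i" "c i" e K by (rule scheme_step[OF i])
    define h where "h = step t i"
    define \<delta>' where "\<delta>' = (\<lambda>\<omega>. Y (Suc i) \<omega> - Yt (Suc i) \<omega>)"
    have h: "0 < h" using step_pos[OF i] by (simp add: h_def)
    note meas_i [measurable] = adapted[of i, OF less_imp_le[OF i]]
    have \<gamma>i: "\<gamma> i \<in> borel_measurable (G i)" "AE \<omega> in M. norm (\<gamma> i \<omega>) \<le> K"
      using \<gamma> i by (auto simp: admissible_def)
    have int': "integrable M (Y (Suc i))" "integrable M (Yt (Suc i))" "integrable M \<delta>'"
      using Y_int[of "Suc i"] Yt_int[of "Suc i"] i by (auto simp: \<delta>'_def)
    let ?f = "\<lambda>\<omega>. F i \<omega> (Y i \<omega>) (Z i \<omega>)" and ?ft = "\<lambda>\<omega>. F i \<omega> (Yt i \<omega>) (Zt i \<omega>)"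
    have f [measurable]: "?f \<in> borel_measurable (G i)" "?ft \<in> borel_measurable (G i)"
      by (auto intro!: F_meas_comp[OF i])
    have sum_int: "integrable M (\<lambda>\<omega>. Y (Suc i) \<omega> + h * ?f \<omega>)" "integrable M (\<lambda>\<omega>. Yt (Suc i) \<omega> + h * ?ft \<omega>)"
      using sol solt i by (auto simp: scheme_solution_def perturbed_scheme_solution_def h_def)
    \<comment> \<open>A solution provides integrability only of the sum of \<open>Y (Suc i)\<close>
      and the driver; that of the driver alone follows by subtraction.\<close>
    have hf_int: "integrable M (\<lambda>\<omega>. h * ?f \<omega>)" "integrable M (\<lambda>\<omega>. h * ?ft \<omega>)"
      using Bochner_Integration.integrable_diff[OF sum_int(1) int'(1)]
        Bochner_Integration.integrable_diff[OF sum_int(2) int'(2)] by simp_all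
    have Eq: "AE \<omega> in M. Y i \<omega> = real_cond_exp M (G i) (\<lambda>\<omega>. Y (Suc i) \<omega> + h * ?f \<omega>) \<omega>"
      "AE \<omega> in M. Yt i \<omega> = real_cond_exp M (G i) (\<lambda>\<omega>. Yt (Suc i) \<omega> + h * ?ft \<omega>) \<omega> + \<zeta> i \<omega>"
      "AE \<omega> in M. Z i \<omega> = vec_cond_exp M (G i) (\<lambda>\<omega>. Y (Suc i) \<omega> *\<^sub>R H i \<omega>) \<omega>"
      "AE \<omega> in M. Zt i \<omega> = vec_cond_exp M (G i) (\<lambda>\<omega>. Yt (Suc i) \<omega> *\<^sub>R H i \<omega>) \<omega>"
      using sol solt i by (auto simp: scheme_solution_def perturbed_scheme_solution_def h_def)
    have E_sum: "AE \<omega> in M. real_cond_exp M (G i) (\<lambda>\<omega>. Y (Suc i) \<omega> + h * ?f \<omega>) \<omega> =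
        real_cond_exp M (G i) (Y (Suc i)) \<omega> + h * ?f \<omega>"
      "AE \<omega> in M. real_cond_exp M (G i) (\<lambda>\<omega>. Yt (Suc i) \<omega> + h * ?ft \<omega>) \<omega> =
        real_cond_exp M (G i) (Yt (Suc i)) \<omega> + h * ?ft \<omega>"
      using has_cond_exp_add[OF has_cond_expI[OF int'(1)] has_cond_exp_self[OF hf_int(1)]]
        has_cond_exp_add[OF has_cond_expI[OF int'(2)] has_cond_exp_self[OF hf_int(2)]]
      by (simp_all add: has_cond_exp_def)
    have E_diff: "AE \<omega> in M. real_cond_exp M (G i) \<delta>' \<omega> =
        real_cond_exp M (G i) (Y (Suc i)) \<omega> - real_cond_exp M (G i) (Yt (Suc i)) \<omega>"
      unfolding \<delta>'_def using int' by (intro real_cond_exp_diff) auto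
    have comp: "integrable M (\<lambda>\<omega>. Y (Suc i) \<omega> * H i \<omega> $ k)" "integrable M (\<lambda>\<omega>. Yt (Suc i) \<omega> * H i \<omega> $ k)" for k
      using integrable_H_mult[OF int'(1), of k] integrable_H_mult[OF int'(2), of k]
      by (simp_all add: mult.commute)
    have "AE \<omega> in M. \<forall>k\<in>UNIV. real_cond_exp M (G i) (\<lambda>\<omega>. Y (Suc i) \<omega> * H i \<omega> $ k - Yt (Suc i) \<omega> * H i \<omega> $ k) \<omega> =
        real_cond_exp M (G i) (\<lambda>\<omega>. Y (Suc i) \<omega> * H i \<omega> $ k) \<omega> - real_cond_exp M (G i) (\<lambda>\<omega>. Yt (Suc i) \<omega> * H i \<omega> $ k) \<omega>"
      using real_cond_exp_diff[OF comp] by (subst AE_finite_all) auto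
    then have V_diff: "AE \<omega> in M. vec_cond_exp M (G i) (\<lambda>\<omega>. \<delta>' \<omega> *\<^sub>R H i \<omega>) \<omega> =
        vec_cond_exp M (G i) (\<lambda>\<omega>. Y (Suc i) \<omega> *\<^sub>R H i \<omega>) \<omega> - vec_cond_exp M (G i) (\<lambda>\<omega>. Yt (Suc i) \<omega> *\<^sub>R H i \<omega>) \<omega>"
      by eventually_elim (simp add: vec_cond_exp_def vec_eq_iff \<delta>'_def left_diff_distrib)
    have "AE \<omega> in M. \<bar>(Y i \<omega> - Yt i \<omega>) - real_cond_exp M (G i) \<delta>' \<omega>
      - h * (vec_cond_exp M (G i) (\<lambda>\<omega>'. \<delta>' \<omega>' *\<^sub>R H i \<omega>') \<omega> \<bullet> \<gamma> i \<omega>) + \<zeta> i \<omega>\<bar> \<le> h * Ky * \<bar>Y i \<omega> - Yt i \<omega>\<bar>"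
      using Eq E_sum E_diff V_diff F_AE_lipschitz_y[OF i]
    proof eventually_elim
      case (elim \<omega>)
      \<comment> \<open>The increment of \<open>F i\<close> is split at the intermediate point
        \<open>(Yt i, Z i)\<close>: the change in \<open>z\<close> is reproduced exactly by
        \<open>\<gamma> i\<close>, the change in \<open>y\<close> is what remains and is Lipschitz
        with constant \<open>Ky\<close>.\<close>
      have "vec_cond_exp M (G i) (\<lambda>\<omega>'. \<delta>' \<omega>' *\<^sub>R H i \<omega>') \<omega> \<bullet> \<gamma> i \<omega> =
          F i \<omega> (Yt i \<omega>) (Z i \<omega>) - F i \<omega> (Yt i \<omega>) (Zt i \<omega>)"
        unfolding elim(8) elim(3,4)[symmetric] \<gamma>_def
        by (subst inner_commute) (rule linearization_inner)
      then have "h * (vec_cond_exp M (G i) (\<lambda>\<omega>'. \<delta>' \<omega>' *\<^sub>R H i \<omega>') \<omega> \<bullet> \<gamma> i \<omega>) =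
          h * F i \<omega> (Yt i \<omega>) (Z i \<omega>) - h * ?ft \<omega>"
        by (simp only: right_diff_distrib)
      moreover have "Y i \<omega> = real_cond_exp M (G i) (Y (Suc i)) \<omega> + h * ?f \<omega>"
        by (rule trans[OF elim(1,5)])
      moreover have "Yt i \<omega> = real_cond_exp M (G i) (Yt (Suc i)) \<omega> + h * ?ft \<omega> + \<zeta> i \<omega>"
        using elim(2) by (simp only: elim(6))
      ultimately have "(Y i \<omega> - Yt i \<omega>) - real_cond_exp M (G i) \<delta>' \<omega>
          - h * (vec_cond_exp M (G i) (\<lambda>\<omega>'. \<delta>' \<omega>' *\<^sub>R H i \<omega>') \<omega> \<bullet> \<gamma> i \<omega>) + \<zeta> i \<omega>
          = h * (F i \<omega> (Y i \<omega>) (Z i \<omega>) - F i \<omega> (Yt i \<omega>) (Z i \<omega>))"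
        unfolding right_diff_distrib using elim(7) by linarith
      then show ?case
        using elim(9) h by (simp add: abs_mult mult.assoc)
    qed
    then have first: "AE \<omega> in M. ennreal \<bar>Y i \<omega> - Yt i \<omega>\<bar> \<le> ennreal (exp (h * Ky / e)) *
        (nn_cond_exp M (G i) (\<lambda>\<omega>. ennreal (factor \<gamma> i \<omega> * \<bar>\<delta>' \<omega>\<bar>)) \<omega> + ennreal \<bar>\<zeta> i \<omega>\<bar>)"
      unfolding factor_def h_def using step_Ky_le[OF i] constants
      by (intro stability_step[OF int'(3) \<gamma>i]) auto
    \<comment> \<open>The factor accumulated after this step. It is at least 1, so it may be put in
      front of \<open>|\<zeta> i|\<close> as well.\<close>
    define r where "r = exp ((T - t (Suc i)) * Ky / e)"
    have r: "1 \<le> r" using t_range(2)[of "Suc i"] i constants by (simp add: r_def)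
    let ?W = "\<lambda>\<omega>. ennreal (weight \<gamma> i \<omega>)"
    let ?N = "nn_cond_exp M (G (Suc i)) (\<lambda>\<omega>. ennreal (weight \<gamma> (Suc i) \<omega>) * ?X (Suc i) \<omega>)"
    have [measurable]: "factor \<gamma> i \<in> borel_measurable M" "weight \<gamma> i \<in> borel_measurable M"
        "\<delta>' \<in> borel_measurable M" "\<zeta> i \<in> borel_measurable M"
      using i int' int(3)[OF i] by (auto intro: factor_meas[OF \<gamma>] weight_meas[OF \<gamma>])
    have X_i: "(\<lambda>\<omega>. ?W \<omega> * ?X (Suc i) \<omega> + ennreal \<bar>\<zeta> i \<omega>\<bar> * ?W \<omega>) = (\<lambda>\<omega>. ?W \<omega> * ?X i \<omega>)"
      using i by (auto simp: fun_eq_iff sum.atLeast_Suc_lessThan ennreal_plus distrib_left sum_nonneg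
          mult.commute add_ac)
    have "AE \<omega> in M. nn_cond_exp M (G i) (\<lambda>\<omega>. ennreal (factor \<gamma> i \<omega> * \<bar>\<delta>' \<omega>\<bar>)) \<omega>
        \<le> nn_cond_exp M (G i) (\<lambda>\<omega>. ennreal r * (ennreal (factor \<gamma> i \<omega>) * ?N \<omega>)) \<omega>"
    proof (rule nn_cond_exp_mono)
      show "AE \<omega> in M. ennreal (factor \<gamma> i \<omega> * \<bar>\<delta>' \<omega>\<bar>) \<le> ennreal r * (ennreal (factor \<gamma> i \<omega>) * ?N \<omega>)"
        using step.IH
      proof eventually_elim
        case (elim \<omega>)
        have "ennreal (factor \<gamma> i \<omega> * \<bar>\<delta>' \<omega>\<bar>) = ennreal (factor \<gamma> i \<omega>) * ennreal \<bar>\<delta>' \<omega>\<bar>"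
          by (simp add: ennreal_mult'')
        also have "\<dots> \<le> ennreal (factor \<gamma> i \<omega>) * (ennreal r * ?N \<omega>)"
          using elim by (intro mult_left_mono) (auto simp: \<delta>'_def r_def)
        finally show ?case by (simp add: mult.left_commute)
      qed
    qed auto
    moreover have "AE \<omega> in M. nn_cond_exp M (G i) (\<lambda>\<omega>. ennreal r * (ennreal (factor \<gamma> i \<omega>) * ?N \<omega>)) \<omega>
        = ennreal r * nn_cond_exp M (G i) (\<lambda>\<omega>. ennreal (factor \<gamma> i \<omega>) * ?N \<omega>) \<omega>"
      by (rule nn_cond_exp_cmult) auto
    moreover have "AE \<omega> in M. nn_cond_exp M (G i) (\<lambda>\<omega>. ?W \<omega> * ?X (Suc i) \<omega>) \<omega> =
        nn_cond_exp M (G i) (\<lambda>\<omega>. ennreal (factor \<gamma> i \<omega>) * ?N \<omega>) \<omega>"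
      by (rule nn_cond_exp_factor_weight[OF \<gamma> i X_meas])
    \<comment> \<open>With the conditional mean 1 of the weight this moves the new perturbation
      under the weight, where it joins the sum in \<open>?X i\<close>.\<close>
    moreover have "AE \<omega> in M. ennreal \<bar>\<zeta> i \<omega>\<bar> * nn_cond_exp M (G i) ?W \<omega> =
        nn_cond_exp M (G i) (\<lambda>\<omega>. ennreal \<bar>\<zeta> i \<omega>\<bar> * ?W \<omega>) \<omega>"
      using \<zeta>[OF i] by (intro nn_cond_exp_prod) auto
    moreover have "AE \<omega> in M. nn_cond_exp M (G i) ?W \<omega> = 1"
      using i by (intro nn_cond_exp_weight[OF \<gamma>]) auto
    moreover have "AE \<omega> in M. nn_cond_exp M (G i) (\<lambda>\<omega>. ?W \<omega> * ?X (Suc i) \<omega>) \<omega> +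
        nn_cond_exp M (G i) (\<lambda>\<omega>. ennreal \<bar>\<zeta> i \<omega>\<bar> * ?W \<omega>) \<omega> =
        nn_cond_exp M (G i) (\<lambda>\<omega>. ?W \<omega> * ?X (Suc i) \<omega> + ennreal \<bar>\<zeta> i \<omega>\<bar> * ?W \<omega>) \<omega>"
      by (intro nn_cond_exp_sum borel_measurable_times_ennreal X_meas) measurable
    ultimately have "AE \<omega> in M. nn_cond_exp M (G i) (\<lambda>\<omega>. ennreal (factor \<gamma> i \<omega> * \<bar>\<delta>' \<omega>\<bar>)) \<omega>
        + ennreal \<bar>\<zeta> i \<omega>\<bar> \<le> ennreal r * nn_cond_exp M (G i) (\<lambda>\<omega>. ?W \<omega> * ?X i \<omega>) \<omega>"
      unfolding X_i
    proof eventually_elim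
      case (elim \<omega>)
      have "ennreal \<bar>\<zeta> i \<omega>\<bar> = 1 * ennreal \<bar>\<zeta> i \<omega>\<bar>" by simp
      also have "\<dots> \<le> ennreal r * ennreal \<bar>\<zeta> i \<omega>\<bar>"
        using r by (intro mult_right_mono) auto
      also have "\<dots> = ennreal r * nn_cond_exp M (G i) (\<lambda>\<omega>. ennreal \<bar>\<zeta> i \<omega>\<bar> * ?W \<omega>) \<omega>"
        unfolding elim(4)[symmetric] elim(5) by simp
      finally have "nn_cond_exp M (G i) (\<lambda>\<omega>. ennreal (factor \<gamma> i \<omega> * \<bar>\<delta>' \<omega>\<bar>)) \<omega> + ennreal \<bar>\<zeta> i \<omega>\<bar>
          \<le> ennreal r * nn_cond_exp M (G i) (\<lambda>\<omega>. ?W \<omega> * ?X (Suc i) \<omega>) \<omega>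
            + ennreal r * nn_cond_exp M (G i) (\<lambda>\<omega>. ennreal \<bar>\<zeta> i \<omega>\<bar> * ?W \<omega>) \<omega>"
        using elim(1) unfolding elim(2,3) by (rule add_mono[rotated])
      then show ?case
        unfolding elim(6)[symmetric] distrib_left .
    qed
    with first show ?case
    proof eventually_elim
      case (elim \<omega>)
      have "(T - t i) * Ky / e = h * Ky / e + (T - t (Suc i)) * Ky / e"
        by (simp add: h_def step_def field_simps add_divide_distrib diff_divide_distrib)
      then have "exp ((T - t i) * Ky / e) = exp (h * Ky / e) * r"
        by (simp add: r_def exp_add)
      then have "ennreal (exp ((T - t i) * Ky / e)) = ennreal (exp (h * Ky / e)) * ennreal r"
        using r by (simp add: ennreal_mult)
      moreover have "ennreal (exp (h * Ky / e)) * (nn_cond_exp M (G i) (\<lambda>\<omega>. ennreal (factor \<gamma> i \<omega> * \<bar>\<delta>' \<omega>\<bar>)) \<omega> + ennreal \<bar>\<zeta> i \<omega>\<bar>)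
         \<le> ennreal (exp (h * Ky / e)) * (ennreal r * nn_cond_exp M (G i) (\<lambda>\<omega>. ?W \<omega> * ?X i \<omega>) \<omega>)"
        using elim(2) by (intro mult_left_mono) auto
      ultimately show ?case
        using order_trans[OF elim(1)] by (simp add: mult.assoc)
    qed
  qed
qed

end

text \<open>Integrating the bound shows that \<open>f\<close> is integrable. Thus a conditional
  moment bound in \<open>ennreal\<close>, which presupposes no integrability, becomes usable for
  \<open>real_cond_exp\<close>.\<close>

lemma (in finite_measure_subalgebra) nn_cond_exp_boundedD:
  fixes f :: "'a \<Rightarrow> real"
  assumes [measurable]: "f \<in> borel_measurable M" and nonneg: "\<And>\<omega>. 0 \<le> f \<omega>" and C: "0 \<le> C"
    and bound: "AE \<omega> in M. nn_cond_exp M F (\<lambda>\<omega>. ennreal (f \<omega>)) \<omega> \<le> ennreal C"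
  shows "integrable M f" "AE \<omega> in M. real_cond_exp M F f \<omega> \<le> C"
proof -
  have "(\<integral>\<^sup>+\<omega>. ennreal (f \<omega>) \<partial>M) = (\<integral>\<^sup>+\<omega>. nn_cond_exp M F (\<lambda>\<omega>. ennreal (f \<omega>)) \<omega> \<partial>M)"
    using nn_cond_exp_intg[of "\<lambda>_. 1" "\<lambda>\<omega>. ennreal (f \<omega>)"] by simp
  also have "\<dots> \<le> (\<integral>\<^sup>+\<omega>. ennreal C \<partial>M)"
    using bound by (rule nn_integral_mono_AE)
  also have "\<dots> < \<infinity>"
    by (simp add: ennreal_mult_less_top emeasure_eq_measure)
  finally show int: "integrable M f"
    using nonneg by (intro integrableI_nonneg) auto
  have "AE \<omega> in M. nn_cond_exp M F (\<lambda>\<omega>. ennreal (f \<omega>)) \<omega> = ennreal (real_cond_exp M F f \<omega>)"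
    using nonneg by (intro nn_cond_exp_eq_has_cond_exp has_cond_expI int) auto
  with bound show "AE \<omega> in M. real_cond_exp M F f \<omega> \<le> C"
    by eventually_elim (use C in \<open>simp add: ennreal_le_iff\<close>)
qed

section \<open>A priori bounds for \<open>Y\<close> and for the sum of
  \<open>h * |Z|^2\<close>\<close>

context bsde_scheme
begin

lemma finite_measure_subalgebra_G: "i \<le> n \<Longrightarrow> finite_measure_subalgebra M (G i)"
  by (simp add: finite_measure_subalgebra_def finite_measure_subalgebra_axioms_def
      subalg_G finite_measure_axioms)

text \<open>In the stability estimate against the zero process, the terminal difference and the
  perturbations together are almost surely at most \<open>B0 + T * Ct\<close>. A bounded quantity
  under weights of conditional mean 1 needs no Hoelder inequality.\<close>

lemma solution_bounded:
  assumes sol: "scheme_solution M \<F> n t H F \<xi> Y Z"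
    and \<xi>: "\<xi> \<in> borel_measurable M" "AE \<omega> in M. \<bar>\<xi> \<omega>\<bar> \<le> B0" "0 \<le> B0"
    and F0: "\<And>i. i < n \<Longrightarrow> AE \<omega> in M. \<bar>F i \<omega> 0 0\<bar> \<le> Ct" "0 \<le> Ct"
    and i: "i \<le> n"
  shows "AE \<omega> in M. \<bar>Y i \<omega>\<bar> \<le> exp (T * Ky / e) * (B0 + T * Ct)"
proof -
  interpret i: finite_measure_subalgebra M "G i" using i by (rule finite_measure_subalgebra_G)
  define \<zeta> where "\<zeta> = (\<lambda>i \<omega>. - (step t i * F i \<omega> 0 0))"
  define \<gamma> where "\<gamma> = (\<lambda>j \<omega>. linearization (F j \<omega>) 0 (Z j \<omega>) 0)"
  have F0_meas: "(\<lambda>\<omega>. F i \<omega> 0 0) \<in> borel_measurable (G i)" if "i < n" for i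
    using F_meas_comp[OF that, of "\<lambda>_. 0" "\<lambda>_. 0"] by simp
  have \<zeta>_meas: "\<zeta> i \<in> borel_measurable (G i)" if "i < n" for i
    unfolding \<zeta>_def using F0_meas[OF that] by measurable
  have F0_int: "integrable M (\<lambda>\<omega>. F i \<omega> 0 0)" if "i < n" for i
    using F0(1)[OF that] measurable_G[OF F0_meas[OF that]] that
    by (intro integrable_const_bound[of _ Ct]) auto
  have \<zeta>_int: "integrable M (\<zeta> i)" if "i < n" for i
    unfolding \<zeta>_def using F0_int[OF that] by simp
  have zero: "perturbed_scheme_solution M \<F> n t H F (\<lambda>_. 0) \<zeta> (\<lambda>_ _. 0) (\<lambda>_ _. 0)"
    unfolding perturbed_scheme_solution_def
  proof (intro conjI allI impI)
    fix j assume j: "j < n"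
    interpret finite_measure_subalgebra M "G j" using j by (intro finite_measure_subalgebra_G) simp
    have int: "integrable M (\<lambda>\<omega>. 0 + step t j * F j \<omega> 0 0)" using F0_int[OF j] by simp
    then show "integrable M (\<lambda>\<omega>. 0 + step t j * F j \<omega> 0 0)" .
    have "AE \<omega> in M. real_cond_exp M (G j) (\<lambda>\<omega>'. 0 + step t j * F j \<omega>' 0 0) \<omega> = 0 + step t j * F j \<omega> 0 0"
      using F0_meas[OF j] int by (intro real_cond_exp_F_meas) auto
    then show "AE \<omega> in M. 0 = real_cond_exp M (G j) (\<lambda>\<omega>'. 0 + step t j * F j \<omega>' 0 0) \<omega> + \<zeta> j \<omega>"
      by eventually_elim (simp add: \<zeta>_def)
    have "AE \<omega> in M. real_cond_exp M (G j) (\<lambda>_. 0) \<omega> = 0"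
      by (rule real_cond_exp_F_meas) auto
    then show "AE \<omega> in M. 0 = vec_cond_exp M (G j) (\<lambda>\<omega>'. 0 *\<^sub>R H j \<omega>') \<omega>"
      by eventually_elim (simp add: vec_cond_exp_def vec_eq_iff)
  qed auto
  have \<xi>_int: "integrable M \<xi>"
    using \<xi> by (intro integrable_const_bound[of _ B0]) auto
  note st = stability[OF sol zero \<xi>_int _ \<zeta>_int \<zeta>_meas i, folded \<gamma>_def]
  have Z_meas: "Z j \<in> borel_measurable (G j)" if "j < n" for j
    using sol that by (auto simp: scheme_solution_def perturbed_scheme_solution_def)
  have \<gamma>: "admissible \<gamma>"
    unfolding \<gamma>_def by (rule admissible_linearization) (auto intro: Z_meas)
  have [measurable]: "weight \<gamma> i \<in> borel_measurable M" by (rule weight_meas[OF \<gamma> i])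
  define b where "b = B0 + T * Ct"
  have b: "0 \<le> b" using \<xi> F0 T_nonneg by (simp add: b_def)
  let ?X = "\<lambda>\<omega>. \<bar>Y n \<omega> - 0\<bar> + (\<Sum>j=i..<n. \<bar>\<zeta> j \<omega>\<bar>)"
  have "AE \<omega> in M. \<forall>j\<in>{i..<n}. \<bar>F j \<omega> 0 0\<bar> \<le> Ct"
    using F0(1) by (subst AE_finite_all) auto
  moreover have Yn: "AE \<omega> in M. Y n \<omega> = \<xi> \<omega>"
    using sol by (simp add: scheme_solution_def perturbed_scheme_solution_def)
  ultimately have X: "AE \<omega> in M. ?X \<omega> \<le> b"
    using \<xi>(2)
  proof eventually_elim
    case (elim \<omega>)
    have "(\<Sum>j=i..<n. \<bar>\<zeta> j \<omega>\<bar>) \<le> (\<Sum>j=i..<n. step t j * Ct)"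
    proof (rule sum_mono)
      fix j assume j: "j \<in> {i..<n}"
      then show "\<bar>\<zeta> j \<omega>\<bar> \<le> step t j * Ct"
        using elim(1) step_pos[of j] by (simp add: \<zeta>_def abs_mult)
    qed
    also have "\<dots> = (T - t i) * Ct" using sum_step[OF i] by (simp flip: sum_distrib_right)
    also have "\<dots> \<le> T * Ct" using t_range[OF i] F0 by (intro mult_right_mono) auto
    finally show ?case using elim(2,3) by (simp add: b_def)
  qed
  have Xm: "?X \<in> borel_measurable M"
  proof -
    have "Y n \<in> borel_measurable M"
      using sol measurable_G[of "Y n" n] by (auto simp: scheme_solution_def perturbed_scheme_solution_def)
    moreover have "(\<lambda>\<omega>. \<Sum>j=i..<n. \<bar>\<zeta> j \<omega>\<bar>) \<in> borel_measurable M"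
      using \<zeta>_int by (intro borel_measurable_sum borel_measurable_abs borel_measurable_integrable) auto
    ultimately show ?thesis by measurable
  qed
  have "AE \<omega> in M. nn_cond_exp M (G i) (\<lambda>\<omega>. ennreal (weight \<gamma> i \<omega>) * ennreal (?X \<omega>)) \<omega>
      \<le> nn_cond_exp M (G i) (\<lambda>\<omega>. ennreal b * ennreal (weight \<gamma> i \<omega>)) \<omega>"
  proof (rule i.nn_cond_exp_mono)
    show "AE \<omega> in M. ennreal (weight \<gamma> i \<omega>) * ennreal (?X \<omega>) \<le> ennreal b * ennreal (weight \<gamma> i \<omega>)"
      using X by eventually_elim (subst mult.commute, intro mult_right_mono ennreal_leI, auto)
    show "(\<lambda>\<omega>. ennreal (weight \<gamma> i \<omega>) * ennreal (?X \<omega>)) \<in> borel_measurable M"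
      using Xm by (intro borel_measurable_times_ennreal measurable_compose[OF Xm measurable_ennreal]) measurable
  qed auto
  moreover have "AE \<omega> in M. nn_cond_exp M (G i) (\<lambda>\<omega>. ennreal b * ennreal (weight \<gamma> i \<omega>)) \<omega>
      = ennreal b * nn_cond_exp M (G i) (\<lambda>\<omega>. ennreal (weight \<gamma> i \<omega>)) \<omega>"
    by (rule i.nn_cond_exp_cmult) auto
  moreover have "AE \<omega> in M. ennreal \<bar>Y i \<omega> - 0\<bar> \<le> ennreal (exp ((T - t i) * Ky / e)) *
      nn_cond_exp M (G i) (\<lambda>\<omega>. ennreal (weight \<gamma> i \<omega>) * ennreal (?X \<omega>)) \<omega>"
    by (rule st) auto
  ultimately show ?thesis
    using nn_cond_exp_weight[OF \<gamma> i]
  proof eventually_elim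
    case (elim \<omega>)
    have "ennreal \<bar>Y i \<omega>\<bar> \<le> ennreal (exp ((T - t i) * Ky / e)) *
        nn_cond_exp M (G i) (\<lambda>\<omega>. ennreal (weight \<gamma> i \<omega>) * ennreal (?X \<omega>)) \<omega>"
      using elim(3) by simp
    also have "\<dots> \<le> ennreal (exp ((T - t i) * Ky / e)) * ennreal b"
      using elim(1) unfolding elim(2,4) by (intro mult_left_mono) auto
    also have "\<dots> = ennreal (exp ((T - t i) * Ky / e) * b)" using b by (simp add: ennreal_mult)
    finally have "\<bar>Y i \<omega>\<bar> \<le> exp ((T - t i) * Ky / e) * b"
      using b by (subst (asm) ennreal_le_iff) auto
    also have "\<dots> \<le> exp (T * Ky / e) * b"
      using b t_range[OF i] constants by (intro mult_right_mono) (auto intro!: divide_right_mono mult_right_mono)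
    finally show ?case by (simp add: b_def)
  qed
qed

text \<open>The one-step drift is multiplied by \<open>exp (k * B)\<close>, which makes the
  coefficient of \<open>h * |Z|^2\<close> at least 1. The terms \<open>exp (k * Y i)\<close> then
  telescope under conditioning. The right-hand side keeps \<open>exp (k * Y i)\<close> instead of a
  bound for it, since the induction needs this difference; its value at \<open>n\<close> is
  nonnegative.\<close>

lemma Z_sum_bounded:
  fixes Y :: "nat \<Rightarrow> 'a \<Rightarrow> real" and B Ct L k c0 :: real
  defines "C1 \<equiv> k * (Ct + Ky * B) + 2 * (1 + 1 / e) * c0 * L\<^sup>2"
  assumes sol: "scheme_solution M \<F> n t H F \<xi> Y Z"
    and Y: "\<And>i. i \<le> n \<Longrightarrow> AE \<omega> in M. \<bar>Y i \<omega>\<bar> \<le> B"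
    and F0: "\<And>i. i < n \<Longrightarrow> AE \<omega> in M. \<bar>F i \<omega> 0 0\<bar> \<le> Ct"
    and growth: "\<And>i. i < n \<Longrightarrow> AE \<omega> in M. \<forall>y z z'.
        \<bar>F i \<omega> y z - F i \<omega> y z'\<bar> \<le> L * (1 + norm z + norm z') * norm (z - z')"
    and const: "1 \<le> B" "1 \<le> k" "0 \<le> L" "0 \<le> Ct" "c0 = lmax / CARD('d)" "0 < c0"
      "1 + 2 * (1 + 1 / e) * c0 * L\<^sup>2 \<le> e * k / (10 * B) / c0"
  shows "i < n \<Longrightarrow> integrable M (\<lambda>\<omega>. step t i * (norm (Z i \<omega>))\<^sup>2)"
    and "i \<le> n \<Longrightarrow> AE \<omega> in M. real_cond_exp M (G i) (\<lambda>\<omega>. \<Sum>j=i..<n. step t j * (norm (Z j \<omega>))\<^sup>2) \<omega>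
      \<le> exp (k * B) * (exp (k * B) - exp (k * Y i \<omega>)) + (T - t i) * (C1 * exp (2 * (k * B)))"
proof -
  let ?s = "\<lambda>j \<omega>. step t j * (norm (Z j \<omega>))\<^sup>2"
  let ?R = "\<lambda>i \<omega>. exp (k * B) * (exp (k * B) - exp (k * Y i \<omega>)) + (T - t i) * (C1 * exp (2 * (k * B)))"
  have adapted: "Y i \<in> borel_measurable (G i)" "Z i \<in> borel_measurable (G i)" if "i \<le> n" for i
    using sol that by (auto simp: scheme_solution_def perturbed_scheme_solution_def)
  have Y_meas: "Y i \<in> borel_measurable M" if "i \<le> n" for i
    using measurable_G[OF adapted(1)[OF that]] that by simp
  have Z_eq: "AE \<omega> in M. Z i \<omega> = vec_cond_exp M (G i) (\<lambda>\<omega>. Y (Suc i) \<omega> *\<^sub>R H i \<omega>) \<omega>" if "i < n" for i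
    using sol that by (auto simp: scheme_solution_def perturbed_scheme_solution_def)
  have Y_int: "integrable M (Y i)" if "i \<le> n" for i
    using Y[OF that] Y_meas[OF that] by (intro integrable_const_bound[of _ B]) auto
  have s_int: "integrable M (?s i)" if i: "i < n" for i
  proof -
    interpret scheme_step M "G i" "H i" "step t i" "c i" e K by (rule scheme_step[OF i])
    let ?x2 = "\<lambda>\<omega>. (Y (Suc i) \<omega> - Y i \<omega>)\<^sup>2"
    note [measurable] = Y_meas[of i] Y_meas[of "Suc i"] adapted[of i]
    have "AE \<omega> in M. ?s i \<omega> \<le> c i * real_cond_exp M (G i) ?x2 \<omega>"
      using Y[of i] Y[of "Suc i"] Z_eq[OF i] i adapted[of i] Y_meas[of "Suc i"]
      by (intro norm_vec_cond_exp_le[where B = B]) auto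
    moreover have x2: "AE \<omega> in M. ?x2 \<omega> \<le> (2 * B)\<^sup>2"
      using Y[of i, OF less_imp_le[OF i]] Y[of "Suc i", OF Suc_leI[OF i]]
    proof eventually_elim
      case (elim \<omega>)
      then have "\<bar>Y (Suc i) \<omega> - Y i \<omega>\<bar> \<le> 2 * B" by linarith
      then show ?case by (metis abs_ge_zero power2_abs power_mono)
    qed
    have "AE \<omega> in M. real_cond_exp M (G i) ?x2 \<omega> \<le> (2 * B)\<^sup>2"
    proof (rule real_cond_exp_le_c[OF _ x2])
      show "integrable M ?x2"
        using x2 i by (intro integrable_const_bound[of _ "(2 * B)\<^sup>2"]) auto
    qed
    ultimately have "AE \<omega> in M. \<bar>?s i \<omega>\<bar> \<le> c i * (2 * B)\<^sup>2"
    proof eventually_elim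
      case (elim \<omega>)
      have "c i * real_cond_exp M (G i) ?x2 \<omega> \<le> c i * (2 * B)\<^sup>2"
        using elim(2) pos by (intro mult_left_mono) auto
      moreover have "0 \<le> ?s i \<omega>" using pos by simp
      ultimately show ?case using elim(1) by linarith
    qed
    then show ?thesis
      using i by (intro integrable_bounded[of _ "c i * (2 * B)\<^sup>2"]) auto
  qed
  then show "i < n \<Longrightarrow> integrable M (?s i)" .
  have S_int: "integrable M (\<lambda>\<omega>. \<Sum>j=i..<n. ?s j \<omega>)" for i
    using s_int by (intro Bochner_Integration.integrable_sum) auto
  have exp_int: "integrable M (\<lambda>\<omega>. exp (k * Y i \<omega>))" if "i \<le> n" for i
  proof (rule integrable_const_bound[of _ "exp (k * B)"])
    show "AE \<omega> in M. norm (exp (k * Y i \<omega>)) \<le> exp (k * B)"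
      using Y[OF that] by eventually_elim (use const in auto)
    show "(\<lambda>\<omega>. exp (k * Y i \<omega>)) \<in> borel_measurable M"
      using Y_meas[OF that] by measurable
  qed
  assume "i \<le> n"
  then show "AE \<omega> in M. real_cond_exp M (G i) (\<lambda>\<omega>. \<Sum>j=i..<n. ?s j \<omega>) \<omega> \<le> ?R i \<omega>"
  proof (induction i rule: inc_induct)
    case base
    interpret finite_measure_subalgebra M "G n" by (rule finite_measure_subalgebra_G) simp
    have "AE \<omega> in M. real_cond_exp M (G n) (\<lambda>\<omega>. 0) \<omega> = 0"
      by (rule real_cond_exp_F_meas) auto
    with Y[OF order_refl] show ?case
      by eventually_elim (use grid const in \<open>simp add: time_grid_def\<close>)
  next
    case (step i)
    have i: "i < n" by fact
    interpret scheme_step M "G i" "H i" "step t i" "c i" e K by (rule scheme_step[OF i])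
    define h where "h = step t i"
    have h: "0 < h" using step_pos[OF i] by (simp add: h_def)
    have i': "i \<le> n" "Suc i \<le> n" using i by auto
    note [measurable] = Y_meas[OF i'(1)] Y_meas[OF i'(2)] adapted[OF i'(1)]
    \<comment> \<open>Linearisation between \<open>Z\<close> and 0 at the actual value of
      \<open>Y\<close>: the remainder \<open>F i (Y i) 0\<close> is then bounded, and
      \<open>\<gamma>\<close> grows at most like \<open>1 + |Z|\<close>.\<close>
    define \<gamma> where "\<gamma> = (\<lambda>j \<omega>. linearization (F j \<omega>) (Y j \<omega>) (Z j \<omega>) 0)"
    have "admissible \<gamma>"
      unfolding \<gamma>_def by (rule admissible_linearization) (auto intro: adapted)
    then have \<gamma>i: "\<gamma> i \<in> borel_measurable (G i)" "AE \<omega> in M. norm (\<gamma> i \<omega>) \<le> K"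
      using i by (auto simp: admissible_def)
    let ?f = "\<lambda>\<omega>. F i \<omega> (Y i \<omega>) (Z i \<omega>)"
    have f [measurable]: "?f \<in> borel_measurable (G i)" by (auto intro!: F_meas_comp[OF i])
    have sum_int: "integrable M (\<lambda>\<omega>. Y (Suc i) \<omega> + h * ?f \<omega>)"
      using sol i by (auto simp: scheme_solution_def perturbed_scheme_solution_def h_def)
    have hf_int: "integrable M (\<lambda>\<omega>. h * ?f \<omega>)"
      using Bochner_Integration.integrable_diff[OF sum_int Y_int[OF i'(2)]] by simp
    have "has_cond_exp M (G i) (\<lambda>\<omega>. Y (Suc i) \<omega> + h * ?f \<omega>) (\<lambda>\<omega>. real_cond_exp M (G i) (Y (Suc i)) \<omega> + h * ?f \<omega>)"
      using Y_int[OF i'(2)] hf_int by (intro has_cond_exp_add has_cond_expI has_cond_exp_self) auto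
    then have "AE \<omega> in M. real_cond_exp M (G i) (\<lambda>\<omega>. Y (Suc i) \<omega> + h * ?f \<omega>) \<omega> =
        real_cond_exp M (G i) (Y (Suc i)) \<omega> + h * ?f \<omega>"
      by (simp add: has_cond_exp_def)
    moreover have "AE \<omega> in M. Y i \<omega> = real_cond_exp M (G i) (\<lambda>\<omega>. Y (Suc i) \<omega> + h * ?f \<omega>) \<omega>"
      using sol i by (auto simp: scheme_solution_def perturbed_scheme_solution_def h_def)
    ultimately have eq: "AE \<omega> in M. Y i \<omega> = real_cond_exp M (G i) (Y (Suc i)) \<omega> +
        h * (F i \<omega> (Y i \<omega>) 0 + Z i \<omega> \<bullet> \<gamma> i \<omega>)"
    proof eventually_elim
      case (elim \<omega>)
      have "Z i \<omega> \<bullet> \<gamma> i \<omega> = ?f \<omega> - F i \<omega> (Y i \<omega>) 0"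
        unfolding \<gamma>_def by (subst inner_commute) (use linearization_inner[of _ _ "Z i \<omega>" 0] in simp)
      then have "F i \<omega> (Y i \<omega>) 0 + Z i \<omega> \<bullet> \<gamma> i \<omega> = ?f \<omega>" by simp
      then show ?case using trans[OF elim(2,1)] by simp
    qed
    have f0: "AE \<omega> in M. \<bar>F i \<omega> (Y i \<omega>) 0\<bar> \<le> Ct + Ky * B"
      using F_AE_lipschitz_y[OF i] F0[OF i] Y[OF i'(1)]
    proof eventually_elim
      case (elim \<omega>)
      have "\<bar>F i \<omega> (Y i \<omega>) 0 - F i \<omega> 0 0\<bar> \<le> Ky * \<bar>Y i \<omega>\<bar>"
        using elim(1)[rule_format, of "Y i \<omega>" 0 0] by simp
      also have "\<dots> \<le> Ky * B" using elim(3) constants by (intro mult_left_mono) auto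
      finally show ?case using elim(2) by linarith
    qed
    have \<gamma>_Z: "AE \<omega> in M. norm (\<gamma> i \<omega>) \<le> L * (1 + norm (Z i \<omega>))"
      using growth[OF i]
    proof eventually_elim
      case (elim \<omega>)
      show ?case
        unfolding \<gamma>_def using elim[rule_format, of "Y i \<omega>" "Z i \<omega>" 0] const
        by (intro norm_linearization_le) auto
    qed
    have "AE \<omega> in M. exp (k * Y i \<omega>) * (1 + h * (norm (Z i \<omega>))\<^sup>2
        - h * (k * (Ct + Ky * B) + 2 * (1 + 1 / e) * c0 * L\<^sup>2))
        \<le> real_cond_exp M (G i) (\<lambda>\<omega>'. exp (k * Y (Suc i) \<omega>')) \<omega>"
      unfolding h_def
      by (rule exponential_step[OF adapted(1)[OF i'(1)] Y_meas[OF i'(2)] Y[OF i'(1)] Y[OF i'(2)]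
          adapted(2)[OF i'(1)] Z_eq[OF i] \<gamma>i \<gamma>_Z eq[unfolded h_def] f0 const(1,2,3) _ const(7)])
        (use coefficient_bounds(2)[OF i] const(5) in simp)
    then have main: "AE \<omega> in M. exp (k * Y i \<omega>) * (1 + ?s i \<omega> - h * C1)
        \<le> real_cond_exp M (G i) (\<lambda>\<omega>'. exp (k * Y (Suc i) \<omega>')) \<omega>"
      by (simp add: C1_def h_def)
    let ?S = "\<lambda>\<omega>. \<Sum>j=Suc i..<n. ?s j \<omega>"
    have "has_cond_exp M (G i) (\<lambda>\<omega>. ?s i \<omega> + ?S \<omega>) (\<lambda>\<omega>. ?s i \<omega> + real_cond_exp M (G i) ?S \<omega>)"
      using s_int[OF i] S_int by (intro has_cond_exp_add has_cond_exp_self has_cond_expI) auto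
    then have "has_cond_exp M (G i) (\<lambda>\<omega>. \<Sum>j=i..<n. ?s j \<omega>) (\<lambda>\<omega>. ?s i \<omega> + real_cond_exp M (G i) ?S \<omega>)"
      using i by (simp add: sum.atLeast_Suc_lessThan)
    then have "AE \<omega> in M. real_cond_exp M (G i) (\<lambda>\<omega>. \<Sum>j=i..<n. ?s j \<omega>) \<omega> = ?s i \<omega> + real_cond_exp M (G i) ?S \<omega>"
      by (simp add: has_cond_exp_def)
    moreover have "AE \<omega> in M. real_cond_exp M (G i) (real_cond_exp M (G (Suc i)) ?S) \<omega> = real_cond_exp M (G i) ?S \<omega>"
      using i' S_int by (intro real_cond_exp_nested_subalg subalg_G subalg_G_mono) auto
    moreover have "AE \<omega> in M. real_cond_exp M (G i) (real_cond_exp M (G (Suc i)) ?S) \<omega> \<le>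
        exp (k * B) * (exp (k * B) - real_cond_exp M (G i) (\<lambda>\<omega>'. exp (k * Y (Suc i) \<omega>')) \<omega>)
        + (T - t (Suc i)) * (C1 * exp (2 * (k * B)))"
    proof (rule has_cond_exp_mono[OF has_cond_expI _ step.IH])
      interpret Suc: finite_measure_subalgebra M "G (Suc i)" using i'(2) by (rule finite_measure_subalgebra_G)
      show "integrable M (real_cond_exp M (G (Suc i)) ?S)"
        using S_int by (rule Suc.real_cond_exp_int(1))
      show "has_cond_exp M (G i) (?R (Suc i)) (\<lambda>\<omega>. exp (k * B) * (exp (k * B) - real_cond_exp M (G i) (\<lambda>\<omega>'. exp (k * Y (Suc i) \<omega>')) \<omega>)
        + (T - t (Suc i)) * (C1 * exp (2 * (k * B))))"
        using exp_int[OF i'(2)]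
        by (intro has_cond_exp_add has_cond_exp_cmult has_cond_exp_diff has_cond_expI has_cond_exp_self) auto
    qed
    ultimately show ?case
      using main Y[OF i'(1)]
    proof eventually_elim
      case (elim \<omega>)
      define E where "E = real_cond_exp M (G i) (\<lambda>\<omega>'. exp (k * Y (Suc i) \<omega>')) \<omega>"
      \<comment> \<open>The lower bound 1 of \<open>u\<close> serves for the gain
        \<open>h * |Z|^2\<close>, the upper bound \<open>exp (2 * (k * B))\<close> for the error
        \<open>h * C1\<close>.\<close>
      define u where "u = exp (k * B) * exp (k * Y i \<omega>)"
      have "\<bar>k * Y i \<omega>\<bar> \<le> k * B" using elim(5) const by (simp add: abs_mult)
      then have kY: "0 \<le> k * B + k * Y i \<omega>" "k * B + k * Y i \<omega> \<le> 2 * (k * B)" by linarith+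
      have u: "1 \<le> u" "u \<le> exp (2 * (k * B))"
        using kY by (simp_all add: u_def flip: exp_add)
      have C1: "0 \<le> C1"
        using const constants unfolding C1_def by (intro add_nonneg_nonneg mult_nonneg_nonneg) auto
      have "exp (k * B) * (exp (k * Y i \<omega>) * (1 + ?s i \<omega> - h * C1)) \<le> exp (k * B) * E"
        using elim(4) unfolding E_def by (intro mult_left_mono) auto
      then have "u + u * ?s i \<omega> - u * (h * C1) \<le> exp (k * B) * E"
        by (simp add: u_def algebra_simps)
      moreover have "1 * ?s i \<omega> \<le> u * ?s i \<omega>" using u pos by (intro mult_right_mono) auto
      moreover have "u * (h * C1) \<le> exp (2 * (k * B)) * (h * C1)"
        using u h C1 by (intro mult_right_mono) auto
      moreover have "(T - t i) * (C1 * exp (2 * (k * B))) =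
          exp (2 * (k * B)) * (h * C1) + (T - t (Suc i)) * (C1 * exp (2 * (k * B)))"
        by (simp add: h_def step_def algebra_simps)
      moreover have "exp (k * B) * (exp (k * B) - exp (k * Y i \<omega>)) = exp (k * B) * exp (k * B) - u"
        by (simp add: u_def right_diff_distrib)
      moreover have "exp (k * B) * (exp (k * B) - E) = exp (k * B) * exp (k * B) - exp (k * B) * E"
        by (simp add: right_diff_distrib)
      ultimately show ?case
        using elim(1,2,3) unfolding E_def by linarith
    qed
  qed
qed

section \<open>Times between grid points, and the combination of the estimates\<close>

lemma discrete_exponential_ratio:
  assumes \<gamma>: "admissible \<gamma>" and i: "i \<le> n" and s: "t i \<le> s" "i < n \<Longrightarrow> s < t (Suc i)"
  shows "AE \<omega> in M. discrete_exponential n t H \<gamma> T \<omega> powr p / discrete_exponential n t H \<gamma> s \<omega> powr p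
    = weight \<gamma> i \<omega> powr p"
proof -
  have le_T: "t (Suc j) \<le> T" if "j < n" for j
    using t_range(2)[of "Suc j"] that by simp
  have le_s: "t (Suc j) \<le> s \<longleftrightarrow> j < i" if "j < n" for j
    using t_mono[of "Suc j" i] t_mono[of "Suc i" "Suc j"] s i that by (cases "j < i") auto
  have DT: "{j. j < n \<and> t (Suc j) \<le> T} = {0..<n}" and Ds: "{j. j < n \<and> t (Suc j) \<le> s} = {0..<i}"
    using le_T le_s i by auto
  have D: "discrete_exponential n t H \<gamma> T \<omega> = weight \<gamma> 0 \<omega>"
    "weight \<gamma> 0 \<omega> = discrete_exponential n t H \<gamma> s \<omega> * weight \<gamma> i \<omega>" for \<omega>
    using prod.atLeastLessThan_concat[of 0 i n "\<lambda>j. factor \<gamma> j \<omega>"] i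
    by (simp_all add: discrete_exponential_def DT Ds weight_def factor_def)
  show ?thesis
    using weight_pos[OF \<gamma> le0] weight_pos[OF \<gamma> i]
  proof eventually_elim
    case (elim \<omega>)
    then have "0 < discrete_exponential n t H \<gamma> s \<omega>"
      using D(2)[of \<omega>] by (simp add: zero_less_mult_iff)
    then show ?case using elim by (simp add: D powr_mult)
  qed
qed

text \<open>For \<open>s\<close> inside a step the exponential still has its value at the left grid
  point, but one conditions on more than \<open>G i\<close>, so the estimate at \<open>t i\<close>
  does not apply. The factor of the current step is bounded by 2, and the estimate at the right grid
  point is used for the others: \<open>2 powr p * 2 \<le> 8\<close>.\<close>

lemma reverse_Holder_continuous_time:
  fixes C :: real
  assumes \<gamma>: "admissible \<gamma>" and p: "1 \<le> p" "p \<le> 2"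
    and RH: "\<And>i. i \<le> n \<Longrightarrow>
      AE \<omega> in M. nn_cond_exp M (G i) (\<lambda>\<omega>. ennreal (weight \<gamma> i \<omega> powr p)) \<omega> \<le> 2"
    and s: "0 \<le> s" "s \<le> T"
  shows "AE \<omega> in M. nn_cond_exp M (\<F> s) (\<lambda>\<omega>. ennreal (discrete_exponential n t H \<gamma> T \<omega> powr p
    / discrete_exponential n t H \<gamma> s \<omega> powr p)) \<omega> \<le> 8"
proof -
  interpret s: sigma_finite_subalgebra M "\<F> s" using s by (rule sigma_finite_F)
  have *: ?thesis if i: "i \<le> n" "t i \<le> s" "i < n \<Longrightarrow> s < t (Suc i)"
    and le: "AE \<omega> in M. nn_cond_exp M (\<F> s) (\<lambda>\<omega>. ennreal (weight \<gamma> i \<omega> powr p)) \<omega> \<le> 8" for i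
  proof -
    note [measurable] = weight_meas[OF \<gamma> i(1)]
    have [measurable]: "discrete_exponential n t H \<gamma> r \<in> borel_measurable M" for r
      using factor_meas[OF \<gamma>] unfolding discrete_exponential_def[abs_def] factor_def[abs_def]
      by (intro borel_measurable_prod) auto
    have "AE \<omega> in M. nn_cond_exp M (\<F> s) (\<lambda>\<omega>. ennreal (discrete_exponential n t H \<gamma> T \<omega> powr p
        / discrete_exponential n t H \<gamma> s \<omega> powr p)) \<omega>
        = nn_cond_exp M (\<F> s) (\<lambda>\<omega>. ennreal (weight \<gamma> i \<omega> powr p)) \<omega>"
      using discrete_exponential_ratio[OF \<gamma> i, of p]
      by (intro s.nn_cond_exp_cong) (auto elim: eventually_mono)
    with le show ?thesis by eventually_elim simp
  qed
  show ?thesis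
  proof (cases "s = T")
    case True
    have tn: "t n = T" using grid by (simp add: time_grid_def)
    have "AE \<omega> in M. nn_cond_exp M (\<F> s) (\<lambda>\<omega>. ennreal (weight \<gamma> n \<omega> powr p)) \<omega> \<le> 8"
      using RH[of n] unfolding tn True
      by (auto elim!: eventually_mono order_trans)
    then show ?thesis by (intro *[of n]) (use True tn in auto)
  next
    case False
    define m where "m = (LEAST j. s < t j)"
    have sn: "s < t n" using False s grid by (simp add: time_grid_def)
    then have m: "s < t m" "m \<le> n"
      unfolding m_def by (auto intro: LeastI Least_le)
    have "t 0 \<le> s" using s grid by (simp add: time_grid_def)
    then have "m \<noteq> 0" using m by (metis not_le)
    then obtain i where mi: "m = Suc i" by (cases m) auto
    then have i: "i < n" "t i \<le> s" "s < t (Suc i)"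
      using m not_less_Least[of i "\<lambda>j. s < t j"] by (auto simp: m_def not_less)
    note [measurable] = weight_meas[OF \<gamma>, of i] weight_meas[OF \<gamma>, of "Suc i"] factor_meas[OF \<gamma>, of i]
    let ?f = "\<lambda>\<omega>. ennreal (factor \<gamma> i \<omega> powr p)" and ?w = "\<lambda>\<omega>. ennreal (weight \<gamma> (Suc i) \<omega> powr p)"
    have ineq: "AE \<omega> in M. ennreal (weight \<gamma> i \<omega> powr p) \<le> 4 * ?w \<omega>"
      using factor_bounds[OF \<gamma> i(1)] weight_pos[OF \<gamma>, of "Suc i", OF Suc_leI[OF i(1)]]
    proof eventually_elim
      case (elim \<omega>)
      have "factor \<gamma> i \<omega> powr p \<le> 2 powr p" using elim constants p by (intro powr_mono2) auto
      also have "\<dots> \<le> 2 powr 2" using p by (intro powr_mono) auto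
      finally have "factor \<gamma> i \<omega> powr p * weight \<gamma> (Suc i) \<omega> powr p \<le> 4 * weight \<gamma> (Suc i) \<omega> powr p"
        by (intro mult_right_mono) auto
      then have "weight \<gamma> i \<omega> powr p \<le> 4 * weight \<gamma> (Suc i) \<omega> powr p"
        using elim constants by (simp add: weight_Suc[OF i(1)] powr_mult)
      from ennreal_leI[OF this] show ?case by (simp add: ennreal_mult)
    qed
    have "AE \<omega> in M. nn_cond_exp M (\<F> s) (\<lambda>\<omega>. ennreal (weight \<gamma> i \<omega> powr p)) \<omega>
        \<le> nn_cond_exp M (\<F> s) (\<lambda>\<omega>. 4 * ?w \<omega>) \<omega>"
      using i by (intro s.nn_cond_exp_mono ineq) auto
    moreover have "AE \<omega> in M. nn_cond_exp M (\<F> s) (\<lambda>\<omega>. 4 * ?w \<omega>) \<omega>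
        = nn_cond_exp M (\<F> s) (\<lambda>\<omega>. 4 * nn_cond_exp M (G (Suc i)) ?w \<omega>) \<omega>"
      using i s t_range(2)[of "Suc i"] by (intro nn_cond_exp_tower) auto
    moreover have "AE \<omega> in M. nn_cond_exp M (\<F> s) (\<lambda>\<omega>. 4 * nn_cond_exp M (G (Suc i)) ?w \<omega>) \<omega>
        \<le> nn_cond_exp M (\<F> s) (\<lambda>_. 8) \<omega>"
    proof (rule s.nn_cond_exp_mono)
      show "AE \<omega> in M. 4 * nn_cond_exp M (G (Suc i)) ?w \<omega> \<le> 8"
        using RH[of "Suc i", OF Suc_leI[OF i(1)]]
      proof eventually_elim
        case (elim \<omega>)
        then have "4 * nn_cond_exp M (G (Suc i)) ?w \<omega> \<le> 4 * (2 :: ennreal)"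
          by (rule mult_left_mono) simp
        then show ?case by simp
      qed
    qed auto
    moreover have "AE \<omega> in M. 8 = nn_cond_exp M (\<F> s) (\<lambda>_. 8) \<omega>"
      by (rule s.nn_cond_exp_F_meas) auto
    ultimately have "AE \<omega> in M. nn_cond_exp M (\<F> s) (\<lambda>\<omega>. ennreal (weight \<gamma> i \<omega> powr p)) \<omega> \<le> 8"
      by eventually_elim simp
    then show ?thesis by (intro *[of i]) (use i in auto)
  qed
qed

text \<open>Hoelder is applied to the terminal difference and to the sum of perturbations
  separately, so the two conditional norms appear as a sum with the common constant
  \<open>2 * C + 1\<close>.\<close>

lemma stability_Holder:
  fixes Y Yt \<zeta> :: "nat \<Rightarrow> 'a \<Rightarrow> real" and Z Zt :: "nat \<Rightarrow> 'a \<Rightarrow> real ^ 'd" and p q C :: real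
  defines "\<gamma> \<equiv> \<lambda>j \<omega>. linearization (F j \<omega>) (Yt j \<omega>) (Z j \<omega>) (Zt j \<omega>)"
  assumes sol: "scheme_solution M \<F> n t H F \<xi> Y Z"
    and solt: "perturbed_scheme_solution M \<F> n t H F \<xi>t \<zeta> Yt Zt"
    and int: "integrable M \<xi>" "integrable M \<xi>t" "\<And>i. i < n \<Longrightarrow> integrable M (\<zeta> i)"
    and \<zeta>: "\<And>i. i < n \<Longrightarrow> \<zeta> i \<in> borel_measurable (G i)"
    and pq: "1 < p" "1 < q" "1 / p + 1 / q = 1" and C: "0 \<le> C"
    and \<gamma>: "admissible \<gamma>"
    and RH: "AE \<omega> in M. nn_cond_exp M (G i) (\<lambda>\<omega>. ennreal (weight \<gamma> i \<omega> powr p)) \<omega> \<le> ennreal C"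
    and i: "i \<le> n"
  shows "AE \<omega> in M. ennreal \<bar>Y i \<omega> - Yt i \<omega>\<bar> \<le> ennreal ((2 * C + 1) * exp (T * Ky / e)) *
    (ennreal_powr (nn_cond_exp M (G i) (\<lambda>\<omega>. ennreal (\<bar>Y n \<omega> - Yt n \<omega>\<bar> powr q)) \<omega>) (1 / q) +
     ennreal_powr (nn_cond_exp M (G i) (\<lambda>\<omega>. ennreal ((\<Sum>j=i..<n. \<bar>\<zeta> j \<omega>\<bar>) powr q)) \<omega>) (1 / q))"
proof -
  interpret i: finite_measure_subalgebra M "G i" using i by (rule finite_measure_subalgebra_G)
  let ?W = "weight \<gamma> i" and ?X = "\<lambda>\<omega>. \<bar>Y n \<omega> - Yt n \<omega>\<bar>" and ?S = "\<lambda>\<omega>. \<Sum>j=i..<n. \<bar>\<zeta> j \<omega>\<bar>"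
  let ?N = "\<lambda>X \<omega>. ennreal_powr (nn_cond_exp M (G i) (\<lambda>\<omega>. ennreal (X \<omega> powr q)) \<omega>) (1 / q)"
  have [measurable]: "?W \<in> borel_measurable M" by (rule weight_meas[OF \<gamma> i])
  have X: "?X \<in> borel_measurable M"
    using solution_integrable[OF sol[unfolded scheme_solution_def] int(1), of n]
      solution_integrable[OF solt int(2,3), of n] by simp
  have S: "?S \<in> borel_measurable M"
    using int(3) by (intro borel_measurable_sum borel_measurable_abs borel_measurable_integrable) auto
  note [measurable] = measurable_compose[OF X measurable_ennreal] measurable_compose[OF S measurable_ennreal]
  have W: "AE \<omega> in M. 0 \<le> ?W \<omega>"
    using weight_pos[OF \<gamma> i] by eventually_elim simp
  have prod: "AE \<omega> in M. nn_cond_exp M (G i) (\<lambda>\<omega>. ennreal (?W \<omega>) * ennreal (R \<omega>)) \<omega>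
      \<le> ennreal (2 * C + 1) * ?N R \<omega>"
    if R: "R \<in> borel_measurable M" "\<And>\<omega>. 0 \<le> R \<omega>" for R
  proof -
    have "AE \<omega> in M. nn_cond_exp M (G i) (\<lambda>\<omega>. ennreal (?W \<omega> * R \<omega>)) \<omega> \<le> ennreal (2 * C + 1) * ?N R \<omega>"
      using R by (intro i.nn_cond_exp_Holder[OF pq C _ _ W _ RH]) auto
    then show ?thesis using R by (simp add: ennreal_mult'')
  qed
  have "AE \<omega> in M. nn_cond_exp M (G i) (\<lambda>\<omega>. ennreal (?W \<omega>) * ennreal (?X \<omega>)) \<omega> +
      nn_cond_exp M (G i) (\<lambda>\<omega>. ennreal (?W \<omega>) * ennreal (?S \<omega>)) \<omega> =
      nn_cond_exp M (G i) (\<lambda>\<omega>. ennreal (?W \<omega>) * ennreal (?X \<omega>) + ennreal (?W \<omega>) * ennreal (?S \<omega>)) \<omega>"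
    by (intro i.nn_cond_exp_sum borel_measurable_times_ennreal measurable_compose[OF X measurable_ennreal]
        measurable_compose[OF S measurable_ennreal]) measurable
  moreover have "(\<lambda>\<omega>. ennreal (?W \<omega>) * ennreal (?X \<omega>) + ennreal (?W \<omega>) * ennreal (?S \<omega>)) =
      (\<lambda>\<omega>. ennreal (?W \<omega>) * ennreal (?X \<omega> + ?S \<omega>))"
    by (simp add: ennreal_plus distrib_left sum_nonneg)
  ultimately have "AE \<omega> in M. nn_cond_exp M (G i) (\<lambda>\<omega>. ennreal (?W \<omega>) * ennreal (?X \<omega>)) \<omega> +
      nn_cond_exp M (G i) (\<lambda>\<omega>. ennreal (?W \<omega>) * ennreal (?S \<omega>)) \<omega> =
      nn_cond_exp M (G i) (\<lambda>\<omega>. ennreal (?W \<omega>) * ennreal (?X \<omega> + ?S \<omega>)) \<omega>"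
    by simp
  moreover have "AE \<omega> in M. nn_cond_exp M (G i) (\<lambda>\<omega>. ennreal (?W \<omega>) * ennreal (?X \<omega>)) \<omega>
      \<le> ennreal (2 * C + 1) * ?N ?X \<omega>"
    by (rule prod[OF X]) simp
  moreover have "AE \<omega> in M. nn_cond_exp M (G i) (\<lambda>\<omega>. ennreal (?W \<omega>) * ennreal (?S \<omega>)) \<omega>
      \<le> ennreal (2 * C + 1) * ?N ?S \<omega>"
    by (rule prod[OF S]) (simp add: sum_nonneg)
  moreover have "AE \<omega> in M. ennreal \<bar>Y i \<omega> - Yt i \<omega>\<bar> \<le> ennreal (exp ((T - t i) * Ky / e)) *
      nn_cond_exp M (G i) (\<lambda>\<omega>. ennreal (?W \<omega>) * ennreal (?X \<omega> + ?S \<omega>)) \<omega>"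
    unfolding \<gamma>_def by (rule stability[OF sol solt int \<zeta> i])
  ultimately have "AE \<omega> in M. ennreal \<bar>Y i \<omega> - Yt i \<omega>\<bar> \<le>
      ennreal (exp ((T - t i) * Ky / e)) * (ennreal (2 * C + 1) * ?N ?X \<omega> + ennreal (2 * C + 1) * ?N ?S \<omega>)"
  proof eventually_elim
    case (elim \<omega>)
    show ?case
      by (rule order_trans[OF elim(4)], unfold elim(1)[symmetric])
        (use elim(2,3) in \<open>intro mult_left_mono add_mono, auto\<close>)
  qed
  then show ?thesis
  proof eventually_elim
    case (elim \<omega>)
    let ?A = "ennreal (2 * C + 1) * (?N ?X \<omega> + ?N ?S \<omega>)"
    have "(T - t i) * Ky / e \<le> T * Ky / e"
      using t_range[OF i] constants by (intro divide_right_mono mult_right_mono) auto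
    then have "ennreal (exp ((T - t i) * Ky / e)) * ?A \<le> ennreal (exp (T * Ky / e)) * ?A"
      by (intro mult_right_mono ennreal_leI) auto
    moreover have "ennreal ((2 * C + 1) * exp (T * Ky / e)) = ennreal (exp (T * Ky / e)) * ennreal (2 * C + 1)"
      using C by (simp add: ennreal_mult mult.commute)
    ultimately show ?case
      using elim by (simp add: distrib_left mult.assoc)
  qed
qed

text \<open>The growth condition gives \<open>|\<gamma>| \<le> L * (1 + |Z| + |Zt|)\<close>, hence a
  bracket majorant with three parts: the step sizes sum to at most \<open>T\<close>, the part in
  \<open>Z\<close> is bounded by \<open>CZ\<close> through the drift of \<open>exp (k * Y)\<close>,
  the part in \<open>Zt\<close> by the assumed \<open>C0\<close>. The summand 1 in \<open>B\<close>
  ensures \<open>1 \<le> B\<close>.\<close>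

lemma reverse_Holder_solution:
  fixes Y Yt \<zeta> :: "nat \<Rightarrow> 'a \<Rightarrow> real" and Z Zt :: "nat \<Rightarrow> 'a \<Rightarrow> real ^ 'd"
    and B0 B C0 C1 Ct CZ L k c0 p :: real
  defines "\<gamma> \<equiv> \<lambda>j \<omega>. linearization (F j \<omega>) (Yt j \<omega>) (Z j \<omega>) (Zt j \<omega>)"
    and "B \<equiv> 1 + exp (T * Ky / e) * (B0 + T * Ct)"
    and "c0 \<equiv> lmax / CARD('d)"
  defines "C1 \<equiv> k * (Ct + Ky * B) + 2 * (1 + 1 / e) * c0 * L\<^sup>2"
  defines "CZ \<equiv> exp (k * B) * exp (k * B) + T * (C1 * exp (2 * (k * B)))"
  assumes sol: "scheme_solution M \<F> n t H F \<xi> Y Z"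
    and solt: "perturbed_scheme_solution M \<F> n t H F \<xi>t \<zeta> Yt Zt"
    and \<xi>: "\<xi> \<in> borel_measurable M" "AE \<omega> in M. \<bar>\<xi> \<omega>\<bar> \<le> B0" "0 \<le> B0"
    and F0: "\<And>i. i < n \<Longrightarrow> AE \<omega> in M. \<bar>F i \<omega> 0 0\<bar> \<le> Ct" "0 \<le> Ct"
    and growth: "\<And>i. i < n \<Longrightarrow> AE \<omega> in M. \<forall>y z z'.
        \<bar>F i \<omega> y z - F i \<omega> y z'\<bar> \<le> L * (1 + norm z + norm z') * norm (z - z')" "0 \<le> L"
    and Zt: "\<And>i. i < n \<Longrightarrow> AE \<omega> in M. nn_cond_exp M (G i)
        (\<lambda>\<omega>. ennreal (\<Sum>j=i..<n. (norm (Zt j \<omega>))\<^sup>2 * step t j)) \<omega> \<le> ennreal C0" "0 \<le> C0"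
    and k: "1 \<le> k" "1 + 2 * (1 + 1 / e) * c0 * L\<^sup>2 \<le> e * k / (10 * B) / c0" and c0: "0 < c0"
    and p: "1 \<le> p" "p \<le> 2" "p - 1 \<le> e / 2"
      "2 * (p - 1) \<le> exp (- (8 / e + 1) * (3 * c0 * L\<^sup>2 * (T + CZ + C0)))"
    and i: "i \<le> n"
  shows "AE \<omega> in M. nn_cond_exp M (G i) (\<lambda>\<omega>. ennreal (weight \<gamma> i \<omega> powr p)) \<omega> \<le> 2"
proof -
  define b where "b = 3 * c0 * L\<^sup>2"
  have b: "0 \<le> b" using c0 by (simp add: b_def)
  have B: "1 \<le> B" using \<xi> F0 T_nonneg by (simp add: B_def)
  have C1: "0 \<le> C1"
  proof -
    have "0 \<le> Ct + Ky * B" using F0(2) B constants by simp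
    then have "0 \<le> k * (Ct + Ky * B)" using k(1) by simp
    then show ?thesis using c0 constants by (simp add: C1_def)
  qed
  have CZ: "0 \<le> CZ" using C1 T_nonneg by (simp add: CZ_def)
  have adapted: "Z i \<in> borel_measurable (G i)" "Yt i \<in> borel_measurable (G i)" "Zt i \<in> borel_measurable (G i)"
    if "i < n" for i
    using sol solt that by (auto simp: scheme_solution_def perturbed_scheme_solution_def)
  have \<gamma>: "admissible \<gamma>"
    unfolding \<gamma>_def by (rule admissible_linearization) (auto intro: adapted)
  have Y: "AE \<omega> in M. \<bar>Y i \<omega>\<bar> \<le> B" if "i \<le> n" for i
  proof -
    have "AE \<omega> in M. \<bar>Y i \<omega>\<bar> \<le> exp (T * Ky / e) * (B0 + T * Ct)"
      by (rule solution_bounded[OF sol \<xi> _ F0(2) that]) (fact F0(1))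
    then show ?thesis by eventually_elim (simp add: B_def)
  qed
  let ?s = "\<lambda>j \<omega>. step t j * (norm (Z j \<omega>))\<^sup>2" and ?st = "\<lambda>j \<omega>. (norm (Zt j \<omega>))\<^sup>2 * step t j"
  have c0_eq: "c0 = lmax / CARD('d)" by (simp add: c0_def)
  have Z_int: "integrable M (?s j)" if "j < n" for j
    by (rule Z_sum_bounded(1)[OF sol _ _ _ B k(1) growth(2) F0(2) c0_eq c0 k(2) that])
      (fact Y F0(1) growth(1))+
  have Z_sum: "AE \<omega> in M. real_cond_exp M (G i) (\<lambda>\<omega>. \<Sum>j=i..<n. ?s j \<omega>) \<omega>
      \<le> exp (k * B) * (exp (k * B) - exp (k * Y i \<omega>)) + (T - t i) * (C1 * exp (2 * (k * B)))"
    if "i \<le> n" for i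
    unfolding C1_def
    by (rule Z_sum_bounded(2)[OF sol _ _ _ B k(1) growth(2) F0(2) c0_eq c0 k(2) that])
      (fact Y F0(1) growth(1))+
  have st_meas: "?st j \<in> borel_measurable M" if "j < n" for j
  proof -
    have [measurable]: "Zt j \<in> borel_measurable M"
      using that by (intro measurable_G[OF adapted(3)[OF that]]) simp
    show ?thesis by measurable
  qed
  have st_sum: "integrable M (\<lambda>\<omega>. \<Sum>j=i..<n. ?st j \<omega>)"
    "AE \<omega> in M. real_cond_exp M (G i) (\<lambda>\<omega>. \<Sum>j=i..<n. ?st j \<omega>) \<omega> \<le> C0" if i: "i < n" for i
  proof -
    interpret finite_measure_subalgebra M "G i" using i by (intro finite_measure_subalgebra_G) simp
    have "(\<lambda>\<omega>. \<Sum>j=i..<n. ?st j \<omega>) \<in> borel_measurable M"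
      using st_meas by (intro borel_measurable_sum) auto
    moreover have "0 \<le> (\<Sum>j=i..<n. ?st j \<omega>)" for \<omega>
      using step_pos by (intro sum_nonneg mult_nonneg_nonneg) (auto intro: less_imp_le)
    ultimately have "integrable M (\<lambda>\<omega>. \<Sum>j=i..<n. ?st j \<omega>) \<and>
        (AE \<omega> in M. real_cond_exp M (G i) (\<lambda>\<omega>. \<Sum>j=i..<n. ?st j \<omega>) \<omega> \<le> C0)"
      using nn_cond_exp_boundedD[OF _ _ Zt(2) Zt(1)[OF i]] by blast
    then show "integrable M (\<lambda>\<omega>. \<Sum>j=i..<n. ?st j \<omega>)"
      "AE \<omega> in M. real_cond_exp M (G i) (\<lambda>\<omega>. \<Sum>j=i..<n. ?st j \<omega>) \<omega> \<le> C0"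
      by blast+
  qed
  \<comment> \<open>The assumption concerns sums only; a single term is dominated by the sum that
    starts with it.\<close>
  have st_int: "integrable M (?st j)" if j: "j < n" for j
  proof (rule Bochner_Integration.integrable_bound[OF st_sum(1)[OF j] st_meas[OF j]])
    show "AE \<omega> in M. norm (?st j \<omega>) \<le> norm (\<Sum>j=j..<n. ?st j \<omega>)"
    proof (rule AE_I2)
      fix \<omega>
      have nonneg: "0 \<le> ?st l \<omega>" if "l < n" for l
        using step_pos[OF that] by simp
      have "?st j \<omega> \<le> (\<Sum>j=j..<n. ?st j \<omega>)"
        using j nonneg by (intro member_le_sum) auto
      then show "norm (?st j \<omega>) \<le> norm (\<Sum>j=j..<n. ?st j \<omega>)"
        using nonneg[OF j] by simp
    qed
  qed
  \<comment> \<open>The 3 in \<open>b\<close> comes from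
    \<open>(1 + u + v)^2 \<le> 3 * (1 + u^2 + v^2)\<close>.\<close>
  define g where "g = (\<lambda>j \<omega>. b * (step t j + ?s j \<omega> + ?st j \<omega>))"
  show ?thesis
  proof (rule reverse_Holder[OF \<gamma>, where g = g and C = "b * (T + CZ + C0)" and k = "8 / e + 1"])
    show "g j \<in> borel_measurable (G j)" if "j < n" for j
      unfolding g_def using adapted[OF that] by measurable
    show "integrable M (g j)" if "j < n" for j
      unfolding g_def using Z_int[OF that] st_int[OF that] by auto
    show "AE \<omega> in M. step t j * c j * (norm (\<gamma> j \<omega>))\<^sup>2 \<le> g j \<omega>" if j: "j < n" for j
      using growth(1)[OF j]
    proof eventually_elim
      case (elim \<omega>)
      define u v where "u = norm (Z j \<omega>)" and "v = norm (Zt j \<omega>)"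
      have "norm (\<gamma> j \<omega>) \<le> L * (1 + u + v)"
        unfolding \<gamma>_def u_def v_def using elim growth(2) by (intro norm_linearization_le) auto
      then have "(norm (\<gamma> j \<omega>))\<^sup>2 \<le> (L * (1 + u + v))\<^sup>2" by (intro power_mono) auto
      also have "\<dots> = L\<^sup>2 * (1 + u + v)\<^sup>2" by (simp add: power_mult_distrib)
      also have "\<dots> \<le> L\<^sup>2 * (3 * (1 + u\<^sup>2 + v\<^sup>2))"
      proof (rule mult_left_mono)
        have "0 \<le> (1 - u)\<^sup>2 + (1 - v)\<^sup>2 + (u - v)\<^sup>2" by simp
        then show "(1 + u + v)\<^sup>2 \<le> 3 * (1 + u\<^sup>2 + v\<^sup>2)"
          by (simp add: power2_eq_square algebra_simps)
      qed simp
      finally have le: "(norm (\<gamma> j \<omega>))\<^sup>2 \<le> L\<^sup>2 * (3 * (1 + u\<^sup>2 + v\<^sup>2))" .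
      have "c j \<le> c0" using coefficient_bounds(2)[OF j] by (simp add: c0_def)
      then have "step t j * c j * (norm (\<gamma> j \<omega>))\<^sup>2 \<le> step t j * c0 * (L\<^sup>2 * (3 * (1 + u\<^sup>2 + v\<^sup>2)))"
        using step_pos[OF j] coefficient_bounds(1)[OF j] c0 le by (intro mult_mono) auto
      then show ?case by (simp add: g_def b_def u_def v_def algebra_simps)
    qed
    show "0 \<le> b * (T + CZ + C0)" using b CZ T_nonneg Zt(2) by simp
    show "AE \<omega> in M. real_cond_exp M (G i) (\<lambda>\<omega>. \<Sum>j=i..<n. g j \<omega>) \<omega> \<le> b * (T + CZ + C0)" if i: "i < n" for i
    proof -
      interpret finite_measure_subalgebra M "G i" using i by (intro finite_measure_subalgebra_G) simp
      let ?S = "\<lambda>\<omega>. \<Sum>j=i..<n. ?s j \<omega>" and ?St = "\<lambda>\<omega>. \<Sum>j=i..<n. ?st j \<omega>"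
      have "integrable M ?S"
        using Z_int by (intro Bochner_Integration.integrable_sum) auto
      then have "has_cond_exp M (G i) (\<lambda>\<omega>. b * ((T - t i) + ?S \<omega> + ?St \<omega>))
          (\<lambda>\<omega>. b * ((T - t i) + real_cond_exp M (G i) ?S \<omega> + real_cond_exp M (G i) ?St \<omega>))"
        using st_sum(1)[OF i]
        by (intro has_cond_exp_cmult has_cond_exp_add has_cond_expI has_cond_exp_self) auto
      moreover have "(\<lambda>\<omega>. b * ((T - t i) + ?S \<omega> + ?St \<omega>)) = (\<lambda>\<omega>. \<Sum>j=i..<n. g j \<omega>)"
        using sum_step[of i] i by (simp add: g_def sum.distrib flip: sum_distrib_left)
      ultimately have "AE \<omega> in M. real_cond_exp M (G i) (\<lambda>\<omega>. \<Sum>j=i..<n. g j \<omega>) \<omega> =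
          b * ((T - t i) + real_cond_exp M (G i) ?S \<omega> + real_cond_exp M (G i) ?St \<omega>)"
        by (simp add: has_cond_exp_def)
      moreover have "AE \<omega> in M. real_cond_exp M (G i) ?S \<omega>
          \<le> exp (k * B) * (exp (k * B) - exp (k * Y i \<omega>)) + (T - t i) * (C1 * exp (2 * (k * B)))"
        using i by (intro Z_sum) auto
      ultimately show ?thesis
        using st_sum(2)[OF i]
      proof eventually_elim
        case (elim \<omega>)
        have "exp (k * B) * (exp (k * B) - exp (k * Y i \<omega>)) \<le> exp (k * B) * exp (k * B)"
          by (intro mult_left_mono) auto
        moreover have "(T - t i) * (C1 * exp (2 * (k * B))) \<le> T * (C1 * exp (2 * (k * B)))"
          using t_range[of i] i C1 by (intro mult_right_mono) auto
        ultimately have "real_cond_exp M (G i) ?S \<omega> \<le> CZ"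
          using elim(2) unfolding CZ_def by linarith
        then have "(T - t i) + real_cond_exp M (G i) ?S \<omega> + real_cond_exp M (G i) ?St \<omega> \<le> T + CZ + C0"
          using elim(3) t_range[of i] i by linarith
        then show ?case unfolding elim(1) using b by (intro mult_left_mono) auto
      qed
    qed
    show "2 * (p - 1) \<le> exp (- (8 / e + 1) * (b * (T + CZ + C0)))"
      using p(4) by (simp add: b_def)
  qed (use p i in auto)
qed

end

section \<open>Choice of constants and exponents common to all grids\<close>

lemma subalgebra_brownian_filtration_mono:
  assumes "r \<le> s"
  shows "subalgebra (brownian_filtration M W s) (brownian_filtration M W r)"
proof -
  let ?G = "\<lambda>t. {W s -` A \<inter> space M | s A. s \<in> {0..t} \<and> A \<in> sets borel} \<union> null_sets M"
  have "?G t \<subseteq> Pow (space M)" for t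
    using sets.sets_into_space by (auto dest: null_setsD2)
  then have "sets (brownian_filtration M W t) = sigma_sets (space M) (?G t)"
    "space (brownian_filtration M W t) = space M" for t
    unfolding brownian_filtration_def by (simp_all add: sets_measure_of space_measure_of_conv)
  moreover have "sigma_sets (space M) (?G r) \<subseteq> sigma_sets (space M) (?G s)"
    using assms by (intro sigma_sets_mono') fastforce
  ultimately show ?thesis by (simp add: subalgebra_def)
qed

theorem corollary2p1:
  fixes M :: "'a measure" and W :: "real \<Rightarrow> 'a \<Rightarrow> real ^ 'd"
    and T c1 c2 \<theta> lmin lmax Ky \<epsilon> Ct Lt \<Lambda>t C0 B\<xi> :: real
    and Kz :: "nat \<Rightarrow> real"
    and t :: "nat \<Rightarrow> nat \<Rightarrow> real"
    and c :: "nat \<Rightarrow> nat \<Rightarrow> real"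
    and H :: "nat \<Rightarrow> nat \<Rightarrow> 'a \<Rightarrow> real ^ 'd"
    and F :: "nat \<Rightarrow> nat \<Rightarrow> 'a \<Rightarrow> real \<Rightarrow> real ^ 'd \<Rightarrow> real"
    and \<xi> \<xi>t :: "nat \<Rightarrow> 'a \<Rightarrow> real"
    and \<sigma> \<zeta> Y Yt :: "nat \<Rightarrow> nat \<Rightarrow> 'a \<Rightarrow> real"
    and Z Zt :: "nat \<Rightarrow> nat \<Rightarrow> 'a \<Rightarrow> real ^ 'd"
  assumes T: "0 < T"
    and W: "brownian_motion M T W"
    and constants: "0 < c1" "0 < c2" "1 \<le> \<theta>" "0 < lmin" "0 < lmax" "0 < Ky" "0 < \<epsilon>" "\<epsilon> < 1"
      "0 < Ct" "0 < Lt" "0 < \<Lambda>t" "0 \<le> C0" "\<And>n. n \<ge> 1 \<Longrightarrow> 0 < Kz n"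
    and grid: "\<And>n. n \<ge> 1 \<Longrightarrow> time_grid T n (t n)"
      "\<And>n. n \<ge> 1 \<Longrightarrow> mesh n (t n) * real n \<le> c1"
      "\<And>n i. n \<ge> 1 \<Longrightarrow> i < n \<Longrightarrow> c2 \<le> step (t n) i * real n powr \<theta>"
    and H: "\<And>n. n \<ge> 1 \<Longrightarrow>
      scheme_coefficients M (brownian_filtration M W) n (t n) lmin lmax (c n) (H n)"
    and a_terminal: "\<And>n. n \<ge> 1 \<Longrightarrow> \<xi> n \<in> borel_measurable (brownian_filtration M W T)"
      "\<And>n. n \<ge> 1 \<Longrightarrow> AE \<omega> in M. \<bar>\<xi> n \<omega>\<bar> \<le> B\<xi>"
    and a_measurable: "\<And>n i. n \<ge> 1 \<Longrightarrow> i < n \<Longrightarrow>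
      (\<lambda>(\<omega>, y, z). F n i \<omega> y z)
        \<in> borel_measurable (brownian_filtration M W (t n i) \<Otimes>\<^sub>M (borel \<Otimes>\<^sub>M borel))"
    and a_lipschitz: "\<And>n i. n \<ge> 1 \<Longrightarrow> i < n \<Longrightarrow>
      AE \<omega> in M. \<forall>y y' z z'.
        \<bar>F n i \<omega> y z - F n i \<omega> y' z'\<bar> \<le> Ky * \<bar>y - y'\<bar> + Kz n * norm (z - z')"
    and b: "\<And>n. n \<ge> 1 \<Longrightarrow> mesh n (t n) * Ky < 1 - \<epsilon>"
      "\<And>n. n \<ge> 1 \<Longrightarrow>
        AE \<omega> in M. (MAX i\<in>{..<n}. step (t n) i * norm (H n i \<omega>)) * Kz n < 1 - \<epsilon>"
    and c: "\<And>n i. n \<ge> 1 \<Longrightarrow> i < n \<Longrightarrow> AE \<omega> in M. \<bar>F n i \<omega> 0 0\<bar> \<le> Ct"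
    and d: "\<And>n i. n \<ge> 1 \<Longrightarrow> i < n \<Longrightarrow> \<sigma> n i \<in> borel_measurable M"
      "\<And>n i. n \<ge> 1 \<Longrightarrow> i < n \<Longrightarrow>
        AE \<omega> in M. \<forall>y z. \<bar>F n i \<omega> y z\<bar> \<le> Ky * \<bar>y\<bar> + Lt * (norm z)\<^sup>2 + \<sigma> n i \<omega>"
      "\<And>n i. n \<ge> 1 \<Longrightarrow> i < n \<Longrightarrow>
        AE \<omega> in M. nn_cond_exp M (brownian_filtration M W (t n i))
          (\<lambda>\<omega>'. ennreal (\<Sum>k=i..<n. step (t n) k * \<bar>\<sigma> n k \<omega>'\<bar>)) \<omega> \<le> ennreal \<Lambda>t"
    and e: "\<And>n i. n \<ge> 1 \<Longrightarrow> i < n \<Longrightarrow>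
      AE \<omega> in M. \<forall>y z z'.
        \<bar>F n i \<omega> y z - F n i \<omega> y z'\<bar> \<le> Lt * (1 + norm z + norm z') * norm (z - z')"
    and solution: "\<And>n. n \<ge> 1 \<Longrightarrow>
      scheme_solution M (brownian_filtration M W) n (t n) (H n) (F n) (\<xi> n) (Y n) (Z n)"
    and perturbed_terminal:
      "\<And>n. n \<ge> 1 \<Longrightarrow> \<xi>t n \<in> borel_measurable (brownian_filtration M W T)"
      "\<And>n. n \<ge> 1 \<Longrightarrow> \<exists>B. AE \<omega> in M. \<bar>\<xi>t n \<omega>\<bar> \<le> B"
    and perturbation:
      "\<And>n i. n \<ge> 1 \<Longrightarrow> i < n \<Longrightarrow> \<zeta> n i \<in> borel_measurable (brownian_filtration M W (t n i))"
      "\<And>n i. n \<ge> 1 \<Longrightarrow> i < n \<Longrightarrow> integrable M (\<lambda>\<omega>. (\<zeta> n i \<omega>)\<^sup>2)"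
    and perturbed_solution: "\<And>n. n \<ge> 1 \<Longrightarrow>
      perturbed_scheme_solution M (brownian_filtration M W) n (t n) (H n) (F n) (\<xi>t n) (\<zeta> n)
        (Yt n) (Zt n)"
    and perturbed_bound: "\<And>n i. n \<ge> 1 \<Longrightarrow> i < n \<Longrightarrow>
      AE \<omega> in M. nn_cond_exp M (brownian_filtration M W (t n i))
        (\<lambda>\<omega>'. ennreal (\<Sum>j=i..<n. (norm (Zt n j \<omega>'))\<^sup>2 * step (t n) j)) \<omega> \<le> ennreal C0"
  shows "\<exists>C>0. \<exists>p>1. \<exists>q>1. \<exists>C'>0. 1 / p + 1 / q = 1 \<and>
    (\<forall>n\<ge>1.
      (let D = discrete_exponential n (t n) (H n)
                 (\<lambda>j \<omega>. linearization (F n j \<omega>) (Yt n j \<omega>) (Z n j \<omega>) (Zt n j \<omega>))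
       in \<forall>s\<in>{0..T}. AE \<omega> in M.
            nn_cond_exp M (brownian_filtration M W s)
              (\<lambda>\<omega>'. ennreal (D T \<omega>' powr p / D s \<omega>' powr p)) \<omega> \<le> ennreal C') \<and>
      (\<forall>i\<le>n. AE \<omega> in M.
        ennreal \<bar>Y n i \<omega> - Yt n i \<omega>\<bar> \<le>
          ennreal C *
            (ennreal_powr
               (nn_cond_exp M (brownian_filtration M W (t n i))
                  (\<lambda>\<omega>'. ennreal (\<bar>Y n n \<omega>' - Yt n n \<omega>'\<bar> powr q)) \<omega>) (1 / q) +
             ennreal_powr
               (nn_cond_exp M (brownian_filtration M W (t n i))
                  (\<lambda>\<omega>'. ennreal ((\<Sum>j=i..<n. \<bar>\<zeta> n j \<omega>'\<bar>) powr q)) \<omega>) (1 / q))))"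
proof -
  define c0 where "c0 = lmax / CARD('d)"
  \<comment> \<open>The absolute value makes the bound nonnegative whatever the sign of
    \<open>B\<xi>\<close>.\<close>
  define B where "B = 1 + exp (T * Ky / \<epsilon>) * (\<bar>B\<xi>\<bar> + T * Ct)"
  \<comment> \<open>The condition under which the drift dominates \<open>h * |Z|^2\<close>, solved
    for \<open>k\<close>.\<close>
  define k where "k = max 1 ((1 + 2 * (1 + 1 / \<epsilon>) * c0 * Lt\<^sup>2) * c0 * (10 * B) / \<epsilon>)"
  define C1 where "C1 = k * (Ct + Ky * B) + 2 * (1 + 1 / \<epsilon>) * c0 * Lt\<^sup>2"
  define CZ where "CZ = exp (k * B) * exp (k * B) + T * (C1 * exp (2 * (k * B)))"
  \<comment> \<open>The two smallness conditions on \<open>p - 1\<close> in the reverse Hoelder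
    step. Neither \<open>n\<close> nor \<open>Kz n\<close> occurs in these definitions, so
    \<open>p\<close> and its conjugate \<open>q\<close> serve all grids.\<close>
  define \<eta> where "\<eta> = min (\<epsilon> / 2) (exp (- (8 / \<epsilon> + 1) * (3 * c0 * Lt\<^sup>2 * (T + CZ + C0))) / 2)"
  define p where "p = 1 + \<eta>"
  define q where "q = p / (p - 1)"
  have c0: "0 < c0" using constants by (simp add: c0_def)
  have B: "1 \<le> B" using T constants by (simp add: B_def)
  have k: "1 \<le> k" "1 + 2 * (1 + 1 / \<epsilon>) * c0 * Lt\<^sup>2 \<le> \<epsilon> * k / (10 * B) / c0"
  proof -
    have "(1 + 2 * (1 + 1 / \<epsilon>) * c0 * Lt\<^sup>2) * c0 * (10 * B) / \<epsilon> \<le> k" by (simp add: k_def)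
    then have "(1 + 2 * (1 + 1 / \<epsilon>) * c0 * Lt\<^sup>2) * c0 * (10 * B) \<le> \<epsilon> * k"
      using constants by (simp only: pos_divide_le_eq mult.commute[of k])
    then show "1 + 2 * (1 + 1 / \<epsilon>) * c0 * Lt\<^sup>2 \<le> \<epsilon> * k / (10 * B) / c0"
      using c0 B by (subst pos_le_divide_eq[OF c0], subst pos_le_divide_eq) auto
  qed (simp add: k_def)
  have \<eta>: "0 < \<eta>" "\<eta> \<le> \<epsilon> / 2"
      "\<eta> \<le> exp (- (8 / \<epsilon> + 1) * (3 * c0 * Lt\<^sup>2 * (T + CZ + C0))) / 2"
    using constants by (auto simp: \<eta>_def)
  have p: "1 < p" "p \<le> 2" "p - 1 \<le> \<epsilon> / 2"
      "2 * (p - 1) \<le> exp (- (8 / \<epsilon> + 1) * (3 * c0 * Lt\<^sup>2 * (T + CZ + C0)))"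
    using \<eta> constants by (auto simp: p_def)
  have q: "1 < q" "1 / p + 1 / q = 1" using p by (auto simp: q_def field_simps)
  have prob: "prob_space M" using W by (simp add: brownian_motion_def)
  interpret prob_space M by (rule prob)
  let ?F = "brownian_filtration M W"
  have meas_F: "f \<in> measurable (?F s) N \<Longrightarrow> s \<le> T \<Longrightarrow> f \<in> measurable M N" for f s and N :: "'b measure"
    using measurable_from_subalg[OF subalgebra_brownian_filtration[OF W]] by blast
  have main: "(\<forall>s\<in>{0..T}. AE \<omega> in M. nn_cond_exp M (?F s)
        (\<lambda>\<omega>'. ennreal (discrete_exponential n (t n) (H n)
            (\<lambda>j \<omega>. linearization (F n j \<omega>) (Yt n j \<omega>) (Z n j \<omega>) (Zt n j \<omega>)) T \<omega>' powr p
          / discrete_exponential n (t n) (H n)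
            (\<lambda>j \<omega>. linearization (F n j \<omega>) (Yt n j \<omega>) (Z n j \<omega>) (Zt n j \<omega>)) s \<omega>' powr p)) \<omega> \<le> ennreal 8) \<and>
      (\<forall>i\<le>n. AE \<omega> in M. ennreal \<bar>Y n i \<omega> - Yt n i \<omega>\<bar> \<le> ennreal (5 * exp (T * Ky / \<epsilon>)) *
        (ennreal_powr (nn_cond_exp M (?F (t n i)) (\<lambda>\<omega>'. ennreal (\<bar>Y n n \<omega>' - Yt n n \<omega>'\<bar> powr q)) \<omega>) (1 / q) +
         ennreal_powr (nn_cond_exp M (?F (t n i)) (\<lambda>\<omega>'. ennreal ((\<Sum>j=i..<n. \<bar>\<zeta> n j \<omega>'\<bar>) powr q)) \<omega>) (1 / q)))"
    if n: "1 \<le> n" for n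
  proof -
    note params = constants
    interpret bsde_scheme M ?F T n "t n" lmin lmax "c n" "H n" "F n" Ky "Kz n" \<epsilon>
      by unfold_locales
        (use n constants grid H a_measurable a_lipschitz b in
          \<open>auto intro: subalgebra_brownian_filtration[OF W] subalgebra_brownian_filtration_mono\<close>)
    let ?\<gamma> = "\<lambda>j \<omega>. linearization (F n j \<omega>) (Yt n j \<omega>) (Z n j \<omega>) (Zt n j \<omega>)"
    have \<xi>: "\<xi> n \<in> borel_measurable M" "AE \<omega> in M. \<bar>\<xi> n \<omega>\<bar> \<le> \<bar>B\<xi>\<bar>"
      using a_terminal(1)[OF n] a_terminal(2)[OF n] by (auto intro: meas_F elim: eventually_mono)
    have \<xi>_int: "integrable M (\<xi> n)"
      using \<xi> by (intro integrable_const_bound[of _ "\<bar>B\<xi>\<bar>"]) auto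
    obtain B' where "AE \<omega> in M. \<bar>\<xi>t n \<omega>\<bar> \<le> B'" using perturbed_terminal(2)[OF n] by blast
    then have \<xi>t_int: "integrable M (\<xi>t n)"
      using perturbed_terminal(1)[OF n] by (intro integrable_const_bound[of _ B']) (auto intro: meas_F)
    have \<zeta>_int: "integrable M (\<zeta> n i)" if "i < n" for i
    proof (rule square_integrable_imp_integrable[OF _ perturbation(2)[OF n that]])
      show "\<zeta> n i \<in> borel_measurable M"
        using that by (intro measurable_G[OF perturbation(1)[OF n that]]) simp
    qed
    have RH: "AE \<omega> in M. nn_cond_exp M (G i) (\<lambda>\<omega>. ennreal (weight ?\<gamma> i \<omega> powr p)) \<omega> \<le> 2" if "i \<le> n" for i
      by (rule reverse_Holder_solution[where ?B0.0 = "\<bar>B\<xi>\<bar>" and Ct = Ct and L = Lt and ?C0.0 = C0 and k = k,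
            OF solution[OF n] perturbed_solution[OF n] \<xi>, folded c0_def, folded B_def, folded C1_def, folded CZ_def])
        (use n c e perturbed_bound params k c0 p that in auto)
    have \<gamma>: "admissible ?\<gamma>"
      using solution[OF n] perturbed_solution[OF n]
      by (intro admissible_linearization) (auto simp: scheme_solution_def perturbed_scheme_solution_def)
    have "AE \<omega> in M. nn_cond_exp M (?F s) (\<lambda>\<omega>'. ennreal (discrete_exponential n (t n) (H n) ?\<gamma> T \<omega>' powr p
          / discrete_exponential n (t n) (H n) ?\<gamma> s \<omega>' powr p)) \<omega> \<le> ennreal 8" if "s \<in> {0..T}" for s
      using reverse_Holder_continuous_time[OF \<gamma> _ _ RH, of s] p that by simp
    moreover have "AE \<omega> in M. ennreal \<bar>Y n i \<omega> - Yt n i \<omega>\<bar> \<le> ennreal (5 * exp (T * Ky / \<epsilon>)) *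
        (ennreal_powr (nn_cond_exp M (?F (t n i)) (\<lambda>\<omega>'. ennreal (\<bar>Y n n \<omega>' - Yt n n \<omega>'\<bar> powr q)) \<omega>) (1 / q) +
         ennreal_powr (nn_cond_exp M (?F (t n i)) (\<lambda>\<omega>'. ennreal ((\<Sum>j=i..<n. \<bar>\<zeta> n j \<omega>'\<bar>) powr q)) \<omega>) (1 / q))"
      if "i \<le> n" for i
      \<comment> \<open>The reverse Hoelder constant on the grid is 2, hence the factor
        \<open>2 * 2 + 1 = 5\<close>.\<close>
      using stability_Holder[OF solution[OF n] perturbed_solution[OF n] \<xi>_int \<xi>t_int \<zeta>_int
          perturbation(1)[OF n] p(1) q(1) q(2) _ \<gamma> _ that, of 2] RH[OF that] by simp
    ultimately show ?thesis by blast
  qed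
  show ?thesis
    unfolding Let_def
    by (rule exI[of _ "5 * exp (T * Ky / \<epsilon>)"], rule conjI, simp, rule exI[of _ p], rule conjI, rule p(1),
        rule exI[of _ q], rule conjI, rule q(1), rule exI[of _ 8], rule conjI, simp, rule conjI, rule q(2))
      (use main in blast)
qed

end
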